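(* Let $\beta,\gamma\in(0,1)$ and $\rho>0$. There exist constants $c_1,c_2,c_3,c_4,c_5>0$, depending only on $\beta,\gamma,\rho$, such that the following holds. Let $\delta,\varepsilon\in(0,1)$, $\alpha\in(0,1)$ with $\alpha<c_1$, $\nu=c_2\varepsilon$, $K=\lceil c_3/(\delta^2\alpha^3)\rceil$, $L=\lceil 2eK\rceil$, and $n\geq c_4/(\delta^5\alpha^9)$. Let $A$ be a deterministic $n\times n$ real matrix with $\|A\|=1$, let $V$ be an $n$-dimensional pattern matrix with parameters $\alpha,\beta,\gamma,\rho$, let $R_1,R_2$ be from the $n$-dimensional oblivious perturbation model with pattern matrix $V$ and parameters $\rho,K,L$, and let $M=A+\varepsilon(R_1+R_2)$. Then $$\mathbb{P}\Big(\kappa(M)\leq \frac{c_5\,n}{\varepsilon^3\delta^2\alpha^3}\Big)\geq 1-\delta.$$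
   Context: $\kappa(M)=\|M\|\,\|M^{-1}\|$ is the condition number ($\infty$ if $M$ is singular); $\|\cdot\|$ the spectral norm; $[n]=\{1,\dots,n\}$. Pattern matrix: for $\alpha,\beta,\gamma\in(0,1)$, $\rho>0$, an $n\times n$ matrix $V$ with entries in $\{-1,1\}$ with (i) $\|V\|\leq\rho\sqrt n$ and (ii) for every $\eta\in\{-1,1\}^n$ and every $x\in S^{n-1}$ with at most $\alpha n$ nonzero coordinates, $|\{j:|e_j^\top V\mathrm{diag}(\eta)x|\geq\beta\}|\geq\gamma n$ and $|\{j:|e_j^\top V^\top\mathrm{diag}(\eta)x|\geq\beta\}|\geq\gamma n$. Oblivious perturbation model (mutually independent random objects): $\eta_{k,i}$ ($k=1,2$, $i\in[n]$) i.i.d. Rademacher, $D_k=\mathrm{diag}(\eta_{k,1},\dots,\eta_{k,n})$, $R_1=(\rho\sqrt n)^{-1}D_1VD_2$; $J_1,\dots,J_n$ independent uniformly random $K$-subsets of $[n]$; $\bar h_{j,i}=\mathbf 1[j\in J_i]$; $H$ is $\bar H$ with each row having more than $L$ nonzeros replaced by zero; $X_{l,i}$ ($l\in[K],i\in[n]$) i.i.d. Rademacher; with $J_i=\{j(i,1)<\dots<j(i,K)\}$, $\bar R_2$ has entry $X_{l,i}/L$ at $(j(i,l),i)$ and $0$ elsewhere; $R_2=H\odot\bar R_2$ (entrywise product). *)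

theory Defs
  imports
    "HOL-Probability.Product_PMF"
    "HOL-Library.Extended_Real"
    "Jordan_Normal_Form.Gauss_Jordan_Elimination"
begin

unbundle no vec_syntax

text \<open>
  Vectors and matrices are those of \<open>Jordan_Normal_Form.Matrix\<close>, whose dimensions are ordinary
  natural numbers; the index set \<open>[n]\<close> is rendered as \<open>{..<n}\<close>.
\<close>

definition vec_l2_norm :: "real vec \<Rightarrow> real" where
  "vec_l2_norm x = sqrt (scalar_prod x x)"

text \<open>
  The supremum runs over the closed unit ball rather than the unit sphere so that it is never taken
  over the empty set (for matrices without columns the norm is \<open>0\<close>).
\<close>

definition spectral_norm :: "real mat \<Rightarrow> real" where
  "spectral_norm A =
     (SUP x \<in> {x \<in> carrier_vec (dim_col A). vec_l2_norm x \<le> 1}. vec_l2_norm (A *\<^sub>v x))"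

definition condition_number :: "real mat \<Rightarrow> ereal" where
  "condition_number M =
     (case mat_inverse M of
        None \<Rightarrow> \<infinity>
      | Some M' \<Rightarrow> ereal (spectral_norm M * spectral_norm M'))"

definition hadamard_prod :: "real mat \<Rightarrow> real mat \<Rightarrow> real mat" where
  "hadamard_prod A B = mat (dim_row A) (dim_col A) (\<lambda>(i, j). A $$ (i, j) * B $$ (i, j))"

definition pattern_matrix ::
  "nat \<Rightarrow> real \<Rightarrow> real \<Rightarrow> real \<Rightarrow> real \<Rightarrow> real mat \<Rightarrow> bool" where
  "pattern_matrix n \<alpha> \<beta> \<gamma> \<rho> V \<longleftrightarrow>
     V \<in> carrier_mat n n \<and>
     (\<forall>i<n. \<forall>j<n. V $$ (i, j) \<in> {-1, 1}) \<and>
     spectral_norm V \<le> \<rho> * sqrt (real n) \<and>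
     (\<forall>\<eta> :: nat \<Rightarrow> real. \<forall>x \<in> carrier_vec n.
        (\<forall>i<n. \<eta> i \<in> {-1, 1}) \<and> vec_l2_norm x = 1 \<and>
        real (card {i. i < n \<and> x $ i \<noteq> 0}) \<le> \<alpha> * real n \<longrightarrow>
        real (card {j. j < n \<and> \<bar>((V * mat_diag n \<eta>) *\<^sub>v x) $ j\<bar> \<ge> \<beta>}) \<ge> \<gamma> * real n \<and>
        real (card {j. j < n \<and> \<bar>((transpose_mat V * mat_diag n \<eta>) *\<^sub>v x) $ j\<bar> \<ge> \<beta>})
          \<ge> \<gamma> * real n)"

definition R1_mat :: "nat \<Rightarrow> real mat \<Rightarrow> real \<Rightarrow> (nat \<times> nat \<Rightarrow> real) \<Rightarrow> real mat" where
  "R1_mat n V \<rho> \<eta> =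
     inverse (\<rho> * sqrt (real n)) \<cdot>\<^sub>m
       (mat_diag n (\<lambda>i. \<eta> (1, i)) * V * mat_diag n (\<lambda>i. \<eta> (2, i)))"

definition H_bar_mat :: "nat \<Rightarrow> (nat \<Rightarrow> nat set) \<Rightarrow> real mat" where
  "H_bar_mat n J = mat n n (\<lambda>(j, i). if j \<in> J i then 1 else 0)"

definition H_mat :: "nat \<Rightarrow> nat \<Rightarrow> (nat \<Rightarrow> nat set) \<Rightarrow> real mat" where
  "H_mat n L J = mat n n (\<lambda>(j, i).
     if card {i'. i' < n \<and> H_bar_mat n J $$ (j, i') \<noteq> 0} > L then 0 else H_bar_mat n J $$ (j, i))"

text \<open>
  \<open>sorted_list_of_set (J i) ! l\<close> is \<open>j(i, l + 1)\<close> in one-based notation, since \<open>l\<close> ranges over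
  \<open>{..<K}\<close>. At most one \<open>l\<close> contributes to the sum in each entry.
\<close>

definition R2_bar_mat ::
  "nat \<Rightarrow> nat \<Rightarrow> nat \<Rightarrow> (nat \<Rightarrow> nat set) \<Rightarrow> (nat \<times> nat \<Rightarrow> real) \<Rightarrow> real mat" where
  "R2_bar_mat n K L J X = mat n n (\<lambda>(j, i).
     \<Sum>l | l < K \<and> sorted_list_of_set (J i) ! l = j. X (l, i) / real L)"

definition R2_mat ::
  "nat \<Rightarrow> nat \<Rightarrow> nat \<Rightarrow> (nat \<Rightarrow> nat set) \<Rightarrow> (nat \<times> nat \<Rightarrow> real) \<Rightarrow> real mat" where
  "R2_mat n K L J X = hadamard_prod (H_mat n L J) (R2_bar_mat n K L J X)"

definition rademacher_pmf :: "real pmf" where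
  "rademacher_pmf = pmf_of_set {-1, 1}"

text \<open>
  The joint law of \<open>(R\<^sub>1, R\<^sub>2)\<close>. It is meaningful only for \<open>K \<le> n\<close>, as otherwise \<open>{..<n}\<close> has no
  \<open>K\<close>-subsets. The second arguments of \<^const>\<open>Pi_pmf\<close> are values outside the index range, which
  do not influence the matrices.
\<close>

definition oblivious_perturbation ::
  "nat \<Rightarrow> real mat \<Rightarrow> real \<Rightarrow> nat \<Rightarrow> nat \<Rightarrow> (real mat \<times> real mat) pmf" where
  "oblivious_perturbation n V \<rho> K L =
     map_pmf (\<lambda>(\<eta>, J, X). (R1_mat n V \<rho> \<eta>, R2_mat n K L J X))
       (pair_pmf (Pi_pmf ({1, 2} \<times> {..<n}) 0 (\<lambda>_. rademacher_pmf))
         (pair_pmf (Pi_pmf {..<n} {} (\<lambda>_. pmf_of_set {S. S \<subseteq> {..<n} \<and> card S = K}))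
           (Pi_pmf ({..<K} \<times> {..<n}) 0 (\<lambda>_. rademacher_pmf))))"

end

theory Submission
  imports Defs "Jordan_Normal_Form.Determinant"
begin

text \<open>
  If a unit vector \<open>x\<close> is contracted by \<open>M\<close>, then many coordinates of \<open>x\<close> are of order at least
  \<open>\<epsilon> / sqrt n\<close>: otherwise \<open>x\<close> is close to a sparse vector, and the random signs of \<open>R\<^sub>1\<close> keep the image
  of every sparse unit vector large in a positive fraction of the rows. The latter needs no net over
  sparse vectors, because only the sign pattern of finitely many affine forms matters, and the
  Sauer-Shelah lemma bounds the number of these patterns uniformly in \<open>\<epsilon>\<close>.

  The norm of \<open>M x\<close> is at least \<open>\<bar>x\<^sub>k\<bar>\<close> times the distance of column \<open>k\<close> from the span of the other
  columns. By the same argument applied to the transpose, the unit normal \<open>u\<close> to the other columns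
  has at least \<open>\<alpha> n\<close> coordinates of order \<open>\<epsilon> / sqrt n\<close>; about \<open>\<alpha> K\<close> of them are hit by the random support
  of column \<open>k\<close> of \<open>R\<^sub>2\<close>, and the Littlewood-Offord inequality bounds from below the inner product of
  \<open>u\<close> with that column, up to an event of probability \<open>O(\<delta> \<alpha>)\<close>. Markov's inequality then leaves fewer
  than \<open>\<alpha> n\<close> exceptional columns, so some large coordinate of \<open>x\<close> belongs to a good column.
\<close>

section \<open>Sign patterns of linear forms\<close>

text \<open>Truncating crowded rows couples the columns of R2: the other columns depend on the
  support of column \<open>k\<close>, so their normal is not independent of it. The normal is
  therefore computed with that support emptied. It stays normal to the true columns unless column
  \<open>k\<close> meets a row that already has \<open>L\<close> other entries, which a Chernoff
  bound makes rare when L \<ge> 2eK. The size of \<open>K\<close> is forced by Markov's inequality: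
  with a threshold of \<alpha>n exceptional columns, each column may fail with probability at most
  of order \<delta>\<alpha>. Littlewood-Offord on order \<alpha>K signs gives order
  (\<alpha>K)^(-1/2), hence K of order \<delta>^(-2) \<alpha>^(-3). The condition on \<alpha>
  compares about exp(6 sqrt(\<alpha>) n) supports and sign patterns with the probability
  exp(-\<gamma>n/20) that a fixed pattern fails. Of the three factors \<epsilon> in the final bound,
  one is the coefficient of R2; the other two come from the large coordinates of \<open>x\<close>
  and of \<open>u\<close>, both of order \<epsilon>/sqrt(n). The factor \<open>L\<close>, of order
  \<open>K\<close>, comes from the entries X/L.\<close>

lemma linear_system_nontrivial_solution:
  fixes f :: "'a \<Rightarrow> 'b \<Rightarrow> real"
  assumes "finite E" "finite U" "card E < card U"
  shows "\<exists>c. (\<exists>j\<in>U. c j \<noteq> 0) \<and> (\<forall>i\<in>E. (\<Sum>j\<in>U. c j * f j i) = 0)"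
  using assms
proof (induction E arbitrary: U f rule: finite_induct)
  case empty
  then obtain j where "j \<in> U" by fastforce
  then show ?case by (intro exI[of _ "\<lambda>_. 1"]) auto
next
  case (insert e E)
  show ?case
  proof (cases "\<forall>j\<in>U. f j e = 0")
    case True
    have "card E < card U" using insert by simp
    from insert.IH[OF insert.prems(1) this, of f] obtain c
      where c: "\<exists>j\<in>U. c j \<noteq> 0" "\<forall>i\<in>E. (\<Sum>j\<in>U. c j * f j i) = 0" by blast
    have "(\<Sum>j\<in>U. c j * f j e) = 0" using True by simp
    then show ?thesis using c by (intro exI[of _ c]) auto
  next
    case False
    then obtain p where p: "p \<in> U" "f p e \<noteq> 0" by blast
    \<comment> \<open>Gaussian elimination with pivot \<open>f p e\<close>: solving equation
      \<open>e\<close> for the unknown \<open>p\<close> and substituting leaves the coefficients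
      \<open>g\<close>. The value of \<open>d\<close> at \<open>p\<close> below is the back
      substitution.\<close>
    define g where "g j i = f j i - f j e / f p e * f p i" for j i
    have "card E < card (U - {p})" using insert p by simp
    from insert.IH[OF _ this, of g] insert.prems(1) obtain c
      where c: "\<exists>j\<in>U - {p}. c j \<noteq> 0" "\<forall>i\<in>E. (\<Sum>j\<in>U - {p}. c j * g j i) = 0" by auto
    define d where "d = c(p := - (\<Sum>j\<in>U - {p}. c j * (f j e / f p e)))"
    have d: "(\<Sum>j\<in>U. d j * f j i) = (\<Sum>j\<in>U - {p}. c j * g j i)" for i
    proof -
      have "(\<Sum>j\<in>U. d j * f j i) = d p * f p i + (\<Sum>j\<in>U - {p}. d j * f j i)"
        using insert.prems(1) p(1) by (rule sum.remove)
      also have "(\<Sum>j\<in>U - {p}. d j * f j i) = (\<Sum>j\<in>U - {p}. c j * f j i)"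
        by (intro sum.cong) (auto simp: d_def)
      also have "d p * f p i = - (\<Sum>j\<in>U - {p}. c j * (f j e / f p e) * f p i)"
        by (simp add: d_def sum_distrib_right)
      finally show ?thesis
        by (simp add: g_def right_diff_distrib sum_subtractf mult.assoc)
    qed
    have "(\<Sum>j\<in>U. d j * f j e) = 0" using p by (simp add: d g_def)
    moreover have "\<exists>j\<in>U. d j \<noteq> 0" using c(1) by (auto simp: d_def)
    ultimately show ?thesis using c(2) by (intro exI[of _ d]) (auto simp: d)
  qed
qed

definition shatters :: "'a set set \<Rightarrow> 'a set \<Rightarrow> bool" where
  "shatters F S \<longleftrightarrow> (\<forall>T\<subseteq>S. \<exists>X\<in>F. X \<inter> S = T)"

lemma shatters_mono: "F \<subseteq> G \<Longrightarrow> shatters F S \<Longrightarrow> shatters G S"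
  unfolding shatters_def by (meson subsetD)

text \<open>Pajor's form of the Sauer-Shelah lemma. Split \<open>F\<close> at a point
  \<open>u\<close> into the sets that avoid it, \<open>G\<close>, and the traces of those that
  contain it, \<open>H\<close>. A set shattered by either part is shattered by \<open>F\<close>; one
  shattered by both stays shattered after adding \<open>u\<close>, so it is counted twice on the
  right as well.\<close>

lemma card_le_card_shattered:
  assumes "finite U" "F \<subseteq> Pow U"
  shows "card F \<le> card {S. S \<subseteq> U \<and> shatters F S}"
  using assms
proof (induction U arbitrary: F rule: finite_induct)
  case empty
  show ?case
  proof (cases "F = {}")
    case False
    then have "F = {{}}" using empty by auto
    then have "{S. S \<subseteq> {} \<and> shatters F S} = {{}}" by (auto simp: shatters_def)
    then show ?thesis using \<open>F = {{}}\<close> by simp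
  qed simp
next
  case (insert u U)
  define G where "G = {X \<in> F. u \<notin> X}"
  define P where "P = {S. S \<subseteq> U \<and> shatters G S}"
  define H where "H = (\<lambda>X. X - {u}) ` {X \<in> F. u \<in> X}"
  define Q where "Q = {S. S \<subseteq> U \<and> shatters H S}"
  have PQ: "P \<subseteq> Pow U" "Q \<subseteq> Pow U" by (auto simp: P_def Q_def)
  have G: "G \<subseteq> Pow U" and H: "H \<subseteq> Pow U" using insert.prems by (auto simp: G_def H_def)
  have finF: "finite F" using insert by (meson finite_Pow_iff finite_insert finite_subset)
  have "card (G \<union> {X \<in> F. u \<in> X}) = card G + card {X \<in> F. u \<in> X}"
    using finF by (intro card_Un_disjoint) (auto simp: G_def)
  moreover have "G \<union> {X \<in> F. u \<in> X} = F" by (auto simp: G_def)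
  ultimately have "card F = card G + card {X \<in> F. u \<in> X}" by simp
  also have "card {X \<in> F. u \<in> X} = card H"
    unfolding H_def by (intro card_image[symmetric] inj_onI) blast
  also have "card G + card H \<le> card P + card Q"
    unfolding P_def Q_def by (intro add_mono insert.IH G H)
  also have "\<dots> = card (P \<union> Q) + card (P \<inter> Q)"
    using PQ by (intro card_Un_Int) (meson finite_Pow_iff finite_subset insert.hyps(1))+
  also have "card (P \<inter> Q) = card (insert u ` (P \<inter> Q))"
    using PQ insert.hyps(2)
    by (intro card_image[symmetric] inj_onI) (metis Diff_insert_absorb IntD1 PowD subsetD)
  also have "card (P \<union> Q) + \<dots> = card ((P \<union> Q) \<union> insert u ` (P \<inter> Q))"
  proof (intro card_Un_disjoint[symmetric])
    show "finite (P \<union> Q)" "finite (insert u ` (P \<inter> Q))"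
      using PQ insert.hyps(1) by (meson finite_Pow_iff finite_subset finite_Un finite_Int finite_imageI)+
    show "(P \<union> Q) \<inter> insert u ` (P \<inter> Q) = {}" using PQ insert.hyps(2) by blast
  qed
  also have "\<dots> \<le> card {S. S \<subseteq> insert u U \<and> shatters F S}"
  proof (rule card_mono)
    show "finite {S. S \<subseteq> insert u U \<and> shatters F S}" using insert.hyps(1) by simp
    have "shatters F S" if S: "S \<subseteq> U" "shatters H S" for S
      unfolding shatters_def
    proof (intro allI impI)
      fix T assume "T \<subseteq> S"
      then obtain X where X: "X \<in> H" "X \<inter> S = T" using S(2) unfolding shatters_def by meson
      then obtain Y where Y: "Y \<in> F" "X = Y - {u}" by (auto simp: H_def)
      have "Y \<inter> S = T" using X Y S insert.hyps(2) by blast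
      then show "\<exists>X\<in>F. X \<inter> S = T" using Y(1) by blast
    qed
    moreover have "shatters F S" if "shatters G S" for S
      using that by (rule shatters_mono[rotated]) (auto simp: G_def)
    moreover have "shatters F (insert u S)" if S: "S \<subseteq> U" "shatters G S" "shatters H S" for S
      unfolding shatters_def
    proof (intro allI impI)
      fix T assume T: "T \<subseteq> insert u S"
      show "\<exists>X\<in>F. X \<inter> insert u S = T"
      proof (cases "u \<in> T")
        case True
        have "T - {u} \<subseteq> S" using T by auto
        then obtain X where X: "X \<in> H" "X \<inter> S = T - {u}"
          using S(3) unfolding shatters_def by meson
        then obtain Y where Y: "Y \<in> F" "u \<in> Y" "X = Y - {u}" by (auto simp: H_def)
        have "Y \<inter> insert u S = T" using X Y S insert.hyps(2) True by blast
        then show ?thesis using Y(1) by blast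
      next
        case False
        then have "T \<subseteq> S" using T by auto
        then obtain X where X: "X \<in> G" "X \<inter> S = T"
          using S(2) unfolding shatters_def by meson
        then have "X \<in> F" "X \<inter> insert u S = T" by (auto simp: G_def)
        then show ?thesis by blast
      qed
    qed
    ultimately show "(P \<union> Q) \<union> insert u ` (P \<inter> Q) \<subseteq> {S. S \<subseteq> insert u U \<and> shatters F S}"
      unfolding P_def Q_def by blast
  qed
  finally show ?case .
qed

lemma card_subsets_le:
  assumes "finite U"
  shows "card {S. S \<subseteq> U \<and> card S \<le> d} = (\<Sum>i\<le>d. card U choose i)"
proof -
  have "{S. S \<subseteq> U \<and> card S \<le> d} = (\<Union>i\<le>d. {S. S \<subseteq> U \<and> card S = i})" by auto
  then have "card {S. S \<subseteq> U \<and> card S \<le> d} = card (\<Union>i\<le>d. {S. S \<subseteq> U \<and> card S = i})" by simp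
  also have "\<dots> = (\<Sum>i\<le>d. card {S. S \<subseteq> U \<and> card S = i})"
    using assms by (intro card_UN_disjoint) auto
  also have "\<dots> = (\<Sum>i\<le>d. card U choose i)" using assms by (simp add: n_subsets)
  finally show ?thesis .
qed

text \<open>
  A linear dependency among the forms indexed by a shattered set is contradicted by a point that
  is positive exactly on the forms with positive coefficient.
\<close>

lemma card_positivity_patterns_le:
  fixes f :: "'a \<Rightarrow> 'b \<Rightarrow> real"
  assumes "finite U" "finite E"
  shows "card ((\<lambda>x. {j\<in>U. (\<Sum>i\<in>E. x i * f j i) > 0}) ` Z) \<le> (\<Sum>i\<le>card E. card U choose i)"
proof -
  define pos where "pos x = {j\<in>U. (\<Sum>i\<in>E. x i * f j i) > 0}" for x :: "'b \<Rightarrow> real"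
  have "card S \<le> card E" if S: "S \<subseteq> U" "shatters (pos ` Z) S" for S
  proof (rule ccontr)
    assume "\<not> card S \<le> card E"
    then have "card E < card S" by simp
    from linear_system_nontrivial_solution[OF assms(2) finite_subset[OF S(1) assms(1)] this, of f]
    obtain c where c: "\<exists>j\<in>S. c j \<noteq> 0" "\<forall>i\<in>E. (\<Sum>j\<in>S. c j * f j i) = 0" by blast
    \<comment> \<open>A dependency may be negated, so some coefficient can be taken positive; this
      coefficient makes the inequality derived below strict.\<close>
    obtain c' where c': "\<exists>j\<in>S. c' j > 0" "\<forall>i\<in>E. (\<Sum>j\<in>S. c' j * f j i) = 0"
    proof (cases "\<exists>j\<in>S. c j > 0")
      case True
      then show ?thesis using that c by blast
    next
      case False
      then have "\<exists>j\<in>S. - c j > 0" using c(1) by force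
      moreover have "\<forall>i\<in>E. (\<Sum>j\<in>S. - c j * f j i) = 0" using c(2) by (simp add: sum_negf)
      ultimately show ?thesis using that[of "\<lambda>j. - c j"] by simp
    qed
    have "{j\<in>S. c' j > 0} \<subseteq> S" by auto
    then have "\<exists>X\<in>pos ` Z. X \<inter> S = {j\<in>S. c' j > 0}"
      using S(2) unfolding shatters_def by meson
    then obtain x where x: "pos x \<inter> S = {j\<in>S. c' j > 0}" by blast
    have xj: "(\<Sum>i\<in>E. x i * f j i) > 0 \<longleftrightarrow> c' j > 0" if "j \<in> S" for j
      using x that S(1) by (auto simp: pos_def)
    have "0 < (\<Sum>j\<in>S. c' j * (\<Sum>i\<in>E. x i * f j i))"
    proof -
      obtain j0 where j0: "j0 \<in> S" "c' j0 > 0" using c' by blast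
      show ?thesis
      proof (rule sum_pos2[OF finite_subset[OF S(1) assms(1)] j0(1)])
        show "0 < c' j0 * (\<Sum>i\<in>E. x i * f j0 i)" using j0 xj by simp
        show "0 \<le> c' j * (\<Sum>i\<in>E. x i * f j i)" if "j \<in> S" for j
          using xj[OF that] by (cases "c' j > 0") (auto simp: not_less mult_nonpos_nonpos)
      qed
    qed
    also have "(\<Sum>j\<in>S. c' j * (\<Sum>i\<in>E. x i * f j i)) = (\<Sum>j\<in>S. \<Sum>i\<in>E. x i * (c' j * f j i))"
      by (simp add: sum_distrib_left mult_ac)
    also have "\<dots> = (\<Sum>i\<in>E. x i * (\<Sum>j\<in>S. c' j * f j i))"
      by (subst sum.swap) (simp add: sum_distrib_left)
    also have "\<dots> = 0" using c'(2) by simp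
    finally show False by simp
  qed
  then have "{S. S \<subseteq> U \<and> shatters (pos ` Z) S} \<subseteq> {S. S \<subseteq> U \<and> card S \<le> card E}" by blast
  then have "card {S. S \<subseteq> U \<and> shatters (pos ` Z) S} \<le> card {S. S \<subseteq> U \<and> card S \<le> card E}"
    using assms(1) by (intro card_mono) auto
  moreover have "card (pos ` Z) \<le> card {S. S \<subseteq> U \<and> shatters (pos ` Z) S}"
    using assms(1) by (intro card_le_card_shattered) (auto simp: pos_def)
  ultimately show ?thesis using card_subsets_le[OF assms(1)] by (simp add: pos_def[abs_def])
qed

text \<open>Each term is multiplied by t^(i-d) \<ge> 1, after which the binomial theorem sums the
  whole row to (1+t)^N. The parameter \<open>t\<close> is left free and later set to
  sqrt(\<alpha>).\<close>

lemma sum_binomial_le_exp: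
  fixes t :: real
  assumes "0 < t" "t \<le> 1"
  shows "real (\<Sum>i\<le>d. N choose i) \<le> (1 / t) ^ d * exp (t * N)"
proof -
  have "real (\<Sum>i\<le>d. N choose i) = (\<Sum>i\<in>{..d} \<inter> {..N}. real (N choose i))"
    by (simp, intro sum.mono_neutral_right) auto
  also have "\<dots> \<le> (\<Sum>i\<in>{..d} \<inter> {..N}. (1 / t) ^ d * (real (N choose i) * t ^ i))"
  proof (intro sum_mono)
    fix i assume "i \<in> {..d} \<inter> {..N}"
    then have "t ^ d \<le> t ^ i" using assms by (auto intro!: power_decreasing)
    then have "1 \<le> (1 / t) ^ d * t ^ i" using assms by (simp add: power_divide field_simps)
    then show "real (N choose i) \<le> (1 / t) ^ d * (real (N choose i) * t ^ i)"
      using mult_left_mono[of 1 "(1 / t) ^ d * t ^ i" "real (N choose i)"] by (simp add: mult_ac)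
  qed
  also have "\<dots> \<le> (\<Sum>i\<le>N. (1 / t) ^ d * (real (N choose i) * t ^ i))"
    using assms by (intro sum_mono2) auto
  also have "\<dots> = (1 / t) ^ d * (t + 1) ^ N"
    by (subst binomial_ring) (simp add: sum_distrib_left)
  also have "(t + 1) ^ N \<le> exp t ^ N"
    using assms exp_ge_add_one_self[of t] by (intro power_mono) (simp_all add: add.commute)
  also have "exp t ^ N = exp (t * N)" by (simp add: exp_of_nat_mult[symmetric] mult.commute)
  finally show ?thesis using assms by (simp add: mult_left_mono)
qed

section \<open>Sparse vectors\<close>

lemma prob_bind_pmf_le:
  assumes "\<And>y. y \<in> set_pmf q \<Longrightarrow> measure_pmf.prob (f y) E \<le> b" and "0 \<le> b"
  shows "measure_pmf.prob (bind_pmf q f) E \<le> b"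
proof -
  have "emeasure (bind_pmf q f) E = (\<integral>\<^sup>+y. emeasure (f y) E \<partial>q)"
    by (rule emeasure_bind_pmf)
  also have "\<dots> \<le> (\<integral>\<^sup>+y. ennreal b \<partial>q)"
    using assms by (intro nn_integral_mono_AE AE_pmfI)
      (simp add: measure_pmf.emeasure_eq_measure ennreal_leI)
  also have "\<dots> = ennreal b" by simp
  finally show ?thesis using assms(2) by (simp add: measure_pmf.emeasure_eq_measure)
qed

lemma prob_pair_pmf_le_fst:
  assumes "\<And>y. y \<in> set_pmf q \<Longrightarrow> measure_pmf.prob p {x. E (x, y)} \<le> b" and "0 \<le> b"
  shows "measure_pmf.prob (pair_pmf p q) {z. E z} \<le> b"
proof -
  have "pair_pmf p q = bind_pmf q (\<lambda>y. map_pmf (\<lambda>x. (x, y)) p)"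
    unfolding pair_pmf_def map_pmf_def by (rule bind_commute_pmf)
  then show ?thesis using assms by (auto intro!: prob_bind_pmf_le simp: vimage_def)
qed

lemma prob_pair_pmf_le_snd:
  assumes "\<And>x. x \<in> set_pmf p \<Longrightarrow> measure_pmf.prob q {y. E (x, y)} \<le> b" and "0 \<le> b"
  shows "measure_pmf.prob (pair_pmf p q) {z. E z} \<le> b"
proof -
  have "pair_pmf p q = bind_pmf p (\<lambda>x. map_pmf (\<lambda>y. (x, y)) q)"
    unfolding pair_pmf_def map_pmf_def by (rule refl)
  then show ?thesis using assms by (auto intro!: prob_bind_pmf_le simp: vimage_def)
qed

lemma prob_Pi_pmf_resample_le:
  assumes "finite A" "B \<subseteq> A" "0 \<le> b"
    and "\<And>f. (\<And>x. x \<in> A - B \<Longrightarrow> f x \<in> set_pmf (p x)) \<Longrightarrow>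
      measure_pmf.prob (Pi_pmf B d p) {g. E (\<lambda>x. if x \<in> B then g x else f x)} \<le> b"
  shows "measure_pmf.prob (Pi_pmf A d p) {f. E f} \<le> b"
proof -
  have "A = B \<union> (A - B)" using assms(2) by auto
  moreover have "Pi_pmf (B \<union> (A - B)) d p = map_pmf (\<lambda>(f, g) x. if x \<in> B then f x else g x)
             (pair_pmf (Pi_pmf B d p) (Pi_pmf (A - B) d p))"
    using assms(1,2) by (intro Pi_pmf_union) (auto intro: finite_subset)
  ultimately have "Pi_pmf A d p = map_pmf (\<lambda>(f, g) x. if x \<in> B then f x else g x)
             (pair_pmf (Pi_pmf B d p) (Pi_pmf (A - B) d p))" by simp
  then have "measure_pmf.prob (Pi_pmf A d p) {f. E f} =
     measure_pmf.prob (pair_pmf (Pi_pmf B d p) (Pi_pmf (A - B) d p))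
       {z. E (\<lambda>x. if x \<in> B then fst z x else snd z x)}"
    by (simp add: vimage_def case_prod_unfold)
  also have "\<dots> \<le> b"
  proof (rule prob_pair_pmf_le_fst)
    fix f assume "f \<in> set_pmf (Pi_pmf (A - B) d p)"
    then show "measure_pmf.prob (Pi_pmf B d p)
        {x. E (\<lambda>xa. if xa \<in> B then fst (x, f) xa else snd (x, f) xa)} \<le> b"
      unfolding fst_conv snd_conv using assms(1)
      by (intro assms(4)) (auto simp: set_Pi_pmf PiE_dflt_def)
  qed fact
  finally show ?thesis .
qed

section \<open>Rademacher signs, Markov and Chernoff bounds\<close>

lemma set_rademacher_pmf: "set_pmf rademacher_pmf = {-1, 1}"
  by (simp add: rademacher_pmf_def)

lemma expectation_rademacher_pmf:
  "measure_pmf.expectation rademacher_pmf f = (f (-1) + f 1) / (2 :: real)"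
  unfolding rademacher_pmf_def by (subst integral_pmf_of_set) auto

lemma finite_set_Pi_pmf:
  "finite A \<Longrightarrow> (\<And>x. x \<in> A \<Longrightarrow> finite (set_pmf (p x))) \<Longrightarrow> finite (set_pmf (Pi_pmf A d p))"
  by (auto simp: set_Pi_pmf intro!: finite_PiE_dflt)

text \<open>Markov's inequality, stated for a function that dominates \<open>c\<close> on the event,
  so that it serves for counts, squares and exponential moments alike. Finite support makes every
  function integrable.\<close>

lemma prob_le_expectation:
  fixes f :: "'a \<Rightarrow> real"
  assumes "finite (set_pmf p)" "\<And>x. x \<in> set_pmf p \<Longrightarrow> 0 \<le> f x"
    and "\<And>x. x \<in> set_pmf p \<Longrightarrow> P x \<Longrightarrow> c \<le> f x" and "c > 0"
  shows "measure_pmf.prob p {x. P x} \<le> measure_pmf.expectation p f / c"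
proof -
  have "measure_pmf.prob p {x. P x} = measure_pmf.expectation p (indicator {x. P x})" by simp
  also have "\<dots> \<le> measure_pmf.expectation p (\<lambda>x. f x / c)"
    using assms by (intro integral_mono_AE integrable_measure_pmf_finite AE_pmfI)
      (auto simp: indicator_def)
  finally show ?thesis by simp
qed

text \<open>Chernoff bound at parameter 1: the number of agreements has exponential moment
  ((1+1/e)/2)^|T| \<le> exp(-3|T|/10), and the threshold |T|/4 leaves the exponent -3/10 + 1/4 =
  -1/20.\<close>

lemma prob_few_sign_agreements_le:
  fixes \<sigma> :: "'a \<Rightarrow> real" and g :: real
  assumes "finite I" "T \<subseteq> I" "\<And>j. \<sigma> j \<in> {-1, 1}" "g \<le> real (card T)"
  shows "measure_pmf.prob (Pi_pmf I 0 (\<lambda>_. rademacher_pmf)) {\<eta>. real (card {j\<in>T. \<eta> j = \<sigma> j}) < g / 4}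
    \<le> exp (- g / 20)"
proof -
  define h :: "'a \<Rightarrow> real \<Rightarrow> real" where
    "h j v = (if j \<in> T \<and> v = \<sigma> j then exp (-1) else 1)" for j v
  let ?P = "Pi_pmf I 0 (\<lambda>_. rademacher_pmf)"
  have finT: "finite T" using assms finite_subset by blast
  have prodh: "(\<Prod>j\<in>I. h j (\<eta> j)) = exp (- real (card {j\<in>T. \<eta> j = \<sigma> j}))" for \<eta>
  proof -
    have "(\<Prod>j\<in>I. h j (\<eta> j)) = (\<Prod>j\<in>{j\<in>T. \<eta> j = \<sigma> j}. exp (-1))"
      using assms(1,2) by (intro prod.mono_neutral_cong_right) (auto simp: h_def)
    also have "\<dots> = exp (- real (card {j\<in>T. \<eta> j = \<sigma> j}))"
      by (simp add: exp_of_nat_mult[symmetric])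
    finally show ?thesis .
  qed
  have fin: "finite (set_pmf ?P)" using assms(1) by (intro finite_set_Pi_pmf) (simp_all add: set_rademacher_pmf)
  have "measure_pmf.prob ?P {\<eta>. real (card {j\<in>T. \<eta> j = \<sigma> j}) < g / 4}
      \<le> measure_pmf.expectation ?P (\<lambda>\<eta>. \<Prod>j\<in>I. h j (\<eta> j)) / exp (- real (card T) / 4)"
    using fin assms(4) by (intro prob_le_expectation) (auto simp: prodh)
  also have "measure_pmf.expectation ?P (\<lambda>\<eta>. \<Prod>j\<in>I. h j (\<eta> j))
      = (\<Prod>j\<in>I. measure_pmf.expectation rademacher_pmf (h j))"
    using assms(1) by (intro expectation_prod_Pi_pmf integrable_measure_pmf_finite)
      (auto simp: set_rademacher_pmf h_def)
  also have "\<dots> = (\<Prod>j\<in>I. if j \<in> T then (1 + exp (-1)) / 2 else 1)"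
  proof (intro prod.cong refl)
    fix j
    show "measure_pmf.expectation rademacher_pmf (h j) = (if j \<in> T then (1 + exp (-1)) / 2 else 1)"
      using assms(3)[of j] by (subst expectation_rademacher_pmf) (auto simp: h_def)
  qed
  also have "\<dots> = ((1 + exp (-1)) / 2) ^ card T"
    using assms(1,2) by (simp add: prod.If_cases Int_absorb1)
  also have "(1 + exp (-1)) / 2 \<le> exp (- 3 / 10 :: real)"
  proof -
    have "(5 / 2 :: real) \<le> exp 1" using exp_lower_Taylor_quadratic[of 1] by simp
    then have "exp (-1) \<le> (2 / 5 :: real)" by (simp add: exp_minus field_simps)
    then have "(1 + exp (-1)) / 2 \<le> 1 + (- 3 / 10 :: real)" by simp
    also have "\<dots> \<le> exp (- 3 / 10)" by (rule exp_ge_add_one_self)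
    finally show ?thesis .
  qed
  then have "((1 + exp (-1)) / 2) ^ card T / exp (- real (card T) / 4)
      \<le> exp (- 3 / 10) ^ card T / exp (- real (card T) / 4)"
    by (intro divide_right_mono power_mono) auto
  also have "\<dots> = exp (- real (card T) / 20)"
    by (simp add: exp_of_nat_mult[symmetric] exp_diff[symmetric])
  also have "\<dots> \<le> exp (- g / 20)" using assms(4) by simp
  finally show ?thesis by simp
qed

lemma prob_UN_le_card_mult:
  assumes "finite I" "\<And>i. i \<in> I \<Longrightarrow> measure_pmf.prob p (A i) \<le> b"
  shows "measure_pmf.prob p (\<Union>i\<in>I. A i) \<le> real (card I) * b"
proof -
  have "measure_pmf.prob p (\<Union>i\<in>I. A i) \<le> (\<Sum>i\<in>I. measure_pmf.prob p (A i))"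
    using assms(1) by (intro measure_UNION_le) auto
  also have "\<dots> \<le> (\<Sum>i\<in>I. b)" using assms(2) by (intro sum_mono)
  finally show ?thesis by simp
qed

text \<open>
  Whether a row fails depends only on the position of \<open>x\<close> relative to three affine hyperplanes,
  so the union bound runs over positivity patterns and needs no net.
\<close>

lemma prob_sparse_vector_small_image_le:
  fixes B W :: "'a \<Rightarrow> nat \<Rightarrow> real" and s b g :: real
  assumes "finite I" "0 < s" "0 < b"
    and good: "\<And>x. L2_set x {..<n} = 1 \<Longrightarrow> card {i. i < n \<and> x i \<noteq> 0} \<le> m \<Longrightarrow>
      g \<le> real (card {j\<in>I. b < \<bar>\<Sum>i<n. W j i * x i\<bar>})"
  shows "measure_pmf.prob (Pi_pmf I 0 (\<lambda>_. rademacher_pmf))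
     {\<eta>. \<exists>x. L2_set x {..<n} = 1 \<and> card {i. i < n \<and> x i \<noteq> 0} \<le> m \<and>
       real (card {j\<in>I. s * b \<le> \<bar>(\<Sum>i<n. B j i * x i) + s * \<eta> j * (\<Sum>i<n. W j i * x i)\<bar>}) < g / 4}
    \<le> real (\<Sum>i\<le>m. n choose i) * (real (\<Sum>i\<le>Suc m. (3 * card I) choose i) * exp (- g / 20))"
    (is "measure_pmf.prob ?P ?bad \<le> _")
proof -
  define \<F> where "\<F> = {F. F \<subseteq> {..<n} \<and> card F \<le> m}"
  define U where "U = I \<times> {..<3 :: nat}"
  \<comment> \<open>Row \<open>j\<close> contributes three forms, recording whether (Bx)_j > 0,
    whether (Wx)_j > b, and whether (Wx)_j < -b. The constant -b sits at the extra coordinate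
    \<open>n\<close>, which \<open>Z\<close> fixes to 1; this homogenization turns the dimension
    \<open>m\<close> into \<open>Suc m\<close> in the bound.\<close>
  define f :: "'a \<times> nat \<Rightarrow> nat \<Rightarrow> real" where
    "f = (\<lambda>(j, k) i. if k = 0 then (if i = n then 0 else B j i)
        else if k = 1 then (if i = n then - b else W j i) else (if i = n then - b else - W j i))"
  define pos where "pos F x = {u\<in>U. 0 < (\<Sum>i\<in>insert n F. x i * f u i)}" for F x
  define Z where "Z F = {x. x n = 1 \<and> L2_set x {..<n} = 1 \<and> {i. i < n \<and> x i \<noteq> 0} = F}" for F :: "nat set"
  define T where "T Q = {j\<in>I. (j, 1) \<in> Q \<or> (j, 2) \<in> Q}" for Q :: "('a \<times> nat) set"
  \<comment> \<open>The sign for which the random term has the same sign as (Bx)_j, so that the two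
    cannot cancel and the entry is at least s|(Wx)_j|. It depends on \<open>x\<close> only through
    the pattern \<open>Q\<close>.\<close>
  define \<sigma> :: "('a \<times> nat) set \<Rightarrow> 'a \<Rightarrow> real" where
    "\<sigma> Q j = (if (j, 0) \<in> Q then 1 else -1) * (if (j, 1) \<in> Q then 1 else -1)" for Q j
  define ev where "ev Q = {\<eta> :: 'a \<Rightarrow> real. real (card {j\<in>T Q. \<eta> j = \<sigma> Q j}) < g / 4}" for Q
  have fin\<F>: "finite \<F>" unfolding \<F>_def by simp
  have finU: "finite U" unfolding U_def using assms(1) by simp
  have card\<F>: "card \<F> = (\<Sum>i\<le>m. n choose i)"
    unfolding \<F>_def by (subst card_subsets_le) auto
  have pos_eqs:
    "(j, 0) \<in> pos F x \<longleftrightarrow> 0 < (\<Sum>i<n. B j i * x i)"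
    "(j, 1) \<in> pos F x \<longleftrightarrow> b < (\<Sum>i<n. W j i * x i)"
    "(j, 2) \<in> pos F x \<longleftrightarrow> b < - (\<Sum>i<n. W j i * x i)"
    if "x \<in> Z F" "j \<in> I" for x F j
  proof -
    have F: "F \<subseteq> {..<n}" "n \<notin> F" and fF: "finite F" and x: "x n = 1" and z: "\<And>i. i < n \<Longrightarrow> i \<notin> F \<Longrightarrow> x i = 0"
      using that(1) by (auto simp: Z_def)
    have [simp]: "(\<Sum>i\<in>F. x i * (if i = n then c else h i)) = (\<Sum>i<n. h i * x i)" for h c
    proof -
      have "(\<Sum>i\<in>F. x i * (if i = n then c else h i)) = (\<Sum>i\<in>F. h i * x i)"
        using F by (intro sum.cong) auto
      also have "\<dots> = (\<Sum>i<n. h i * x i)"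
        using F z by (intro sum.mono_neutral_left) auto
      finally show ?thesis .
    qed
    show "(j, 0) \<in> pos F x \<longleftrightarrow> 0 < (\<Sum>i<n. B j i * x i)"
      "(j, 1) \<in> pos F x \<longleftrightarrow> b < (\<Sum>i<n. W j i * x i)"
      "(j, 2) \<in> pos F x \<longleftrightarrow> b < - (\<Sum>i<n. W j i * x i)"
      using that(2) F fF x by (simp_all add: pos_def U_def f_def sum_negf less_minus_iff[of b])
  qed
  have T_eq: "T (pos F x) = {j\<in>I. b < \<bar>\<Sum>i<n. W j i * x i\<bar>}" if "x \<in> Z F" for x F
    using pos_eqs[OF that] by (auto simp: T_def)
  have sub: "?bad \<subseteq> (\<Union>F\<in>\<F>. \<Union>Q\<in>pos F ` Z F. ev Q)"
  proof
    fix \<eta> assume "\<eta> \<in> ?bad"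
    then obtain x where x: "L2_set x {..<n} = 1" "card {i. i < n \<and> x i \<noteq> 0} \<le> m"
       "real (card {j\<in>I. s * b \<le> \<bar>(\<Sum>i<n. B j i * x i) + s * \<eta> j * (\<Sum>i<n. W j i * x i)\<bar>}) < g / 4"
      by auto
    define F where "F = {i. i < n \<and> x i \<noteq> 0}"
    define y where "y = x(n := 1)"
    have yn: "(\<Sum>i<n. h i * y i) = (\<Sum>i<n. h i * x i)" for h
      by (intro sum.cong) (auto simp: y_def)
    have F: "F \<in> \<F>" using x(2) by (auto simp: \<F>_def F_def)
    have "L2_set y {..<n} = L2_set x {..<n}" by (intro L2_set_cong) (auto simp: y_def)
    then have y: "y \<in> Z F" using x(1) by (auto simp: Z_def F_def y_def)
    have "{j\<in>T (pos F y). \<eta> j = \<sigma> (pos F y) j}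
      \<subseteq> {j\<in>I. s * b \<le> \<bar>(\<Sum>i<n. B j i * x i) + s * \<eta> j * (\<Sum>i<n. W j i * x i)\<bar>}"
    proof safe
      fix j assume j: "j \<in> T (pos F y)" "\<eta> j = \<sigma> (pos F y) j"
      then show jI: "j \<in> I" by (simp add: T_def)
      define u where "u = (\<Sum>i<n. B j i * x i)"
      define w where "w = (\<Sum>i<n. W j i * x i)"
      have w: "b < \<bar>w\<bar>" using j(1) T_eq[OF y] by (simp add: yn w_def)
      have \<eta>j: "\<eta> j = (if 0 < u then 1 else -1) * (if b < w then 1 else -1)"
        using j(2) pos_eqs[OF y jI] by (simp add: \<sigma>_def yn u_def w_def)
      have "\<bar>s * w\<bar> \<le> \<bar>u + s * \<eta> j * w\<bar>"
      proof -
        have "\<eta> j * w = (if 0 < u then 1 else -1) * \<bar>w\<bar>"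
          using w assms(3) \<eta>j by (auto simp: abs_if)
        then have e: "s * \<eta> j * w = (if 0 < u then 1 else -1) * (s * \<bar>w\<bar>)" by simp
        show ?thesis unfolding e using assms(2) by (auto simp: abs_mult)
      qed
      moreover have "s * b \<le> \<bar>s * w\<bar>" using w assms(2) by (simp add: abs_mult)
      ultimately show "s * b \<le> \<bar>u + s * \<eta> j * w\<bar>" by simp
    qed
    then have "card {j\<in>T (pos F y). \<eta> j = \<sigma> (pos F y) j}
      \<le> card {j\<in>I. s * b \<le> \<bar>(\<Sum>i<n. B j i * x i) + s * \<eta> j * (\<Sum>i<n. W j i * x i)\<bar>}"
      using assms(1) by (intro card_mono) auto
    then have "\<eta> \<in> ev (pos F y)" using x(3) by (simp add: ev_def)
    then show "\<eta> \<in> (\<Union>F\<in>\<F>. \<Union>Q\<in>pos F ` Z F. ev Q)" using F y by blast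
  qed
  have "measure_pmf.prob ?P ?bad \<le> measure_pmf.prob ?P (\<Union>F\<in>\<F>. \<Union>Q\<in>pos F ` Z F. ev Q)"
    using sub by (intro measure_pmf.finite_measure_mono) auto
  also have "\<dots> \<le> real (card \<F>) * (real (\<Sum>i\<le>Suc m. (3 * card I) choose i) * exp (- g / 20))"
  proof (rule prob_UN_le_card_mult[OF fin\<F>])
    fix F assume F: "F \<in> \<F>"
    have fin: "finite (pos F ` Z F)"
      by (rule finite_subset[of _ "Pow U"]) (use finU in \<open>auto simp: pos_def\<close>)
    have "measure_pmf.prob ?P (\<Union>Q\<in>pos F ` Z F. ev Q) \<le> real (card (pos F ` Z F)) * exp (- g / 20)"
    proof (rule prob_UN_le_card_mult[OF fin])
      fix Q assume "Q \<in> pos F ` Z F"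
      then obtain x where x: "x \<in> Z F" "Q = pos F x" by auto
      have "g \<le> real (card (T Q))"
        unfolding x(2) T_eq[OF x(1)] using x(1) F by (intro good) (auto simp: Z_def \<F>_def)
      then show "measure_pmf.prob ?P (ev Q) \<le> exp (- g / 20)"
        unfolding ev_def using assms(1)
        by (intro prob_few_sign_agreements_le) (auto simp: T_def \<sigma>_def)
    qed
    also have "card (pos F ` Z F) \<le> (\<Sum>i\<le>card (insert n F). card U choose i)"
      unfolding pos_def using F finU
      by (intro card_positivity_patterns_le) (auto simp: \<F>_def intro: finite_subset)
    also have "(\<Sum>i\<le>card (insert n F). card U choose i) \<le> (\<Sum>i\<le>Suc m. card U choose i)"
      using F card_insert_le_m1[of "Suc m" F n] by (intro sum_mono2) (auto simp: \<F>_def)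
    also have "card U = 3 * card I" by (simp add: U_def card_cartesian_product)
    finally show "measure_pmf.prob ?P (\<Union>Q\<in>pos F ` Z F. ev Q)
       \<le> real (\<Sum>i\<le>Suc m. (3 * card I) choose i) * exp (- g / 20)"
      by (simp add: mult_right_mono)
  qed
  finally show ?thesis by (simp add: card\<F>)
qed

section \<open>The Littlewood-Offord inequality\<close>

text \<open>The sum of the \<open>j\<close> largest binomial coefficients \<open>q choose i\<close>.\<close>

definition middle_binomial_sum :: "nat \<Rightarrow> nat \<Rightarrow> nat" where
  "middle_binomial_sum q j = (\<Sum>i | i \<le> q \<and> q < 2 * i + j \<and> 2 * i \<le> q + j. q choose i)"

lemma middle_binomial_sum_alt:
  assumes "q \<le> N"
  shows "middle_binomial_sum q j
    = (\<Sum>i\<le>N. if q < 2 * i + j \<and> 2 * i \<le> q + j then q choose i else 0)"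
proof -
  have "middle_binomial_sum q j = (\<Sum>i | i \<le> N \<and> q < 2 * i + j \<and> 2 * i \<le> q + j. q choose i)"
    unfolding middle_binomial_sum_def using assms by (intro sum.mono_neutral_left) auto
  also have "{i. i \<le> N \<and> q < 2 * i + j \<and> 2 * i \<le> q + j} = {i\<in>{..N}. q < 2 * i + j \<and> 2 * i \<le> q + j}"
    by auto
  finally show ?thesis by (simp only: sum.inter_filter[OF finite_atMost])
qed

text \<open>Pascal's rule turns the centred window of length \<open>j\<close> in row
  \<open>Suc q\<close> into two windows of row \<open>q\<close>, shifted by one against each other.
  Counted with multiplicity, they cover the centred windows of lengths \<open>j + 1\<close> and
  \<open>j - 1\<close>.\<close>

lemma middle_binomial_sum_Suc:
  assumes "1 \<le> j"
  shows "middle_binomial_sum (Suc q) j = middle_binomial_sum q (j + 1) + middle_binomial_sum q (j - 1)"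
proof -
  define P where "P i \<longleftrightarrow> Suc q < 2 * i + j \<and> 2 * i \<le> Suc q + j" for i
  have "middle_binomial_sum (Suc q) j = (\<Sum>i\<le>Suc q. if P i then Suc q choose i else 0)"
    using middle_binomial_sum_alt[of "Suc q" "Suc q" j] by (simp add: P_def)
  also have "\<dots> = (if P 0 then 1 else 0) + (\<Sum>i\<le>q. if P (Suc i) then Suc q choose Suc i else 0)"
    by (subst sum.atMost_Suc_shift) simp
  also have "(\<Sum>i\<le>q. if P (Suc i) then Suc q choose Suc i else 0)
     = (\<Sum>i\<le>q. if P (Suc i) then q choose i else 0) + (\<Sum>i\<le>q. if P (Suc i) then q choose Suc i else 0)"
    by (subst sum.distrib[symmetric], intro sum.cong) auto
  also have "(if P 0 then 1 else 0) + ((\<Sum>i\<le>q. if P (Suc i) then q choose i else 0)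
      + (\<Sum>i\<le>q. if P (Suc i) then q choose Suc i else 0))
     = (\<Sum>i\<le>q. if P (Suc i) then q choose i else 0) + (\<Sum>i\<le>Suc q. if P i then q choose i else 0)"
    using sum.atMost_Suc_shift[of "\<lambda>i. if P i then q choose i else 0" q] by simp
  also have "(\<Sum>i\<le>Suc q. if P i then q choose i else 0) = (\<Sum>i\<le>q. if P i then q choose i else 0)"
    by simp
  also have "(\<Sum>i\<le>q. if P (Suc i) then q choose i else 0) + (\<Sum>i\<le>q. if P i then q choose i else 0)
    = (\<Sum>i\<le>q. (if q < 2 * i + (j + 1) \<and> 2 * i \<le> q + (j + 1) then q choose i else 0))
     + (\<Sum>i\<le>q. (if q < 2 * i + (j - 1) \<and> 2 * i \<le> q + (j - 1) then q choose i else 0))"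
    unfolding sum.distrib[symmetric] using assms by (intro sum.cong refl) (auto simp: P_def)
  also have "\<dots> = middle_binomial_sum q (j + 1) + middle_binomial_sum q (j - 1)"
    by (simp only: middle_binomial_sum_alt[OF order_refl])
  finally show ?thesis .
qed

text \<open>The squared form of C(2k,k) \<le> 4^k / sqrt(2k+1), which stays within the natural
  numbers. The induction step amounts to (2k+1)(2k+3) \<le> (2k+2)^2.\<close>

lemma central_binomial_upper_bound: "((2 * k) choose k)\<^sup>2 * (2 * k + 1) \<le> 16 ^ k"
proof (induction k)
  case (Suc k)
  define c where "c = (2 * k) choose k"
  have rec: "Suc k * ((2 * Suc k) choose Suc k) = 2 * (2 * k + 1) * c"
  proof -
    have "Suc k * ((2 * Suc k) choose Suc k) = (2 * Suc k) * (Suc (2 * k) choose k)"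
      using Suc_times_binomial_eq[of "Suc (2 * k)" k] by simp
    moreover have "Suc k * (Suc (2 * k) choose k) = Suc k * (Suc (2 * k) choose Suc k)"
      using binomial_symmetric[of k "Suc (2 * k)"] by simp
    moreover have "Suc k * (Suc (2 * k) choose Suc k) = Suc (2 * k) * c"
      using Suc_times_binomial_eq[of "2 * k" k] by (simp add: c_def)
    ultimately show ?thesis by simp
  qed
  have distr: "x\<^sup>2 * (d\<^sup>2 * (2 * Suc k + 1)) = (x * d)\<^sup>2 * (2 * k + 3)" for x d :: nat
    by (simp add: power_mult_distrib algebra_simps)
  have "(Suc k)\<^sup>2 * (((2 * Suc k) choose Suc k)\<^sup>2 * (2 * Suc k + 1)) = (2 * (2 * k + 1) * c)\<^sup>2 * (2 * k + 3)"
    unfolding rec[symmetric] by (rule distr)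
  also have "\<dots> = (c\<^sup>2 * (2 * k + 1)) * (4 * ((2 * k + 1) * (2 * k + 3)))"
    by (simp add: power2_eq_square algebra_simps)
  also have "\<dots> \<le> 16 ^ k * (4 * (4 * (Suc k)\<^sup>2))"
  proof (rule mult_le_mono)
    show "c\<^sup>2 * (2 * k + 1) \<le> 16 ^ k" using Suc by (simp add: c_def)
    show "4 * ((2 * k + 1) * (2 * k + 3)) \<le> 4 * (4 * (Suc k)\<^sup>2)"
      by (simp add: power2_eq_square algebra_simps)
  qed
  also have "\<dots> = (Suc k)\<^sup>2 * 16 ^ Suc k" by simp
  finally show ?case by (simp only: mult_le_cancel1) simp
qed simp

lemma middle_binomial_sum_1_le:
  assumes "1 \<le> q"
  shows "real (middle_binomial_sum q 1) / 2 ^ q \<le> 1 / sqrt (real q)"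
proof -
  have bound: "real ((2 * k) choose k) / 4 ^ k \<le> 1 / sqrt (real (2 * k + 1))" for k
  proof -
    have "(real ((2 * k) choose k))\<^sup>2 * real (2 * k + 1) \<le> 16 ^ k"
      using central_binomial_upper_bound[of k] by (metis of_nat_mult of_nat_power of_nat_le_iff of_nat_numeral)
    then have "sqrt ((real ((2 * k) choose k))\<^sup>2 * real (2 * k + 1)) \<le> sqrt ((4 ^ k)\<^sup>2)"
      by (intro real_sqrt_le_mono) (simp add: power2_eq_square power_mult_distrib[symmetric])
    then have "real ((2 * k) choose k) * sqrt (real (2 * k + 1)) \<le> 4 ^ k"
      by (simp add: real_sqrt_mult)
    then show ?thesis by (simp add: field_simps)
  qed
  show ?thesis
  proof (cases "even q")
    case True
    then obtain k where k: "q = 2 * k" by auto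
    have "{i. i \<le> q \<and> q < 2 * i + 1 \<and> 2 * i \<le> q + 1} = {k}" using k by auto
    then have "real (middle_binomial_sum q 1) / 2 ^ q = real ((2 * k) choose k) / 4 ^ k"
      by (simp add: middle_binomial_sum_def k power_mult)
    also have "\<dots> \<le> 1 / sqrt (real (2 * k + 1))" by (rule bound)
    also have "\<dots> \<le> 1 / sqrt (real q)" using assms k by (intro divide_left_mono) auto
    finally show ?thesis .
  next
    case False
    then obtain k where k: "q = 2 * k + 1" by (auto elim: oddE)
    have "{i. i \<le> q \<and> q < 2 * i + 1 \<and> 2 * i \<le> q + 1} = {Suc k}" using k by auto
    then have "real (middle_binomial_sum q 1) / 2 ^ q = real ((2 * k + 1) choose Suc k) / 2 ^ q"
      by (simp add: middle_binomial_sum_def k)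
    also have "\<dots> = real (2 * ((2 * k + 1) choose Suc k)) / 4 ^ Suc k"
      by (simp add: k power_mult del: binomial_Suc_Suc)
    \<comment> \<open>In an odd row the two middle coefficients are equal and add up to the central
      coefficient of the next row, so the bound for even rows applies.\<close>
    also have "2 * ((2 * k + 1) choose Suc k) = (2 * Suc k) choose Suc k"
      using binomial_symmetric[of k "Suc (2 * k)"] by simp
    also have "real ((2 * Suc k) choose Suc k) / 4 ^ Suc k \<le> 1 / sqrt (real (2 * Suc k + 1))" by (rule bound)
    also have "\<dots> \<le> 1 / sqrt (real q)" using assms k by (intro divide_left_mono) auto
    finally show ?thesis .
  qed
qed

lemma prob_Pi_pmf_insert_rademacher:
  assumes "finite A" "x \<notin> A"
  shows "measure_pmf.prob (Pi_pmf (insert x A) 0 (\<lambda>_. rademacher_pmf)) {f. E f}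
    = (measure_pmf.prob (Pi_pmf A 0 (\<lambda>_. rademacher_pmf)) {f. E (f(x := -1))}
      + measure_pmf.prob (Pi_pmf A 0 (\<lambda>_. rademacher_pmf)) {f. E (f(x := 1))}) / 2"
proof -
  let ?P = "Pi_pmf A 0 (\<lambda>_. rademacher_pmf)"
  have "Pi_pmf (insert x A) 0 (\<lambda>_. rademacher_pmf)
      = bind_pmf rademacher_pmf (\<lambda>y. map_pmf (\<lambda>f. f(x := y)) ?P)"
    using assms by (simp add: Pi_pmf_insert pair_pmf_def map_pmf_def bind_assoc_pmf bind_return_pmf)
  then have "measure_pmf.prob (Pi_pmf (insert x A) 0 (\<lambda>_. rademacher_pmf)) {f. E f}
     = measure_pmf.expectation (bind_pmf rademacher_pmf (\<lambda>y. map_pmf (\<lambda>f. f(x := y)) ?P)) (indicator {f. E f})"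
    by simp
  also have "\<dots> = (\<Sum>y\<in>{-1, 1}. measure_pmf.expectation (map_pmf (\<lambda>f. f(x := y)) ?P) (indicator {f. E f}) / 2)"
    unfolding rademacher_pmf_def using assms(1)
    by (subst pmf_expectation_bind_pmf_of_set)
      (auto intro!: finite_imageI finite_set_Pi_pmf simp: rademacher_pmf_def[symmetric] set_rademacher_pmf)
  finally show ?thesis by (simp add: vimage_def add_divide_distrib)
qed

text \<open>
  Shifting a union of \<open>j\<close> intervals by \<open>\<pm>a\<close> and moving the rightmost interval of the right copy to
  the left copy leaves the latter disjoint: this turns \<open>j + j\<close> intervals into \<open>(j + 1) + (j - 1)\<close>.
\<close>

lemma Littlewood_Offord_intervals:
  fixes a :: "'a \<Rightarrow> real"
  assumes "finite Q" "0 < \<tau>" "\<And>l. l \<in> Q \<Longrightarrow> \<tau> \<le> \<bar>a l\<bar>" "finite Ts"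
  shows "measure_pmf.prob (Pi_pmf Q 0 (\<lambda>_. rademacher_pmf))
      {X. \<exists>t\<in>Ts. t \<le> (\<Sum>l\<in>Q. X l * a l) \<and> (\<Sum>l\<in>Q. X l * a l) < t + 2 * \<tau>}
    \<le> real (middle_binomial_sum (card Q) (card Ts)) / 2 ^ card Q"
  using assms(1,3,4)
proof (induction Q arbitrary: Ts rule: finite_induct)
  case empty
  show ?case
  proof (cases "Ts = {}")
    case False
    then have "1 \<le> card Ts" using empty by (simp add: Suc_leI card_gt_0_iff)
    then have "{i. i \<le> 0 \<and> 0 < 2 * i + card Ts \<and> 2 * i \<le> 0 + card Ts} = {0}" by auto
    then show ?thesis by (simp add: middle_binomial_sum_def)
  qed simp
next
  case (insert x Q)
  let ?P = "Pi_pmf Q 0 (\<lambda>_. rademacher_pmf)"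
  define S where "S X = (\<Sum>l\<in>Q. X l * a l)" for X
  define I where "I T v \<longleftrightarrow> (\<exists>t\<in>T. t \<le> v \<and> v < t + 2 * \<tau>)" for T :: "real set" and v
  define pr where "pr T = measure_pmf.prob ?P {X. I T (S X)}" for T
  define c where "c = \<bar>a x\<bar>"
  have c: "\<tau> \<le> c" using insert.prems(1) by (simp add: c_def)
  have IH: "pr T \<le> real (middle_binomial_sum (card Q) (card T)) / 2 ^ card Q" if "finite T" for T
    using insert.IH[OF _ that] insert.prems(1) by (simp add: pr_def I_def S_def)
  have shift: "I Ts (v + r) \<longleftrightarrow> I ((\<lambda>t. t - r) ` Ts) v" for v r
    by (auto simp: I_def algebra_simps)
  have "measure_pmf.prob (Pi_pmf (insert x Q) 0 (\<lambda>_. rademacher_pmf))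
      {X. I Ts (\<Sum>l\<in>insert x Q. X l * a l)} = (pr ((\<lambda>t. t - (- a x)) ` Ts) + pr ((\<lambda>t. t - a x) ` Ts)) / 2"
  proof -
    have "(\<Sum>l\<in>insert x Q. (X(x := y)) l * a l) = S X + y * a x" for X y
    proof -
      have "(\<Sum>l\<in>Q. (X(x := y)) l * a l) = S X"
        unfolding S_def using insert.hyps by (intro sum.cong) auto
      then show ?thesis using insert.hyps by (simp del: fun_upd_apply) simp
    qed
    then show ?thesis
      using prob_Pi_pmf_insert_rademacher[OF insert.hyps, of "\<lambda>X. I Ts (\<Sum>l\<in>insert x Q. X l * a l)"]
        shift[of _ "- a x"] shift[of _ "a x"]
      by (simp add: pr_def)
  qed
  \<comment> \<open>Both signs of the shift occur with equal weight, so only the absolute value of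
    \<open>a x\<close> matters.\<close>
  also have "pr ((\<lambda>t. t - (- a x)) ` Ts) + pr ((\<lambda>t. t - a x) ` Ts) = pr ((\<lambda>t. t - c) ` Ts) + pr ((\<lambda>t. t + c) ` Ts)"
    by (cases "0 \<le> a x") (auto simp: c_def)
  finally have eq: "measure_pmf.prob (Pi_pmf (insert x Q) 0 (\<lambda>_. rademacher_pmf))
      {X. I Ts (\<Sum>l\<in>insert x Q. X l * a l)} = (pr ((\<lambda>t. t - c) ` Ts) + pr ((\<lambda>t. t + c) ` Ts)) / 2" .
  show ?case
  proof (cases "Ts = {}")
    case True
    then show ?thesis by simp
  next
    case False
    define mx where "mx = Max Ts"
    have mx: "mx \<in> Ts" "\<And>t. t \<in> Ts \<Longrightarrow> t \<le> mx" using False insert.prems(2) by (auto simp: mx_def)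
    define G where "G = insert (mx + c) ((\<lambda>t. t - c) ` Ts)"
    define H where "H = (\<lambda>t. t + c) ` (Ts - {mx})"
    have "mx + c \<notin> (\<lambda>t. t - c) ` Ts" using mx(2) c assms(2) by fastforce
    then have cG: "card G = card Ts + 1"
      unfolding G_def using insert.prems(2) by (simp add: card_image inj_on_def)
    have cH: "card H = card Ts - 1"
      unfolding H_def using insert.prems(2) mx(1) by (simp add: card_image inj_on_def)
    have "pr ((\<lambda>t. t + c) ` Ts) \<le> pr {mx + c} + pr H"
    proof -
      have "{X. I ((\<lambda>t. t + c) ` Ts) (S X)} \<subseteq> {X. I {mx + c} (S X)} \<union> {X. I H (S X)}"
        by (auto simp: I_def H_def)
      then have "pr ((\<lambda>t. t + c) ` Ts) \<le> measure_pmf.prob ?P ({X. I {mx + c} (S X)} \<union> {X. I H (S X)})"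
        unfolding pr_def by (intro measure_pmf.finite_measure_mono) auto
      also have "\<dots> \<le> pr {mx + c} + pr H" unfolding pr_def by (intro measure_subadditive) auto
      finally show ?thesis .
    qed
    \<comment> \<open>The intervals of the left copy start at or before \<open>mx - c\<close> and
      end at or before \<open>mx - c + 2 * \<tau>\<close>, which is at most \<open>mx + c\<close>.
      Half-openness then separates them from the moved interval, so the probabilities add.\<close>
    moreover have "pr ((\<lambda>t. t - c) ` Ts) + pr {mx + c} = pr G"
    proof -
      have "{X. I ((\<lambda>t. t - c) ` Ts) (S X)} \<inter> {X. I {mx + c} (S X)} = {}"
        using mx(2) c by (force simp: I_def)
      moreover have "{X. I G (S X)} = {X. I ((\<lambda>t. t - c) ` Ts) (S X)} \<union> {X. I {mx + c} (S X)}"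
        by (auto simp: I_def G_def)
      ultimately show ?thesis
        unfolding pr_def by (simp add: measure_pmf.finite_measure_Union)
    qed
    ultimately have "pr ((\<lambda>t. t - c) ` Ts) + pr ((\<lambda>t. t + c) ` Ts) \<le> pr G + pr H" by linarith
    also have "\<dots> \<le> real (middle_binomial_sum (card Q) (card G)) / 2 ^ card Q
        + real (middle_binomial_sum (card Q) (card H)) / 2 ^ card Q"
      using insert.prems(2) by (intro add_mono IH) (auto simp: G_def H_def)
    also have "\<dots> = real (middle_binomial_sum (Suc (card Q)) (card Ts)) / 2 ^ card Q"
      using False insert.prems(2)
      by (subst middle_binomial_sum_Suc) (auto simp: cG cH Suc_leI card_gt_0_iff add_divide_distrib)
    finally show ?thesis
      using eq insert.hyps by (simp add: I_def)
  qed
qed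

text \<open>The event confines the Rademacher sum to a single half-open interval of length 2\<tau>,
  so only the largest binomial coefficient enters. The offset \<open>c\<close> costs nothing because
  the interval may lie anywhere.\<close>

lemma Littlewood_Offord:
  fixes a :: "'a \<Rightarrow> real"
  assumes "finite Q" "0 < \<tau>" "\<And>l. l \<in> Q \<Longrightarrow> \<tau> \<le> \<bar>a l\<bar>" "1 \<le> card Q"
  shows "measure_pmf.prob (Pi_pmf Q 0 (\<lambda>_. rademacher_pmf)) {X. \<bar>c + (\<Sum>l\<in>Q. X l * a l)\<bar> < \<tau>}
    \<le> 1 / sqrt (real (card Q))"
proof -
  have "measure_pmf.prob (Pi_pmf Q 0 (\<lambda>_. rademacher_pmf)) {X. \<bar>c + (\<Sum>l\<in>Q. X l * a l)\<bar> < \<tau>}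
    \<le> measure_pmf.prob (Pi_pmf Q 0 (\<lambda>_. rademacher_pmf))
      {X. \<exists>t\<in>{- c - \<tau>}. t \<le> (\<Sum>l\<in>Q. X l * a l) \<and> (\<Sum>l\<in>Q. X l * a l) < t + 2 * \<tau>}"
    by (intro measure_pmf.finite_measure_mono) auto
  also have "\<dots> \<le> real (middle_binomial_sum (card Q) (card {- c - \<tau>})) / 2 ^ card Q"
    using assms by (intro Littlewood_Offord_intervals) auto
  also have "\<dots> \<le> 1 / sqrt (real (card Q))" using middle_binomial_sum_1_le[OF assms(4)] by simp
  finally show ?thesis .
qed

section \<open>Random subsets\<close>

abbreviation uniform_subset_pmf :: "nat \<Rightarrow> nat \<Rightarrow> nat set pmf" where
  "uniform_subset_pmf n K \<equiv> pmf_of_set {S. S \<subseteq> {..<n} \<and> card S = K}"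

lemma card_supersets_of_card:
  assumes "finite U" "D \<subseteq> U" "card D \<le> K"
  shows "card {S. S \<subseteq> U \<and> card S = K \<and> D \<subseteq> S} = (card U - card D) choose (K - card D)"
proof -
  have finD: "finite D" using assms finite_subset by blast
  have "bij_betw (\<lambda>S. S - D) {S. S \<subseteq> U \<and> card S = K \<and> D \<subseteq> S} {S. S \<subseteq> U - D \<and> card S = K - card D}"
  proof (rule bij_betw_byWitness[where f' = "\<lambda>S. S \<union> D"])
    show "(\<lambda>S. S - D) ` {S. S \<subseteq> U \<and> card S = K \<and> D \<subseteq> S} \<subseteq> {S. S \<subseteq> U - D \<and> card S = K - card D}"
      using finD by (auto simp: card_Diff_subset)
    show "(\<lambda>S. S \<union> D) ` {S. S \<subseteq> U - D \<and> card S = K - card D} \<subseteq> {S. S \<subseteq> U \<and> card S = K \<and> D \<subseteq> S}"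
    proof safe
      fix S assume S: "S \<subseteq> U - D" "card S = K - card D"
      have "card (S \<union> D) = card S + card D"
        using S assms(1) finD by (intro card_Un_disjoint) (auto intro: finite_subset)
      then show "card (S \<union> D) = K" using S assms(3) by simp
    qed (use assms in auto)
  qed auto
  then have "card {S. S \<subseteq> U \<and> card S = K \<and> D \<subseteq> S} = card {S. S \<subseteq> U - D \<and> card S = K - card D}"
    by (rule bij_betw_same_card)
  also have "\<dots> = (card U - card D) choose (K - card D)"
    using assms finD by (subst n_subsets) (auto simp: card_Diff_subset)
  finally show ?thesis .
qed

lemma subsets_of_card_nonempty:
  assumes "K \<le> n"
  shows "{S. S \<subseteq> {..<n} \<and> card S = K} \<noteq> {}" "finite {S. S \<subseteq> {..<n} \<and> card S = K}"
proof -
  have "{..<K} \<in> {S. S \<subseteq> {..<n} \<and> card S = K}" using assms by auto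
  then show "{S. S \<subseteq> {..<n} \<and> card S = K} \<noteq> {}" by blast
  show "finite {S. S \<subseteq> {..<n} \<and> card S = K}" by simp
qed

lemma prob_uniform_subset_superset:
  assumes "K \<le> n" "D \<subseteq> {..<n}" "card D \<le> K"
  shows "measure_pmf.prob (uniform_subset_pmf n K) {S. D \<subseteq> S}
    = real ((n - card D) choose (K - card D)) / real (n choose K)"
proof -
  have "{S. S \<subseteq> {..<n} \<and> card S = K} \<inter> {S. D \<subseteq> S} = {S. S \<subseteq> {..<n} \<and> card S = K \<and> D \<subseteq> S}" by auto
  then show ?thesis
    using subsets_of_card_nonempty[OF assms(1)] card_supersets_of_card[OF _ assms(2,3)]
    by (simp add: measure_pmf_of_set n_subsets)
qed

lemma prob_uniform_subset_member:
  assumes "1 \<le> K" "K \<le> n" "i < n"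
  shows "measure_pmf.prob (uniform_subset_pmf n K) {S. i \<in> S} = real K / real n"
proof -
  have "measure_pmf.prob (uniform_subset_pmf n K) {S. i \<in> S}
      = real ((n - 1) choose (K - 1)) / real (n choose K)"
    using prob_uniform_subset_superset[of K n "{i}"] assms by simp
  moreover have "K * (n choose K) = n * ((n - 1) choose (K - 1))"
    using assms Suc_times_binomial_eq[of "n - 1" "K - 1"] by (simp add: mult.commute)
  then have "real K * real (n choose K) = real n * real ((n - 1) choose (K - 1))"
    by (metis of_nat_mult)
  then have "real ((n - 1) choose (K - 1)) / real (n choose K) = real K / real n"
    using assms by (simp add: field_simps)
  ultimately show ?thesis by simp
qed

text \<open>Sampling without replacement: the probability is K(K-1)/(n(n-1)), and (K-1)/(n-1) \<le>
  K/n because K \<le> n.\<close>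

lemma prob_uniform_subset_two_members:
  assumes "1 \<le> K" "K \<le> n" "i < n" "j < n" "i \<noteq> j"
  shows "measure_pmf.prob (uniform_subset_pmf n K) {S. i \<in> S \<and> j \<in> S} \<le> (real K / real n)\<^sup>2"
proof (cases "K = 1")
  case True
  have "{S. S \<subseteq> {..<n} \<and> card S = K} \<inter> {S. i \<in> S \<and> j \<in> S} = {}"
    using True assms(5) by (auto simp: card_1_singleton_iff)
  then have "measure_pmf.prob (uniform_subset_pmf n K) {S. i \<in> S \<and> j \<in> S} = 0"
    using subsets_of_card_nonempty[OF assms(2)] by (simp add: measure_pmf_of_set)
  then show ?thesis by simp
next
  case False
  then have K2: "2 \<le> K" using assms by simp
  have "measure_pmf.prob (uniform_subset_pmf n K) {S. i \<in> S \<and> j \<in> S}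
      = real ((n - 2) choose (K - 2)) / real (n choose K)"
    using prob_uniform_subset_superset[of K n "{i, j}"] assms K2 by (simp add: numeral_2_eq_2)
  also have "\<dots> = (real K / real n) * ((real K - 1) / (real n - 1))"
  proof -
    have "K * (n choose K) = n * ((n - 1) choose (K - 1))"
      using assms Suc_times_binomial_eq[of "n - 1" "K - 1"] by (simp add: mult.commute)
    moreover have "(K - 1) * ((n - 1) choose (K - 1)) = (n - 1) * ((n - 2) choose (K - 2))"
    proof -
      have "Suc (n - 2) = n - 1" "Suc (K - 2) = K - 1" using K2 assms by auto
      then show ?thesis using Suc_times_binomial_eq[of "n - 2" "K - 2"] by (simp add: mult.commute)
    qed
    ultimately have "real K * real (n choose K) = real n * real ((n - 1) choose (K - 1))"
      "real (K - 1) * real ((n - 1) choose (K - 1)) = real (n - 1) * real ((n - 2) choose (K - 2))"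
      by (metis of_nat_mult)+
    then have "real K * (real K - 1) * real (n choose K) = real n * (real n - 1) * real ((n - 2) choose (K - 2))"
      using assms by (simp add: of_nat_diff mult_ac) (metis mult.left_commute)
    moreover have "real (n choose K) > 0" "real n > 0" "real n - 1 > 0" using assms K2 by auto
    ultimately show ?thesis by (simp add: field_simps)
  qed
  also have "\<dots> \<le> (real K / real n) * (real K / real n)"
    using assms K2 by (intro mult_left_mono) (auto simp: field_simps)
  finally show ?thesis by (simp add: power2_eq_square)
qed

lemma expectation_uniform_subset_member:
  assumes "1 \<le> K" "K \<le> n" "i < n"
  shows "measure_pmf.expectation (uniform_subset_pmf n K) (\<lambda>S. if i \<in> S then c else d)
    = d + (c - d) * (real K / real n)"
proof -
  have fin: "finite (set_pmf (uniform_subset_pmf n K))"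
    using subsets_of_card_nonempty[OF assms(2)] by simp
  have "(\<lambda>S. if i \<in> S then c else d) = (\<lambda>S. d + (c - d) * indicator {S. i \<in> S} S)"
    by (auto simp: indicator_def)
  then have "measure_pmf.expectation (uniform_subset_pmf n K) (\<lambda>S. if i \<in> S then c else d)
     = measure_pmf.expectation (uniform_subset_pmf n K) (\<lambda>S. d + (c - d) * indicator {S. i \<in> S} S)"
    by simp
  also have "\<dots> = d + (c - d) * measure_pmf.prob (uniform_subset_pmf n K) {S. i \<in> S}"
    using fin by (subst Bochner_Integration.integral_add) (auto intro: integrable_measure_pmf_finite)
  finally show ?thesis using prob_uniform_subset_member[OF assms] by simp
qed

text \<open>Chebyshev's inequality: membership of different points is negatively correlated.\<close>

lemma prob_uniform_subset_few_hits_le: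
  fixes a :: real
  assumes "1 \<le> K" "K \<le> n" "T \<subseteq> {..<n}" "0 < a" "a * real n \<le> real (card T)"
  shows "measure_pmf.prob (uniform_subset_pmf n K) {S. real (card (S \<inter> T)) < a * real K / 2}
    \<le> 4 / (a * real K)"
proof -
  let ?P = "uniform_subset_pmf n K"
  define X where "X S = (\<Sum>i\<in>T. indicator {S. i \<in> S} S :: real)" for S :: "nat set"
  define p where "p = real K / real n"
  define \<mu> where "\<mu> = real (card T) * p"
  have finT: "finite T" using assms(3) finite_subset by blast
  have fin: "finite (set_pmf ?P)" using subsets_of_card_nonempty[OF assms(2)] by simp
  have int: "integrable (measure_pmf ?P) f" for f :: "nat set \<Rightarrow> real"
    using fin by (rule integrable_measure_pmf_finite)
  have X: "X S = real (card (S \<inter> T))" for S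
    using finT by (simp add: X_def indicator_def sum.If_cases Int_commute)
  have n: "0 < n" "0 < K" using assms by auto
  have \<mu>: "a * real K \<le> \<mu>"
    using assms(5) n mult_right_mono[of "a * real n" "real (card T)" p]
    by (simp add: \<mu>_def p_def field_simps)
  have "0 < a * real K" using assms n by simp
  then have \<mu>0: "0 < \<mu>" using \<mu> by linarith
  have EX: "measure_pmf.expectation ?P X = \<mu>"
  proof -
    have "measure_pmf.expectation ?P X = (\<Sum>i\<in>T. measure_pmf.prob ?P {S. i \<in> S})"
      unfolding X_def by (subst Bochner_Integration.integral_sum) (auto simp: int)
    also have "\<dots> = (\<Sum>i\<in>T. p)"
      using assms unfolding p_def by (intro sum.cong prob_uniform_subset_member) auto
    finally show ?thesis by (simp add: \<mu>_def)
  qed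
  have X2: "(X S)\<^sup>2 = (\<Sum>i\<in>T. \<Sum>j\<in>T. indicator {S. i \<in> S \<and> j \<in> S} S)" for S
    unfolding X_def power2_eq_square sum_product by (intro sum.cong refl) (auto simp: indicator_def)
  have EX2: "measure_pmf.expectation ?P (\<lambda>S. (X S)\<^sup>2) \<le> \<mu> + \<mu>\<^sup>2"
  proof -
    have "measure_pmf.expectation ?P (\<lambda>S. (X S)\<^sup>2)
      = (\<Sum>i\<in>T. \<Sum>j\<in>T. measure_pmf.prob ?P {S. i \<in> S \<and> j \<in> S})"
      unfolding X2 by (simp add: Bochner_Integration.integral_sum int)
    \<comment> \<open>Pairs of distinct points contribute at most p^2 each, so only the diagonal
      exceeds the square of the mean, and the variance is at most \<mu>.\<close>
    also have "\<dots> \<le> (\<Sum>i\<in>T. \<Sum>j\<in>T. (if i = j then p else 0) + p\<^sup>2)"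
    proof (intro sum_mono)
      fix i j assume "i \<in> T" "j \<in> T"
      then show "measure_pmf.prob ?P {S. i \<in> S \<and> j \<in> S} \<le> (if i = j then p else 0) + p\<^sup>2"
        using prob_uniform_subset_member[of K n i] prob_uniform_subset_two_members[of K n i j] assms(1-3)
        by (auto simp: p_def)
    qed
    also have "\<dots> = \<mu> + \<mu>\<^sup>2"
      using finT by (simp add: sum.distrib \<mu>_def power2_eq_square algebra_simps)
    finally show ?thesis .
  qed
  have "measure_pmf.prob ?P {S. real (card (S \<inter> T)) < a * real K / 2}
    \<le> measure_pmf.expectation ?P (\<lambda>S. (X S - \<mu>)\<^sup>2) / (\<mu>\<^sup>2 / 4)"
  proof (rule prob_le_expectation[OF fin])
    fix S assume "real (card (S \<inter> T)) < a * real K / 2"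
    then have "\<mu> / 2 \<le> \<mu> - X S" using \<mu> by (simp add: X)
    then have "(\<mu> / 2)\<^sup>2 \<le> (\<mu> - X S)\<^sup>2" using \<mu>0 by (intro power_mono) auto
    then show "\<mu>\<^sup>2 / 4 \<le> (X S - \<mu>)\<^sup>2" by (simp add: power2_commute power_divide)
  qed (use \<mu>0 in auto)
  also have "measure_pmf.expectation ?P (\<lambda>S. (X S - \<mu>)\<^sup>2)
    = measure_pmf.expectation ?P (\<lambda>S. (X S)\<^sup>2 - 2 * \<mu> * X S + \<mu>\<^sup>2)"
    by (intro Bochner_Integration.integral_cong refl) (simp add: power2_eq_square algebra_simps)
  also have "\<dots> = measure_pmf.expectation ?P (\<lambda>S. (X S)\<^sup>2) - 2 * \<mu> * \<mu> + \<mu>\<^sup>2"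
    by (simp add: int EX)
  also have "\<dots> \<le> \<mu>" using EX2 by (simp add: power2_eq_square)
  finally have "measure_pmf.prob ?P {S. real (card (S \<inter> T)) < a * real K / 2} \<le> \<mu> / (\<mu>\<^sup>2 / 4)"
    by (simp add: divide_right_mono)
  also have "\<dots> = 4 / \<mu>" using \<mu>0 by (simp add: power2_eq_square)
  also have "\<dots> \<le> 4 / (a * real K)" using \<mu> \<open>0 < a * real K\<close> by (intro divide_left_mono) auto
  finally show ?thesis .
qed

text \<open>For a fixed row the number of other columns hitting it is a sum of independent
  indicators with mean at most \<open>K\<close>, to which a Chernoff bound at parameter 1 applies.
  The threshold is \<open>L\<close> other columns, since column \<open>k\<close> itself adds one
  more entry and truncation starts above \<open>L\<close>.\<close>

lemma prob_hit_crowded_row_le: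
  assumes "1 \<le> K" "K \<le> n" "k < n"
  shows "measure_pmf.prob (Pi_pmf {..<n} {} (\<lambda>_. uniform_subset_pmf n K))
     {J. \<exists>j\<in>J k. L \<le> card {i. i < n \<and> i \<noteq> k \<and> j \<in> J i}}
    \<le> real K * exp ((exp 1 - 1) * real K - real L)"
proof -
  let ?P = "Pi_pmf {..<n} {} (\<lambda>_. uniform_subset_pmf n K)"
  have setP: "set_pmf (uniform_subset_pmf n K) = {S. S \<subseteq> {..<n} \<and> card S = K}"
    using subsets_of_card_nonempty[OF assms(2)] by simp
  have finP: "finite (set_pmf ?P)" by (intro finite_set_Pi_pmf) (simp_all add: setP)
  \<comment> \<open>The factor for column \<open>k\<close> is the indicator of the hit itself. Its
    expectation K/n compensates the union bound over \<open>n\<close> rows, leaving only the factor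
    \<open>K\<close>.\<close>
  define f where "f j i S = (if i = k then (if j \<in> S then 1 else 0) else (if j \<in> S then exp 1 else 1 :: real))"
    for j i :: nat and S :: "nat set"
  have pt: "measure_pmf.prob ?P {J. j \<in> J k \<and> L \<le> card {i. i < n \<and> i \<noteq> k \<and> j \<in> J i}}
    \<le> real K / real n * exp ((exp 1 - 1) * real K - real L)" if j: "j < n" for j
  proof -
    have "measure_pmf.prob ?P {J. j \<in> J k \<and> L \<le> card {i. i < n \<and> i \<noteq> k \<and> j \<in> J i}}
      \<le> measure_pmf.expectation ?P (\<lambda>J. \<Prod>i<n. f j i (J i)) / exp (real L)"
    proof (rule prob_le_expectation[OF finP])
      fix J assume J: "j \<in> J k \<and> L \<le> card {i. i < n \<and> i \<noteq> k \<and> j \<in> J i}"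
      have "(\<Prod>i<n. f j i (J i)) = (\<Prod>i\<in>{i. i < n \<and> i \<noteq> k \<and> j \<in> J i}. exp 1)"
        using J by (intro prod.mono_neutral_cong_right) (auto simp: f_def)
      also have "\<dots> = exp (real (card {i. i < n \<and> i \<noteq> k \<and> j \<in> J i}))"
        by (simp add: exp_of_nat_mult[symmetric])
      finally show "exp (real L) \<le> (\<Prod>i<n. f j i (J i))" using J by simp
    qed (auto intro!: prod_nonneg simp: f_def)
    also have "measure_pmf.expectation ?P (\<lambda>J. \<Prod>i<n. f j i (J i))
       = (\<Prod>i<n. measure_pmf.expectation (uniform_subset_pmf n K) (f j i))"
      using setP by (intro expectation_prod_Pi_pmf integrable_measure_pmf_finite) (auto simp: f_def)
    also have "\<dots> = (\<Prod>i<n. if i = k then real K / real n else 1 + (exp 1 - 1) * (real K / real n))"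
      using expectation_uniform_subset_member[OF assms(1,2) j]
      by (intro prod.cong refl) (simp add: f_def[abs_def])
    also have "\<dots> = real K / real n * (\<Prod>i\<in>{..<n} - {k}. 1 + (exp 1 - 1) * (real K / real n))"
      using assms(3) by (subst prod.remove[of _ k]) (auto intro!: prod.cong)
    also have "\<dots> \<le> real K / real n * (\<Prod>i\<in>{..<n} - {k}. exp ((exp 1 - 1) * (real K / real n)))"
      using exp_ge_add_one_self[of 1] by (intro mult_left_mono prod_mono) (auto intro!: add_nonneg_nonneg mult_nonneg_nonneg)
    also have "\<dots> \<le> real K / real n * exp ((exp 1 - 1) * real K)"
    proof (intro mult_left_mono)
      have "(\<Prod>i\<in>{..<n} - {k}. exp ((exp 1 - 1) * (real K / real n)))
        = exp (real (n - 1) * ((exp 1 - 1) * (real K / real n)))"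
        using assms(3) by (simp add: exp_of_nat_mult[symmetric])
      also have "\<dots> \<le> exp (real n * ((exp 1 - 1) * (real K / real n)))"
        using exp_ge_add_one_self[of 1] by (subst exp_le_cancel_iff, intro mult_right_mono) auto
      finally show "(\<Prod>i\<in>{..<n} - {k}. exp ((exp 1 - 1) * (real K / real n))) \<le> exp ((exp 1 - 1) * real K)"
        using assms(3) by simp
    qed simp
    finally show ?thesis by (simp add: divide_right_mono exp_diff)
  qed
  have "measure_pmf.prob ?P {J. \<exists>j\<in>J k. L \<le> card {i. i < n \<and> i \<noteq> k \<and> j \<in> J i}}
     = measure_pmf.prob ?P (\<Union>j<n. {J. j \<in> J k \<and> L \<le> card {i. i < n \<and> i \<noteq> k \<and> j \<in> J i}})"
  proof (intro measure_pmf.finite_measure_eq_AE AE_pmfI)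
    fix J assume "J \<in> set_pmf ?P"
    then have "J k \<subseteq> {..<n}" using assms(3) by (auto simp: set_Pi_pmf PiE_dflt_def setP)
    then show "(J \<in> {J. \<exists>j\<in>J k. L \<le> card {i. i < n \<and> i \<noteq> k \<and> j \<in> J i}}) =
       (J \<in> (\<Union>j<n. {J. j \<in> J k \<and> L \<le> card {i. i < n \<and> i \<noteq> k \<and> j \<in> J i}}))" by auto
  qed auto
  also have "\<dots> \<le> real (card {..<n}) * (real K / real n * exp ((exp 1 - 1) * real K - real L))"
    by (intro prob_UN_le_card_mult pt) auto
  also have "\<dots> = real K * exp ((exp 1 - 1) * real K - real L)" using assms(3) by simp
  finally show ?thesis .
qed

section \<open>Matrices as functions\<close>

definition mat_app :: "nat \<Rightarrow> (nat \<Rightarrow> nat \<Rightarrow> real) \<Rightarrow> (nat \<Rightarrow> real) \<Rightarrow> nat \<Rightarrow> real" where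
  "mat_app n M x j = (\<Sum>i<n. M j i * x i)"

abbreviation nrm :: "nat \<Rightarrow> (nat \<Rightarrow> real) \<Rightarrow> real" where
  "nrm n x \<equiv> L2_set x {..<n}"

text \<open>An inequality for all vectors instead of a supremum: sums, multiples and transposes can
  then be treated without boundedness or carrier conditions.\<close>

definition op_bounded :: "nat \<Rightarrow> (nat \<Rightarrow> nat \<Rightarrow> real) \<Rightarrow> real \<Rightarrow> bool" where
  "op_bounded n M c \<longleftrightarrow> (\<forall>x. nrm n (mat_app n M x) \<le> c * nrm n x)"

lemma op_boundedD: "op_bounded n M c \<Longrightarrow> nrm n (mat_app n M x) \<le> c * nrm n x"
  by (simp add: op_bounded_def)

lemma L2_set_mono_set:
  assumes "A \<subseteq> B" "finite B"
  shows "L2_set f A \<le> L2_set f B"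
  unfolding L2_set_def using assms by (intro real_sqrt_le_mono sum_mono2) auto

lemma L2_set_uminus: "L2_set (\<lambda>i. - f i) A = L2_set f A"
  by (simp add: L2_set_def)

lemma L2_set_scale: "L2_set (\<lambda>i. c * f i) A = \<bar>c\<bar> * L2_set f A"
  using L2_set_right_distrib[of "\<bar>c\<bar>" f A] by (simp add: L2_set_def power_mult_distrib)

lemma L2_set_inner_le: "\<bar>\<Sum>i\<in>A. f i * g i\<bar> \<le> L2_set f A * L2_set g A"
proof -
  have "\<bar>\<Sum>i\<in>A. f i * g i\<bar> \<le> (\<Sum>i\<in>A. \<bar>f i\<bar> * \<bar>g i\<bar>)"
    by (rule order_trans[OF sum_abs]) (simp add: abs_mult)
  also have "\<dots> \<le> L2_set f A * L2_set g A" by (rule L2_set_mult_ineq)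
  finally show ?thesis .
qed

lemma L2_set_square: "finite A \<Longrightarrow> (L2_set f A)\<^sup>2 = (\<Sum>i\<in>A. (f i)\<^sup>2)"
  by (simp add: L2_set_def sum_nonneg)

lemma op_bounded_add:
  assumes "op_bounded n M c" "op_bounded n N d"
  shows "op_bounded n (\<lambda>j i. M j i + N j i) (c + d)"
  unfolding op_bounded_def
proof
  fix x
  have "mat_app n (\<lambda>j i. M j i + N j i) x = (\<lambda>j. mat_app n M x j + mat_app n N x j)"
    by (simp add: mat_app_def fun_eq_iff distrib_right sum.distrib)
  then have "nrm n (mat_app n (\<lambda>j i. M j i + N j i) x) \<le> nrm n (mat_app n M x) + nrm n (mat_app n N x)"
    by (simp add: L2_set_triangle_ineq)
  also have "\<dots> \<le> c * nrm n x + d * nrm n x" using assms by (intro add_mono op_boundedD)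
  finally show "nrm n (mat_app n (\<lambda>j i. M j i + N j i) x) \<le> (c + d) * nrm n x"
    by (simp add: distrib_right)
qed

lemma op_bounded_scale:
  assumes "op_bounded n M c"
  shows "op_bounded n (\<lambda>j i. r * M j i) (\<bar>r\<bar> * c)"
  unfolding op_bounded_def
proof
  fix x
  have "mat_app n (\<lambda>j i. r * M j i) x = (\<lambda>j. r * mat_app n M x j)"
    by (simp add: mat_app_def fun_eq_iff sum_distrib_left mult.assoc)
  then show "nrm n (mat_app n (\<lambda>j i. r * M j i) x) \<le> \<bar>r\<bar> * c * nrm n x"
    using mult_left_mono[OF op_boundedD[OF assms, of x], of "\<bar>r\<bar>"] by (simp add: L2_set_scale mult.assoc)
qed

lemma op_bounded_mono: "op_bounded n M c \<Longrightarrow> c \<le> d \<Longrightarrow> op_bounded n M d"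
  unfolding op_bounded_def by (meson L2_set_nonneg mult_right_mono order_trans)

lemma sum_mat_app_transpose:
  "(\<Sum>j<n. u j * mat_app n M x j) = (\<Sum>i<n. x i * mat_app n (\<lambda>i j. M j i) u i)"
proof -
  have "(\<Sum>j<n. u j * mat_app n M x j) = (\<Sum>j<n. \<Sum>i<n. u j * (M j i * x i))"
    by (simp add: mat_app_def sum_distrib_left)
  also have "\<dots> = (\<Sum>i<n. \<Sum>j<n. u j * (M j i * x i))" by (rule sum.swap)
  also have "\<dots> = (\<Sum>i<n. x i * mat_app n (\<lambda>i j. M j i) u i)"
    by (simp add: mat_app_def sum_distrib_left mult_ac)
  finally show ?thesis .
qed

text \<open>With y the image of x under the transpose, |y|^2 is the inner product of x with My,
  hence at most |x| c |y|; then |y| is cancelled.\<close>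

lemma op_bounded_transpose:
  assumes "op_bounded n M c"
  shows "op_bounded n (\<lambda>i j. M j i) c"
  unfolding op_bounded_def
proof
  fix x
  define y where "y = mat_app n (\<lambda>i j. M j i) x"
  have "(nrm n y)\<^sup>2 = (\<Sum>i<n. y i * mat_app n (\<lambda>i j. M j i) x i)"
    unfolding L2_set_square[OF finite_lessThan] by (simp add: y_def power2_eq_square)
  also have "\<dots> = (\<Sum>j<n. x j * mat_app n M y j)" by (rule sum_mat_app_transpose[symmetric])
  also have "\<dots> \<le> nrm n x * nrm n (mat_app n M y)"
    using L2_set_inner_le[of x "mat_app n M y" "{..<n}"] by linarith
  also have "\<dots> \<le> nrm n x * (c * nrm n y)" by (intro mult_left_mono op_boundedD assms) simp
  finally have *: "nrm n y * nrm n y \<le> (c * nrm n x) * nrm n y" by (simp add: power2_eq_square mult_ac)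
  show "nrm n y \<le> c * nrm n x"
  proof (cases "nrm n y = 0")
    case True
    have "0 \<le> c * nrm n x" using op_boundedD[OF assms, of x] L2_set_nonneg[of "mat_app n M x" "{..<n}"] by linarith
    then show ?thesis using True by simp
  next
    case False
    then have "0 < nrm n y" using L2_set_nonneg[of y "{..<n}"] by linarith
    then show ?thesis using * by (simp add: mult_le_cancel_right)
  qed
qed

text \<open>Writing |M_ji| as a product of two square roots, Cauchy-Schwarz pulls out the row sums;
  exchanging the order of summation then brings in the column sums.\<close>

lemma Schur_test:
  assumes "\<And>j. j < n \<Longrightarrow> (\<Sum>i<n. \<bar>M j i\<bar>) \<le> 1" "\<And>i. i < n \<Longrightarrow> (\<Sum>j<n. \<bar>M j i\<bar>) \<le> 1"
  shows "op_bounded n M 1"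
  unfolding op_bounded_def
proof
  fix x
  have row: "(mat_app n M x j)\<^sup>2 \<le> (\<Sum>i<n. \<bar>M j i\<bar> * (x i)\<^sup>2)" if "j < n" for j
  proof -
    have "(mat_app n M x j)\<^sup>2 \<le> (\<Sum>i<n. sqrt \<bar>M j i\<bar> * (sqrt \<bar>M j i\<bar> * \<bar>x i\<bar>))\<^sup>2"
    proof (rule abs_le_square_iff[THEN iffD1])
      have "\<bar>mat_app n M x j\<bar> \<le> (\<Sum>i<n. \<bar>M j i\<bar> * \<bar>x i\<bar>)"
        unfolding mat_app_def by (rule order_trans[OF sum_abs]) (simp add: abs_mult)
      also have "\<dots> = (\<Sum>i<n. sqrt \<bar>M j i\<bar> * (sqrt \<bar>M j i\<bar> * \<bar>x i\<bar>))"
        by (simp add: mult.assoc[symmetric])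
      finally show "\<bar>mat_app n M x j\<bar> \<le> \<bar>\<Sum>i<n. sqrt \<bar>M j i\<bar> * (sqrt \<bar>M j i\<bar> * \<bar>x i\<bar>)\<bar>" by simp
    qed
    also have "\<dots> \<le> (\<Sum>i<n. (sqrt \<bar>M j i\<bar>)\<^sup>2) * (\<Sum>i<n. (sqrt \<bar>M j i\<bar> * \<bar>x i\<bar>)\<^sup>2)"
      by (rule Cauchy_Schwarz_ineq_sum)
    also have "\<dots> = (\<Sum>i<n. \<bar>M j i\<bar>) * (\<Sum>i<n. \<bar>M j i\<bar> * (x i)\<^sup>2)"
      by (simp add: power_mult_distrib)
    also have "\<dots> \<le> 1 * (\<Sum>i<n. \<bar>M j i\<bar> * (x i)\<^sup>2)"
      using assms(1)[OF that] by (intro mult_right_mono sum_nonneg) auto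
    finally show ?thesis by simp
  qed
  have "(\<Sum>j<n. (mat_app n M x j)\<^sup>2) \<le> (\<Sum>j<n. \<Sum>i<n. \<bar>M j i\<bar> * (x i)\<^sup>2)"
    using row by (intro sum_mono) auto
  also have "\<dots> = (\<Sum>i<n. \<Sum>j<n. \<bar>M j i\<bar> * (x i)\<^sup>2)" by (rule sum.swap)
  also have "\<dots> = (\<Sum>i<n. (\<Sum>j<n. \<bar>M j i\<bar>) * (x i)\<^sup>2)" by (simp add: sum_distrib_right)
  also have "\<dots> \<le> (\<Sum>i<n. 1 * (x i)\<^sup>2)" using assms(2) by (intro sum_mono mult_right_mono) auto
  finally show "nrm n (mat_app n M x) \<le> 1 * nrm n x" by (simp add: L2_set_def)
qed

section \<open>Spread vectors and distances between columns\<close>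

definition sparse_good :: "nat \<Rightarrow> nat \<Rightarrow> (nat \<Rightarrow> nat \<Rightarrow> real) \<Rightarrow> real \<Rightarrow> real \<Rightarrow> bool" where
  "sparse_good n m M t g \<longleftrightarrow> (\<forall>x. nrm n x = 1 \<longrightarrow> card {i. i < n \<and> x i \<noteq> 0} \<le> m \<longrightarrow>
     g \<le> real (card {j. j < n \<and> t \<le> \<bar>mat_app n M x j\<bar>}))"

text \<open>Split x into its coordinates of size at least \<omega>/sqrt(n) and a rest of norm at
  most \<omega>. If the large part were sparse, its image off \<open>k\<close> would have norm below
  3\<omega> + 3\<omega>, while its norm is at least 1/2 and sparse goodness makes many image
  coordinates at least t/2. Coordinate \<open>k\<close> of the image is ignored because a normal to
  the columns other than \<open>k\<close> is not controlled there; this costs one row, hence g -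
  1.\<close>

lemma spread_of_small_image:
  assumes good: "sparse_good n m M t g" and op: "op_bounded n M 3"
    and x: "nrm n x = 1" and small: "L2_set (mat_app n M x) ({..<n} - {k}) < 3 * \<omega>"
    and \<omega>: "0 < \<omega>" "\<omega> \<le> 1 / 2" and t: "0 \<le> t" and large: "(6 * \<omega>)\<^sup>2 \<le> (g - 1) * (t / 2)\<^sup>2"
  shows "m < card {i. i < n \<and> \<omega> / sqrt (real n) \<le> \<bar>x i\<bar>}"
proof (rule ccontr)
  define B where "B = {i. i < n \<and> \<omega> / sqrt (real n) \<le> \<bar>x i\<bar>}"
  assume "\<not> ?thesis"
  then have B: "card B \<le> m" by (simp add: B_def)
  define y where "y i = (if i \<in> B then x i else 0)" for i
  define z where "z i = (if i \<in> B then 0 else x i)" for i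
  define r where "r = nrm n y"
  have n: "0 < n" using x by (cases n) auto
  have "nrm n z \<le> \<omega>"
  proof -
    have "(nrm n z)\<^sup>2 \<le> (\<Sum>i<n. (\<omega> / sqrt (real n))\<^sup>2)"
      unfolding L2_set_square[OF finite_lessThan]
    proof (intro sum_mono)
      fix i assume "i \<in> {..<n}"
      then have "\<bar>z i\<bar> \<le> \<bar>\<omega> / sqrt (real n)\<bar>" using \<omega> by (auto simp: z_def B_def)
      then show "(z i)\<^sup>2 \<le> (\<omega> / sqrt (real n))\<^sup>2" by (simp only: abs_le_square_iff)
    qed
    also have "\<dots> = \<omega>\<^sup>2" using n by (simp add: power_divide)
    finally show ?thesis using \<omega> by (simp add: power2_le_iff_abs_le)
  qed
  have xyz: "x = (\<lambda>i. y i + z i)" by (auto simp: y_def z_def)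
  have "nrm n x \<le> r + nrm n z" unfolding r_def by (subst xyz) (rule L2_set_triangle_ineq)
  then have r: "1 / 2 \<le> r" using x \<open>nrm n z \<le> \<omega>\<close> \<omega> by linarith
  have My: "mat_app n M y = (\<lambda>j. mat_app n M x j + - mat_app n M z j)"
    by (subst (1) xyz) (simp add: mat_app_def fun_eq_iff distrib_left sum.distrib)
  have "L2_set (mat_app n M y) ({..<n} - {k})
     \<le> L2_set (mat_app n M x) ({..<n} - {k}) + L2_set (\<lambda>j. - mat_app n M z j) ({..<n} - {k})"
    unfolding My by (rule L2_set_triangle_ineq)
  also have "L2_set (\<lambda>j. - mat_app n M z j) ({..<n} - {k}) \<le> nrm n (mat_app n M z)"
    unfolding L2_set_uminus by (intro L2_set_mono_set) auto
  also have "\<dots> \<le> 3 * \<omega>" using op_boundedD[OF op, of z] \<open>nrm n z \<le> \<omega>\<close> by linarith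
  finally have up: "L2_set (mat_app n M y) ({..<n} - {k}) < 6 * \<omega>" using small by linarith
  define w where "w i = 1 / r * y i" for i
  have w: "nrm n w = 1" using r unfolding w_def L2_set_scale r_def[symmetric] by simp
  have "{i. i < n \<and> w i \<noteq> 0} \<subseteq> B" by (auto simp: w_def y_def split: if_splits)
  then have "card {i. i < n \<and> w i \<noteq> 0} \<le> card B" by (intro card_mono) (auto simp: B_def)
  then have g: "g \<le> real (card {j. j < n \<and> t \<le> \<bar>mat_app n M w j\<bar>})"
    using good w B by (simp add: sparse_good_def)
  define T where "T = {j. j < n \<and> t \<le> \<bar>mat_app n M w j\<bar>}"
  have finT: "finite T" by (simp add: T_def)
  have wy: "mat_app n M y j = r * mat_app n M w j" for j
    using r by (simp add: w_def mat_app_def sum_distrib_left)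
  have "card T \<le> Suc (card (T - {k}))" using card_Suc_Diff1[OF finT, of k] by (cases "k \<in> T") auto
  then have gT: "g - 1 \<le> real (card (T - {k}))" using g by (simp add: T_def)
  have "(g - 1) * (t / 2)\<^sup>2 \<le> real (card (T - {k})) * (t / 2)\<^sup>2"
    using gT by (intro mult_right_mono) auto
  also have "\<dots> = (\<Sum>j\<in>T - {k}. (t / 2)\<^sup>2)" by simp
  also have "\<dots> \<le> (\<Sum>j\<in>T - {k}. (mat_app n M y j)\<^sup>2)"
  proof (intro sum_mono)
    fix j assume "j \<in> T - {k}"
    then have "1 / 2 * t \<le> r * \<bar>mat_app n M w j\<bar>" using r t by (intro mult_mono) (auto simp: T_def)
    then have "t / 2 \<le> \<bar>mat_app n M y j\<bar>" using r by (simp add: wy abs_mult)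
    then show "(t / 2)\<^sup>2 \<le> (mat_app n M y j)\<^sup>2" using t power_mono[of "t / 2" "\<bar>mat_app n M y j\<bar>" 2] by simp
  qed
  also have "\<dots> \<le> (\<Sum>j\<in>{..<n} - {k}. (mat_app n M y j)\<^sup>2)"
    by (intro sum_mono2) (auto simp: T_def)
  also have "\<dots> = (L2_set (mat_app n M y) ({..<n} - {k}))\<^sup>2" by (simp add: L2_set_square)
  also have "\<dots> < (6 * \<omega>)\<^sup>2" using up by (intro power_strict_mono) auto
  finally show False using large by simp
qed

text \<open>The choice operator makes the vector a function of the matrix, so equal matrices yield
  the same normal; its independence of column \<open>k\<close> will rest on this. Existence needs no
  invertibility: there are n - 1 equations in n unknowns.\<close>

definition unit_normal :: "nat \<Rightarrow> (nat \<Rightarrow> nat \<Rightarrow> real) \<Rightarrow> nat \<Rightarrow> nat \<Rightarrow> real" where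
  "unit_normal n M k = (SOME u. nrm n u = 1 \<and> (\<forall>i<n. i \<noteq> k \<longrightarrow> (\<Sum>j<n. u j * M j i) = 0))"

lemma unit_normal:
  assumes "k < n"
  shows "nrm n (unit_normal n M k) = 1"
    and "i < n \<Longrightarrow> i \<noteq> k \<Longrightarrow> (\<Sum>j<n. unit_normal n M k j * M j i) = 0"
proof -
  have "card ({..<n} - {k}) < card {..<n}" using assms by simp
  from linear_system_nontrivial_solution[OF _ _ this, of M]
  obtain c where c: "\<exists>j\<in>{..<n}. c j \<noteq> 0" "\<forall>i\<in>{..<n} - {k}. (\<Sum>j<n. c j * M j i) = 0" by blast
  have "nrm n c \<noteq> 0" using c(1) by (auto simp: L2_set_eq_0_iff)
  then have pos: "0 < nrm n c" using L2_set_nonneg[of c "{..<n}"] by linarith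
  have "nrm n (\<lambda>j. 1 / nrm n c * c j) = 1" unfolding L2_set_scale using pos by simp
  moreover have "(\<Sum>j<n. 1 / nrm n c * c j * M j i) = 0" if "i < n" "i \<noteq> k" for i
  proof -
    have "(\<Sum>j<n. 1 / nrm n c * c j * M j i) = 1 / nrm n c * (\<Sum>j<n. c j * M j i)"
      by (simp add: sum_distrib_left mult.assoc)
    then show ?thesis using c(2) that by simp
  qed
  ultimately have "\<exists>u. nrm n u = 1 \<and> (\<forall>i<n. i \<noteq> k \<longrightarrow> (\<Sum>j<n. u j * M j i) = 0)"
    by (intro exI[of _ "\<lambda>j. 1 / nrm n c * c j"]) blast
  from someI_ex[OF this, folded unit_normal_def]
  show "nrm n (unit_normal n M k) = 1"
    "i < n \<Longrightarrow> i \<noteq> k \<Longrightarrow> (\<Sum>j<n. unit_normal n M k j * M j i) = 0" by simp_all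
qed

text \<open>A dual witness that column \<open>k\<close> lies at distance at least \<open>d\<close>
  from the span of the other columns.\<close>

definition separated_column :: "nat \<Rightarrow> (nat \<Rightarrow> nat \<Rightarrow> real) \<Rightarrow> real \<Rightarrow> nat \<Rightarrow> bool" where
  "separated_column n M d k \<longleftrightarrow> (\<exists>u. nrm n u = 1 \<and> (\<forall>i<n. i \<noteq> k \<longrightarrow> (\<Sum>j<n. u j * M j i) = 0) \<and>
     d \<le> \<bar>\<Sum>j<n. u j * M j k\<bar>)"

text \<open>Pairing Mx with the witness \<open>u\<close> annihilates every column except
  \<open>k\<close> and leaves x_k times the inner product of \<open>u\<close> with that column;
  Cauchy-Schwarz concludes.\<close>

lemma norm_ge_separated_column:
  assumes "separated_column n M d k" "k < n"
  shows "\<bar>x k\<bar> * d \<le> nrm n (mat_app n M x)"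
proof -
  from assms obtain u where u: "nrm n u = 1" "\<And>i. i < n \<Longrightarrow> i \<noteq> k \<Longrightarrow> (\<Sum>j<n. u j * M j i) = 0"
    "d \<le> \<bar>\<Sum>j<n. u j * M j k\<bar>" by (auto simp: separated_column_def)
  have app: "mat_app n (\<lambda>i j. M j i) u i = (\<Sum>j<n. u j * M j i)" for i
    by (simp add: mat_app_def mult.commute)
  have "(\<Sum>i<n. x i * mat_app n (\<lambda>i j. M j i) u i) = (\<Sum>i\<in>{k}. x i * mat_app n (\<lambda>i j. M j i) u i)"
    using assms(2) u(2) by (intro sum.mono_neutral_right) (auto simp: app)
  then have "(\<Sum>j<n. u j * mat_app n M x j) = x k * (\<Sum>j<n. u j * M j k)"
    by (simp add: sum_mat_app_transpose app)
  then have "\<bar>x k\<bar> * \<bar>\<Sum>j<n. u j * M j k\<bar> \<le> nrm n u * nrm n (mat_app n M x)"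
    using L2_set_inner_le[of u "mat_app n M x" "{..<n}"] by (simp add: abs_mult)
  moreover have "\<bar>x k\<bar> * d \<le> \<bar>x k\<bar> * \<bar>\<Sum>j<n. u j * M j k\<bar>" using u(3) by (intro mult_left_mono) auto
  ultimately show ?thesis using u(1) by simp
qed

text \<open>Pigeonhole: a vector with short image has more than \<open>m\<close> large coordinates,
  and at most \<open>m\<close> columns fail to be separated, so some large coordinate belongs to a
  separated column.\<close>

lemma norm_lower_bound:
  assumes good: "sparse_good n m M t g" and op: "op_bounded n M 3" and x: "nrm n x = 1"
    and \<omega>: "0 < \<omega>" "\<omega> \<le> 1 / 2" and t: "0 \<le> t" and large: "(6 * \<omega>)\<^sup>2 \<le> (g - 1) * (t / 2)\<^sup>2"
    and sep: "card {k. k < n \<and> \<not> separated_column n M d k} \<le> m" and d: "0 \<le> d"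
  shows "min (3 * \<omega>) (\<omega> / sqrt (real n) * d) \<le> nrm n (mat_app n M x)"
proof (cases "nrm n (mat_app n M x) < 3 * \<omega>")
  case True
  \<comment> \<open>Here no coordinate has to be ignored; dropping coordinate 0 only decreases the
    norm.\<close>
  then have "L2_set (mat_app n M x) ({..<n} - {0}) < 3 * \<omega>"
    using L2_set_mono_set[of "{..<n} - {0}" "{..<n}" "mat_app n M x"] by simp
  from spread_of_small_image[OF good op x this \<omega> t large]
  have "card {k. k < n \<and> \<not> separated_column n M d k} < card {i. i < n \<and> \<omega> / sqrt (real n) \<le> \<bar>x i\<bar>}"
    using sep by linarith
  then have "\<not> {i. i < n \<and> \<omega> / sqrt (real n) \<le> \<bar>x i\<bar>} \<subseteq> {k. k < n \<and> \<not> separated_column n M d k}"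
    using card_mono[of "{k. k < n \<and> \<not> separated_column n M d k}" "{i. i < n \<and> \<omega> / sqrt (real n) \<le> \<bar>x i\<bar>}"]
    by fastforce
  then obtain k where k: "k < n" "separated_column n M d k" "\<omega> / sqrt (real n) \<le> \<bar>x k\<bar>" by auto
  have "\<omega> / sqrt (real n) * d \<le> \<bar>x k\<bar> * d" using k(3) d by (intro mult_right_mono) auto
  also have "\<dots> \<le> nrm n (mat_app n M x)" using k by (intro norm_ge_separated_column)
  finally show ?thesis by simp
qed auto

section \<open>Spectral norm and condition number\<close>

definition mat_fun :: "real mat \<Rightarrow> nat \<Rightarrow> nat \<Rightarrow> real" where
  "mat_fun M j i = M $$ (j, i)"

lemma vec_l2_norm_eq: "x \<in> carrier_vec n \<Longrightarrow> vec_l2_norm x = nrm n (\<lambda>i. x $ i)"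
  by (simp add: vec_l2_norm_def L2_set_def scalar_prod_def lessThan_atLeast0 power2_eq_square carrier_vecD)

lemma mult_mat_vec_eq_mat_app:
  "M \<in> carrier_mat n n \<Longrightarrow> x \<in> carrier_vec n \<Longrightarrow> j < n \<Longrightarrow>
    (M *\<^sub>v x) $ j = mat_app n (mat_fun M) (\<lambda>i. x $ i) j"
  by (auto simp: mat_app_def mat_fun_def scalar_prod_def lessThan_atLeast0 intro!: sum.cong)

lemma vec_l2_norm_mult_mat_vec:
  assumes "M \<in> carrier_mat n n" "x \<in> carrier_vec n"
  shows "vec_l2_norm (M *\<^sub>v x) = nrm n (mat_app n (mat_fun M) (\<lambda>i. x $ i))"
proof -
  have "vec_l2_norm (M *\<^sub>v x) = nrm n (\<lambda>i. (M *\<^sub>v x) $ i)"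
    using assms by (intro vec_l2_norm_eq) auto
  also have "\<dots> = nrm n (mat_app n (mat_fun M) (\<lambda>i. x $ i))"
    using assms by (intro L2_set_cong refl mult_mat_vec_eq_mat_app) auto
  finally show ?thesis .
qed

text \<open>A crude bound whose purpose is to show that the supremum defining the spectral norm is
  taken over a bounded set.\<close>

lemma op_bounded_exists: "\<exists>c. op_bounded n M c"
proof
  show "op_bounded n M (\<Sum>j<n. \<Sum>i<n. \<bar>M j i\<bar>)"
    unfolding op_bounded_def
  proof
    fix x
    have "nrm n (mat_app n M x) \<le> (\<Sum>j<n. \<bar>mat_app n M x j\<bar>)" by (rule L2_set_le_sum_abs)
    also have "\<dots> \<le> (\<Sum>j<n. \<Sum>i<n. \<bar>M j i\<bar> * nrm n x)"
    proof (intro sum_mono)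
      fix j
      have "\<bar>mat_app n M x j\<bar> \<le> (\<Sum>i<n. \<bar>M j i * x i\<bar>)" unfolding mat_app_def by (rule sum_abs)
      also have "\<dots> \<le> (\<Sum>i<n. \<bar>M j i\<bar> * nrm n x)"
      proof (intro sum_mono)
        fix i assume "i \<in> {..<n}"
        then have "\<bar>x i\<bar> \<le> nrm n x"
          using member_le_L2_set[of "{..<n}" i x] member_le_L2_set[of "{..<n}" i "\<lambda>i. - x i"]
          by (simp add: L2_set_uminus abs_le_iff)
        then show "\<bar>M j i * x i\<bar> \<le> \<bar>M j i\<bar> * nrm n x" by (simp add: abs_mult mult_left_mono)
      qed
      finally show "\<bar>mat_app n M x j\<bar> \<le> (\<Sum>i<n. \<bar>M j i\<bar> * nrm n x)" .
    qed
    finally show "nrm n (mat_app n M x) \<le> (\<Sum>j<n. \<Sum>i<n. \<bar>M j i\<bar>) * nrm n x"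
      by (simp add: sum_distrib_right)
  qed
qed

lemma mat_app_cong:
  "(\<And>i. i < n \<Longrightarrow> M j i = N j i) \<Longrightarrow> (\<And>i. i < n \<Longrightarrow> x i = y i) \<Longrightarrow> mat_app n M x j = mat_app n N y j"
  unfolding mat_app_def by (intro sum.cong) auto

lemma mat_app_scale: "mat_app n M (\<lambda>i. c * x i) j = c * mat_app n M x j"
  by (simp add: mat_app_def sum_distrib_left mult_ac)

lemma bdd_above_spectral_norm:
  assumes M: "M \<in> carrier_mat n n"
  shows "bdd_above ((\<lambda>x. vec_l2_norm (M *\<^sub>v x)) ` {x \<in> carrier_vec (dim_col M). vec_l2_norm x \<le> 1})"
proof -
  obtain c where c: "op_bounded n (mat_fun M) c" using op_bounded_exists by blast
  show ?thesis
  proof (rule bdd_aboveI2[where M = "\<bar>c\<bar>"])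
    fix v assume v: "v \<in> {x \<in> carrier_vec (dim_col M). vec_l2_norm x \<le> 1}"
    then have vn: "v \<in> carrier_vec n" "nrm n (\<lambda>i. v $ i) \<le> 1"
      using M vec_l2_norm_eq[of v n] by auto
    have "vec_l2_norm (M *\<^sub>v v) \<le> c * nrm n (\<lambda>i. v $ i)"
      using vec_l2_norm_mult_mat_vec[OF M vn(1)] op_boundedD[OF c] by simp
    also have "\<dots> \<le> \<bar>c\<bar> * 1" using vn(2) by (intro mult_mono) auto
    finally show "vec_l2_norm (M *\<^sub>v v) \<le> \<bar>c\<bar>" by simp
  qed
qed

lemma spectral_norm_nonneg:
  assumes M: "M \<in> carrier_mat n n"
  shows "0 \<le> spectral_norm M"
proof -
  have "0\<^sub>v n \<in> {x \<in> carrier_vec (dim_col M). vec_l2_norm x \<le> 1}"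
    using M by (simp add: vec_l2_norm_def)
  then have "vec_l2_norm (M *\<^sub>v 0\<^sub>v n) \<le> spectral_norm M"
    unfolding spectral_norm_def by (intro cSUP_upper bdd_above_spectral_norm[OF M])
  then show ?thesis using M by (simp add: vec_l2_norm_def scalar_prod_def)
qed

lemma op_bounded_spectral_norm:
  assumes M: "M \<in> carrier_mat n n"
  shows "op_bounded n (mat_fun M) (spectral_norm M)"
  unfolding op_bounded_def
proof
  fix x
  show "nrm n (mat_app n (mat_fun M) x) \<le> spectral_norm M * nrm n x"
  proof (cases "nrm n x = 0")
    case True
    then have "mat_app n (mat_fun M) x j = 0" for j by (simp add: L2_set_eq_0_iff mat_app_def)
    then show ?thesis using True by (simp add: L2_set_def)
  next
    case False
    then have pos: "0 < nrm n x" using L2_set_nonneg[of x "{..<n}"] by linarith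
    define v where "v = vec n (\<lambda>i. 1 / nrm n x * x i)"
    have v: "v \<in> carrier_vec n" by (simp add: v_def)
    have nv: "nrm n (\<lambda>i. v $ i) = nrm n (\<lambda>i. 1 / nrm n x * x i)"
      by (intro L2_set_cong) (auto simp: v_def)
    also have "\<dots> = 1" unfolding L2_set_scale using pos by simp
    finally have "v \<in> {x \<in> carrier_vec (dim_col M). vec_l2_norm x \<le> 1}"
      using v M by (simp add: vec_l2_norm_eq)
    then have "vec_l2_norm (M *\<^sub>v v) \<le> spectral_norm M"
      unfolding spectral_norm_def by (intro cSUP_upper bdd_above_spectral_norm[OF M])
    moreover have "vec_l2_norm (M *\<^sub>v v) = nrm n (\<lambda>j. 1 / nrm n x * mat_app n (mat_fun M) x j)"
    proof -
      have "mat_app n (mat_fun M) (\<lambda>i. v $ i) j = 1 / nrm n x * mat_app n (mat_fun M) x j" for j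
        unfolding mat_app_scale[symmetric] by (rule mat_app_cong) (auto simp: v_def)
      then show ?thesis
        unfolding vec_l2_norm_mult_mat_vec[OF M v] by (intro L2_set_cong refl)
    qed
    ultimately show ?thesis using pos by (simp only: L2_set_scale) (simp add: field_simps)
  qed
qed

lemma spectral_norm_le:
  assumes M: "M \<in> carrier_mat n n" and op: "op_bounded n (mat_fun M) c" and c: "0 \<le> c"
  shows "spectral_norm M \<le> c"
  unfolding spectral_norm_def
proof (rule cSUP_least)
  have "0\<^sub>v (dim_col M) \<in> {x \<in> carrier_vec (dim_col M). vec_l2_norm x \<le> 1}"
    by (simp add: vec_l2_norm_def)
  then show "{x \<in> carrier_vec (dim_col M). vec_l2_norm x \<le> 1} \<noteq> {}" by blast
next
  fix v assume "v \<in> {x \<in> carrier_vec (dim_col M). vec_l2_norm x \<le> 1}"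
  then have v: "v \<in> carrier_vec n" "nrm n (\<lambda>i. v $ i) \<le> 1" using M vec_l2_norm_eq[of v n] by auto
  have "vec_l2_norm (M *\<^sub>v v) \<le> c * nrm n (\<lambda>i. v $ i)"
    using vec_l2_norm_mult_mat_vec[OF M v(1)] op_boundedD[OF op] by simp
  also have "\<dots> \<le> c * 1" using v(2) c by (intro mult_left_mono)
  finally show "vec_l2_norm (M *\<^sub>v v) \<le> c" by simp
qed

text \<open>The lower bound \<sigma> excludes a kernel, so the determinant is nonzero and
  \<open>mat_inverse\<close> succeeds. Applied to vectors M'v, the same bound shows that the inverse
  M' has norm at most 1/\<sigma>.\<close>

lemma condition_number_le:
  assumes M: "M \<in> carrier_mat n n" and op: "op_bounded n (mat_fun M) c" and c: "0 \<le> c"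
    and \<sigma>: "0 < \<sigma>" and low: "\<And>x. nrm n x = 1 \<Longrightarrow> \<sigma> \<le> nrm n (mat_app n (mat_fun M) x)"
  shows "condition_number M \<le> ereal (c / \<sigma>)"
proof -
  have low': "\<sigma> * nrm n x \<le> nrm n (mat_app n (mat_fun M) x)" for x
  proof (cases "nrm n x = 0")
    case False
    then have pos: "0 < nrm n x" using L2_set_nonneg[of x "{..<n}"] by linarith
    have "nrm n (\<lambda>i. 1 / nrm n x * x i) = 1" unfolding L2_set_scale using pos by simp
    from low[OF this] have "\<sigma> \<le> nrm n (\<lambda>j. 1 / nrm n x * mat_app n (mat_fun M) x j)"
      by (simp only: mat_app_scale[abs_def])
    then show ?thesis using pos by (simp only: L2_set_scale) (simp add: field_simps)
  qed simp
  have "det M \<noteq> 0"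
  proof
    assume "det M = 0"
    then obtain v where v: "v \<in> carrier_vec n" "v \<noteq> 0\<^sub>v n" "M *\<^sub>v v = 0\<^sub>v n"
      using det_0_iff_vec_prod_zero_field[OF M] by blast
    have "nrm n (mat_app n (mat_fun M) (\<lambda>i. v $ i)) = 0"
      using vec_l2_norm_mult_mat_vec[OF M v(1)] v(3) by (simp add: vec_l2_norm_def)
    then have "nrm n (\<lambda>i. v $ i) \<le> 0" using low'[of "\<lambda>i. v $ i"] \<sigma> by (simp add: mult_le_0_iff)
    then have "nrm n (\<lambda>i. v $ i) = 0" using L2_set_nonneg[of "\<lambda>i. v $ i" "{..<n}"] by linarith
    then have "v = 0\<^sub>v n" using v(1) by (intro eq_vecI) (auto simp: L2_set_eq_0_iff)
    then show False using v(2) by simp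
  qed
  then have "M \<in> Units (ring_mat TYPE(real) n ())" by (rule det_non_zero_imp_unit[OF M])
  then obtain M' where M': "mat_inverse M = Some M'" using mat_inverse(1)[OF M, where b = "()"] by (cases "mat_inverse M") auto
  from mat_inverse(2)[OF M M'] have inv: "M * M' = 1\<^sub>m n" "M' \<in> carrier_mat n n" by auto
  have "op_bounded n (mat_fun M') (1 / \<sigma>)"
    unfolding op_bounded_def
  proof
    fix x :: "nat \<Rightarrow> real"
    define v where "v = vec n x"
    have v: "v \<in> carrier_vec n" by (simp add: v_def)
    have nv: "nrm n (\<lambda>i. v $ i) = nrm n x" by (intro L2_set_cong) (auto simp: v_def)
    have "M *\<^sub>v (M' *\<^sub>v v) = v"
      using assoc_mult_mat_vec[OF M inv(2) v] inv(1) v by simp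
    then have "nrm n x = vec_l2_norm (M *\<^sub>v (M' *\<^sub>v v))" using nv vec_l2_norm_eq[OF v] by simp
    also have "\<dots> = nrm n (mat_app n (mat_fun M) (\<lambda>i. (M' *\<^sub>v v) $ i))"
      using inv v by (intro vec_l2_norm_mult_mat_vec[OF M]) auto
    finally have "\<sigma> * nrm n (\<lambda>i. (M' *\<^sub>v v) $ i) \<le> nrm n x" using low'[of "\<lambda>i. (M' *\<^sub>v v) $ i"] by simp
    moreover have "nrm n (\<lambda>i. (M' *\<^sub>v v) $ i) = nrm n (mat_app n (mat_fun M') x)"
    proof (intro L2_set_cong refl)
      fix j assume "j \<in> {..<n}"
      then have "(M' *\<^sub>v v) $ j = mat_app n (mat_fun M') (\<lambda>i. v $ i) j"
        by (intro mult_mat_vec_eq_mat_app inv v) auto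
      also have "\<dots> = mat_app n (mat_fun M') x j" by (rule mat_app_cong) (auto simp: v_def)
      finally show "(M' *\<^sub>v v) $ j = mat_app n (mat_fun M') x j" .
    qed
    ultimately show "nrm n (mat_app n (mat_fun M') x) \<le> 1 / \<sigma> * nrm n x"
      using \<sigma> by (simp add: field_simps)
  qed
  then have "spectral_norm M' \<le> 1 / \<sigma>" using \<sigma> by (intro spectral_norm_le[OF inv(2)]) auto
  moreover have "spectral_norm M \<le> c" using M op c by (rule spectral_norm_le)
  moreover have "0 \<le> spectral_norm M'" using inv(2) by (rule spectral_norm_nonneg)
  ultimately have "spectral_norm M * spectral_norm M' \<le> c * (1 / \<sigma>)"
    using c by (intro mult_mono) auto
  then show ?thesis by (simp add: condition_number_def M')
qed

lemma pattern_matrix_rows: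
  assumes pat: "pattern_matrix n \<alpha> \<beta> \<gamma> \<rho> V" and \<eta>: "\<And>i. i < n \<Longrightarrow> \<eta> i \<in> {-1, 1 :: real}"
    and x: "nrm n x = 1" "real (card {i. i < n \<and> x i \<noteq> 0}) \<le> \<alpha> * real n"
  shows "\<gamma> * real n \<le> real (card {j. j < n \<and> \<beta> \<le> \<bar>\<Sum>i<n. mat_fun V j i * \<eta> i * x i\<bar>})"
    and "\<gamma> * real n \<le> real (card {j. j < n \<and> \<beta> \<le> \<bar>\<Sum>i<n. mat_fun V i j * \<eta> i * x i\<bar>})"
proof -
  define v where "v = vec n x"
  have v: "v \<in> carrier_vec n" by (simp add: v_def)
  have V: "V \<in> carrier_mat n n" using pat by (simp add: pattern_matrix_def)
  have "nrm n (\<lambda>i. v $ i) = nrm n x" by (intro L2_set_cong) (auto simp: v_def)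
  then have "vec_l2_norm v = 1" using v x(1) by (simp add: vec_l2_norm_eq)
  moreover have "{i. i < n \<and> v $ i \<noteq> 0} = {i. i < n \<and> x i \<noteq> 0}" by (auto simp: v_def)
  ultimately have
    "\<gamma> * real n \<le> real (card {j. j < n \<and> \<bar>((V * mat_diag n \<eta>) *\<^sub>v v) $ j\<bar> \<ge> \<beta>})"
    "\<gamma> * real n \<le> real (card {j. j < n \<and> \<bar>((transpose_mat V * mat_diag n \<eta>) *\<^sub>v v) $ j\<bar> \<ge> \<beta>})"
    using pat v x(2) \<eta> unfolding pattern_matrix_def by auto
  moreover have "((V * mat_diag n \<eta>) *\<^sub>v v) $ j = (\<Sum>i<n. mat_fun V j i * \<eta> i * x i)" if "j < n" for j
    using that V by (simp add: mat_diag_mult_right[OF V] scalar_prod_def v_def mat_fun_def lessThan_atLeast0)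
  moreover have "((transpose_mat V * mat_diag n \<eta>) *\<^sub>v v) $ j = (\<Sum>i<n. mat_fun V i j * \<eta> i * x i)" if "j < n" for j
  proof -
    have VT: "transpose_mat V \<in> carrier_mat n n" using V by simp
    show ?thesis
      using that V by (simp add: mat_diag_mult_right[OF VT] scalar_prod_def v_def mat_fun_def lessThan_atLeast0)
  qed
  ultimately show "\<gamma> * real n \<le> real (card {j. j < n \<and> \<beta> \<le> \<bar>\<Sum>i<n. mat_fun V j i * \<eta> i * x i\<bar>})"
    "\<gamma> * real n \<le> real (card {j. j < n \<and> \<beta> \<le> \<bar>\<Sum>i<n. mat_fun V i j * \<eta> i * x i\<bar>})"
    by (simp_all cong: conj_cong)
qed

section \<open>The perturbed matrix\<close>

definition row_count :: "nat \<Rightarrow> (nat \<Rightarrow> nat set) \<Rightarrow> nat \<Rightarrow> nat" where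
  "row_count n J j = card {i. i < n \<and> j \<in> J i}"

definition R2_entry ::
  "nat \<Rightarrow> nat \<Rightarrow> nat \<Rightarrow> (nat \<Rightarrow> nat set) \<Rightarrow> (nat \<times> nat \<Rightarrow> real) \<Rightarrow> nat \<Rightarrow> nat \<Rightarrow> real" where
  "R2_entry n K L J X j i = (if j \<in> J i \<and> row_count n J j \<le> L
     then \<Sum>l | l < K \<and> sorted_list_of_set (J i) ! l = j. X (l, i) / real L else 0)"

definition perturbed ::
  "nat \<Rightarrow> nat \<Rightarrow> nat \<Rightarrow> (nat \<Rightarrow> nat \<Rightarrow> real) \<Rightarrow> (nat \<Rightarrow> nat \<Rightarrow> real) \<Rightarrow> real \<Rightarrow> real \<Rightarrow>
    (nat \<times> nat \<Rightarrow> real) \<Rightarrow> (nat \<Rightarrow> nat set) \<Rightarrow> (nat \<times> nat \<Rightarrow> real) \<Rightarrow> nat \<Rightarrow> nat \<Rightarrow> real" where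
  "perturbed n K L A V s \<epsilon> \<eta> J X j i =
     A j i + s * (\<eta> (1, j) * V j i * \<eta> (2, i)) + \<epsilon> * R2_entry n K L J X j i"

lemma mat_fun_perturbed:
  assumes "A \<in> carrier_mat n n" "V \<in> carrier_mat n n" "j < n" "i < n"
  shows "mat_fun (A + \<epsilon> \<cdot>\<^sub>m (R1_mat n V \<rho> \<eta> + R2_mat n K L J X)) j i
    = perturbed n K L (mat_fun A) (mat_fun V) (\<epsilon> * inverse (\<rho> * sqrt (real n))) \<epsilon> \<eta> J X j i"
proof -
  have "{i'. i' < n \<and> H_bar_mat n J $$ (j, i') \<noteq> 0} = {i. i < n \<and> j \<in> J i}"
    using assms(3) by (auto simp: H_bar_mat_def split: if_splits)
  then have "R2_mat n K L J X $$ (j, i) = R2_entry n K L J X j i"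
    using assms(3,4)
    by (simp add: R2_mat_def hadamard_prod_def H_mat_def R2_bar_mat_def H_bar_mat_def R2_entry_def row_count_def)
  moreover have "R1_mat n V \<rho> \<eta> $$ (j, i) = inverse (\<rho> * sqrt (real n)) * (\<eta> (1, j) * V $$ (j, i) * \<eta> (2, i))"
    using assms(2-4) by (simp add: R1_mat_def mat_diag_mult_left[OF assms(2)] mat_diag_mult_right[where nr = n])
  moreover have "R1_mat n V \<rho> \<eta> \<in> carrier_mat n n" "R2_mat n K L J X \<in> carrier_mat n n"
    by (auto simp: R1_mat_def R2_mat_def hadamard_prod_def H_mat_def
        mat_diag_mult_left[OF assms(2)] mat_diag_mult_right[where nr = n])
  ultimately show ?thesis
    using assms by (simp add: mat_fun_def perturbed_def algebra_simps)
qed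

definition valid_supports :: "nat \<Rightarrow> nat \<Rightarrow> (nat \<Rightarrow> nat set) \<Rightarrow> bool" where
  "valid_supports n K J \<longleftrightarrow> (\<forall>i<n. J i = {} \<or> J i \<subseteq> {..<n} \<and> card (J i) = K)"

definition valid_signs :: "'a set \<Rightarrow> ('a \<Rightarrow> real) \<Rightarrow> bool" where
  "valid_signs I X \<longleftrightarrow> (\<forall>p\<in>I. X p \<in> {-1, 1})"

lemma R2_entry_abs_le:
  assumes J: "valid_supports n K J" and X: "valid_signs ({..<K} \<times> {..<n}) X" and i: "i < n"
  shows "\<bar>R2_entry n K L J X j i\<bar> \<le> (if j \<in> J i \<and> row_count n J j \<le> L then 1 / real L else 0)"
proof (cases "j \<in> J i \<and> row_count n J j \<le> L")
  case True
  then have Ji: "J i \<subseteq> {..<n}" "card (J i) = K" using J i by (auto simp: valid_supports_def)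
  define Q where "Q = {l. l < K \<and> sorted_list_of_set (J i) ! l = j}"
  have "card Q \<le> Suc 0"
  proof (rule card_le_Suc0_iff_eq[THEN iffD2])
    show "\<forall>l\<in>Q. \<forall>l'\<in>Q. l = l'"
      using Ji by (auto simp: Q_def nth_eq_iff_index_eq)
  qed (simp add: Q_def)
  have "\<bar>R2_entry n K L J X j i\<bar> = \<bar>\<Sum>l\<in>Q. X (l, i) / real L\<bar>" using True by (simp add: R2_entry_def Q_def)
  also have "\<dots> \<le> (\<Sum>l\<in>Q. \<bar>X (l, i) / real L\<bar>)" by (rule sum_abs)
  also have "\<dots> = (\<Sum>l\<in>Q. 1 / real L)"
  proof (intro sum.cong refl)
    fix l assume "l \<in> Q"
    then have "X (l, i) \<in> {-1, 1}" using X i unfolding valid_signs_def Q_def by blast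
    then show "\<bar>X (l, i) / real L\<bar> = 1 / real L" by auto
  qed
  also have "\<dots> = real (card Q) * (1 / real L)" by simp
  also have "\<dots> \<le> 1 * (1 / real L)" using \<open>card Q \<le> Suc 0\<close> by (intro mult_right_mono) auto
  finally show ?thesis using True by simp
qed (auto simp: R2_entry_def)

text \<open>Entries have size at most 1/L. After truncation a row holds at most \<open>L\<close> of
  them, and a column holds at most K \<le> L, so the Schur test applies.\<close>

lemma op_bounded_R2_entry:
  assumes J: "valid_supports n K J" and X: "valid_signs ({..<K} \<times> {..<n}) X" and L: "K \<le> L" "1 \<le> L"
  shows "op_bounded n (R2_entry n K L J X) 1"
proof (rule Schur_test)
  fix j assume "j < n"
  have "(\<Sum>i<n. \<bar>R2_entry n K L J X j i\<bar>) \<le> (\<Sum>i<n. if j \<in> J i \<and> row_count n J j \<le> L then 1 / real L else 0)"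
    by (intro sum_mono R2_entry_abs_le J X) simp
  also have "\<dots> = real (card {i\<in>{..<n}. j \<in> J i \<and> row_count n J j \<le> L}) * (1 / real L)"
    by (subst sum.inter_filter[symmetric]) auto
  also have "\<dots> \<le> real L * (1 / real L)"
  proof (intro mult_right_mono)
    have "card {i\<in>{..<n}. j \<in> J i \<and> row_count n J j \<le> L} \<le> L"
      by (cases "row_count n J j \<le> L") (auto simp: row_count_def)
    then show "real (card {i\<in>{..<n}. j \<in> J i \<and> row_count n J j \<le> L}) \<le> real L" by simp
  qed simp
  also have "\<dots> = 1" using L by simp
  finally show "(\<Sum>i<n. \<bar>R2_entry n K L J X j i\<bar>) \<le> 1" .
next
  fix i assume i: "i < n"
  have "(\<Sum>j<n. \<bar>R2_entry n K L J X j i\<bar>) \<le> (\<Sum>j<n. if j \<in> J i then 1 / real L else 0)"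
    using R2_entry_abs_le[OF J X i] by (intro sum_mono) (smt (verit) divide_nonneg_nonneg of_nat_0_le_iff)
  also have "\<dots> = real (card {j\<in>{..<n}. j \<in> J i}) * (1 / real L)"
    by (subst sum.inter_filter[symmetric]) auto
  also have "\<dots> \<le> real L * (1 / real L)"
  proof (intro mult_right_mono)
    have "J i = {} \<or> J i \<subseteq> {..<n} \<and> card (J i) = K" using J i by (simp add: valid_supports_def)
    then have "card {j\<in>{..<n}. j \<in> J i} \<le> K"
    proof
      assume *: "J i \<subseteq> {..<n} \<and> card (J i) = K"
      then have "{j\<in>{..<n}. j \<in> J i} = J i" by auto
      then show ?thesis using * by simp
    qed simp
    then show "real (card {j\<in>{..<n}. j \<in> J i}) \<le> real L" using L by simp
  qed simp
  also have "\<dots> = 1" using L by simp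
  finally show "(\<Sum>j<n. \<bar>R2_entry n K L J X j i\<bar>) \<le> 1" .
qed

lemma nrm_signs:
  assumes "\<And>i. i < n \<Longrightarrow> a i \<in> {-1, 1 :: real}"
  shows "nrm n (\<lambda>i. a i * x i) = nrm n x"
  unfolding L2_set_def using assms by (intro arg_cong[of _ _ sqrt] sum.cong refl) fastforce

lemma op_bounded_signs:
  assumes V: "op_bounded n V c" and a: "\<And>i. i < n \<Longrightarrow> a i \<in> {-1, 1}" and b: "\<And>i. i < n \<Longrightarrow> b i \<in> {-1, 1}"
  shows "op_bounded n (\<lambda>j i. a j * V j i * b i) c"
  unfolding op_bounded_def
proof
  fix x
  have "mat_app n (\<lambda>j i. a j * V j i * b i) x = (\<lambda>j. a j * mat_app n V (\<lambda>i. b i * x i) j)"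
    by (simp add: mat_app_def fun_eq_iff sum_distrib_left mult_ac)
  then have "nrm n (mat_app n (\<lambda>j i. a j * V j i * b i) x) = nrm n (mat_app n V (\<lambda>i. b i * x i))"
    using nrm_signs[OF a] by simp
  also have "\<dots> \<le> c * nrm n (\<lambda>i. b i * x i)" by (rule op_boundedD[OF V])
  finally show "nrm n (mat_app n (\<lambda>j i. a j * V j i * b i) x) \<le> c * nrm n x"
    using nrm_signs[OF b] by simp
qed

lemma op_bounded_perturbed:
  assumes A: "op_bounded n A 1" and V: "op_bounded n V c" and s: "0 \<le> s" "s * c \<le> 1" and \<epsilon>: "0 \<le> \<epsilon>" "\<epsilon> \<le> 1"
    and \<eta>: "valid_signs ({1, 2} \<times> {..<n}) \<eta>"
    and J: "valid_supports n K J" and X: "valid_signs ({..<K} \<times> {..<n}) X" and L: "K \<le> L" "1 \<le> L"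
  shows "op_bounded n (perturbed n K L A V s \<epsilon> \<eta> J X) 3"
proof -
  have "op_bounded n (\<lambda>j i. s * (\<eta> (1, j) * V j i * \<eta> (2, i))) (\<bar>s\<bar> * c)"
    using \<eta> by (intro op_bounded_scale op_bounded_signs V) (auto simp: valid_signs_def)
  moreover have "op_bounded n (\<lambda>j i. \<epsilon> * R2_entry n K L J X j i) (\<bar>\<epsilon>\<bar> * 1)"
    by (intro op_bounded_scale op_bounded_R2_entry J X L)
  ultimately have "op_bounded n (\<lambda>j i. (A j i + s * (\<eta> (1, j) * V j i * \<eta> (2, i))) + \<epsilon> * R2_entry n K L J X j i)
     ((1 + \<bar>s\<bar> * c) + \<bar>\<epsilon>\<bar> * 1)"
    by (intro op_bounded_add A)
  then have "op_bounded n (\<lambda>j i. (A j i + s * (\<eta> (1, j) * V j i * \<eta> (2, i))) + \<epsilon> * R2_entry n K L J X j i) 3"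
    by (rule op_bounded_mono) (use s \<epsilon> in auto)
  then show ?thesis unfolding perturbed_def[abs_def] .
qed

section \<open>Emptying the support of one column\<close>

lemma row_count_remove:
  "row_count n (J(k := {})) j = card {i. i < n \<and> i \<noteq> k \<and> j \<in> J i}"
  unfolding row_count_def by (intro arg_cong[of _ _ card]) auto

lemma row_count_insert:
  assumes "k < n"
  shows "row_count n J j = row_count n (J(k := {})) j + (if j \<in> J k then 1 else 0)"
proof -
  have "{i. i < n \<and> j \<in> J i} = {i. i < n \<and> i \<noteq> k \<and> j \<in> J i} \<union> (if j \<in> J k then {k} else {})"
    using assms by auto
  then show ?thesis unfolding row_count_remove unfolding row_count_def by (auto simp: card_insert_if)
qed

text \<open>Emptying column \<open>k\<close> could bring a truncated row back to life. If every row
  hit by column \<open>k\<close> has fewer than \<open>L\<close> other entries, it stays within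
  \<open>L\<close> when column \<open>k\<close> is counted, so it is kept in both matrices; the
  other rows have unchanged counts.\<close>

lemma R2_entry_remove_column:
  assumes "k < n" "\<And>j. j \<in> J k \<Longrightarrow> row_count n (J(k := {})) j < L" "i \<noteq> k"
  shows "R2_entry n K L (J(k := {})) X j i = R2_entry n K L J X j i"
  using assms(2)[of j] assms(3) row_count_insert[OF assms(1), of J j] by (auto simp: R2_entry_def)

text \<open>With its support empty, column \<open>k\<close> vanishes and does not count in any row,
  so neither its former support nor its signs are seen.\<close>

lemma R2_entry_removed_cong:
  assumes "\<And>i. i \<noteq> k \<Longrightarrow> J i = J' i" "\<And>l i. i \<noteq> k \<Longrightarrow> X (l, i) = X' (l, i)"
  shows "R2_entry n K L (J(k := {})) X = R2_entry n K L (J'(k := {})) X'"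
proof -
  have e: "J(k := {}) = J'(k := {})" using assms(1) by (auto simp: fun_eq_iff)
  have "R2_entry n K L (J'(k := {})) X j i = R2_entry n K L (J'(k := {})) X' j i" for j i
    using assms(2) by (cases "i = k") (auto simp: R2_entry_def intro!: sum.cong)
  then show ?thesis unfolding e by (intro ext)
qed

text \<open>Indexing by the position in the sorted support instead of the row exhibits the inner
  product as a Rademacher sum. The assumption \<open>free\<close> guarantees that no entry of the
  column is truncated.\<close>

lemma inner_R2_column:
  assumes "k < n" "J k \<subseteq> {..<n}" "card (J k) = K"
    and free: "\<And>j. j \<in> J k \<Longrightarrow> row_count n (J(k := {})) j < L"
  shows "(\<Sum>j<n. u j * R2_entry n K L J X j k)
    = (\<Sum>l<K. X (l, k) * u (sorted_list_of_set (J k) ! l)) / real L"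
proof -
  have fin: "finite (J k)" using assms(2) finite_subset by blast
  have "(\<Sum>j<n. u j * R2_entry n K L J X j k) = (\<Sum>j\<in>J k. u j * R2_entry n K L J X j k)"
    using assms(2) by (intro sum.mono_neutral_right) (auto simp: R2_entry_def)
  also have "\<dots> = (\<Sum>j\<in>J k. \<Sum>l<K. if sorted_list_of_set (J k) ! l = j then X (l, k) * u j / real L else 0)"
  proof (intro sum.cong refl)
    fix j assume j: "j \<in> J k"
    then have "row_count n J j \<le> L" using free[OF j] row_count_insert[OF assms(1), of J j] by simp
    then have "u j * R2_entry n K L J X j k
       = (\<Sum>l\<in>{l\<in>{..<K}. sorted_list_of_set (J k) ! l = j}. X (l, k) * u j / real L)"
      using j by (simp add: R2_entry_def sum_distrib_left mult_ac)
    then show "u j * R2_entry n K L J X j k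
       = (\<Sum>l<K. if sorted_list_of_set (J k) ! l = j then X (l, k) * u j / real L else 0)"
      by (simp only: sum.inter_filter[OF finite_lessThan])
  qed
  also have "\<dots> = (\<Sum>l<K. \<Sum>j\<in>J k. if sorted_list_of_set (J k) ! l = j then X (l, k) * u j / real L else 0)"
    by (rule sum.swap)
  also have "\<dots> = (\<Sum>l<K. X (l, k) * u (sorted_list_of_set (J k) ! l) / real L)"
  proof (intro sum.cong refl)
    fix l assume "l \<in> {..<K}"
    then have "sorted_list_of_set (J k) ! l \<in> J k"
      using fin assms(3) by (metis length_sorted_list_of_set lessThan_iff nth_mem set_sorted_list_of_set)
    then show "(\<Sum>j\<in>J k. if sorted_list_of_set (J k) ! l = j then X (l, k) * u j / real L else 0)
      = X (l, k) * u (sorted_list_of_set (J k) ! l) / real L" using fin by simp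
  qed
  finally show ?thesis by (simp add: sum_divide_distrib)
qed

lemma card_positions_eq:
  assumes "finite S" "card S = K"
  shows "card {l. l < K \<and> P (sorted_list_of_set S ! l)} = card {j\<in>S. P j}"
proof (rule bij_betw_same_card)
  show "bij_betw (\<lambda>l. sorted_list_of_set S ! l) {l. l < K \<and> P (sorted_list_of_set S ! l)} {j\<in>S. P j}"
    unfolding bij_betw_def
  proof
    show "inj_on ((!) (sorted_list_of_set S)) {l. l < K \<and> P (sorted_list_of_set S ! l)}"
      using assms by (auto simp: inj_on_def nth_eq_iff_index_eq)
    show "(!) (sorted_list_of_set S) ` {l. l < K \<and> P (sorted_list_of_set S ! l)} = {j\<in>S. P j}"
    proof safe
      fix l assume "l < K"
      then show "sorted_list_of_set S ! l \<in> S"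
        using assms by (metis length_sorted_list_of_set nth_mem set_sorted_list_of_set)
    next
      fix j assume j: "j \<in> S" "P j"
      then obtain l where "l < K" "sorted_list_of_set S ! l = j"
        using assms by (metis in_set_conv_nth length_sorted_list_of_set set_sorted_list_of_set)
      then show "j \<in> (!) (sorted_list_of_set S) ` {l. l < K \<and> P (sorted_list_of_set S ! l)}"
        using j by auto
    qed
  qed
qed

section \<open>Failure probabilities\<close>

lemma card_Collect_lessThan_pair:
  "card {p \<in> {r} \<times> {..<n}. P (snd p)} = card {j. j < n \<and> P j}"
  by (rule bij_betw_same_card[of snd], rule bij_betwI[of _ _ _ "Pair r"]) auto

definition sparse_failure_bound :: "nat \<Rightarrow> nat \<Rightarrow> real \<Rightarrow> real" where
  "sparse_failure_bound n m g =
     real (\<Sum>i\<le>m. n choose i) * (real (\<Sum>i\<le>Suc m. (3 * n) choose i) * exp (- g / 20))"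

lemma sparse_failure_bound_nonneg: "0 \<le> sparse_failure_bound n m g"
  unfolding sparse_failure_bound_def by (intro mult_nonneg_nonneg of_nat_0_le_iff exp_ge_zero)

lemma prob_not_sparse_good_le:
  fixes C W :: "nat \<Rightarrow> nat \<Rightarrow> real" and r :: nat
  assumes "0 < s" "0 < b"
    and good: "\<And>x. nrm n x = 1 \<Longrightarrow> card {i. i < n \<and> x i \<noteq> 0} \<le> m \<Longrightarrow>
      g \<le> real (card {j. j < n \<and> b < \<bar>\<Sum>i<n. W j i * x i\<bar>})"
  shows "measure_pmf.prob (Pi_pmf ({r} \<times> {..<n}) 0 (\<lambda>_. rademacher_pmf))
     {h. \<not> sparse_good n m (\<lambda>j i. C j i + s * h (r, j) * W j i) (s * b) (g / 4)} \<le> sparse_failure_bound n m g"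
proof -
  let ?I = "{r} \<times> {..<n}"
  let ?P = "Pi_pmf ?I 0 (\<lambda>_. rademacher_pmf)"
  have split: "mat_app n (\<lambda>j i. C j i + s * h (r, j) * W j i) x j
      = (\<Sum>i<n. C j i * x i) + s * h (r, j) * (\<Sum>i<n. W j i * x i)" for h :: "nat \<times> nat \<Rightarrow> real" and x j
    by (simp add: mat_app_def distrib_right sum.distrib sum_distrib_left mult.assoc)
  have eq: "card {p \<in> ?I. s * b \<le> \<bar>(\<Sum>i<n. C (snd p) i * x i) + s * h p * (\<Sum>i<n. W (snd p) i * x i)\<bar>}
     = card {j. j < n \<and> s * b \<le> \<bar>mat_app n (\<lambda>j i. C j i + s * h (r, j) * W j i) x j\<bar>}"
    for h :: "nat \<times> nat \<Rightarrow> real" and x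
    unfolding card_Collect_lessThan_pair[of r n, symmetric] split
    by (intro arg_cong[of _ _ card]) auto
  have "measure_pmf.prob ?P {h. \<not> sparse_good n m (\<lambda>j i. C j i + s * h (r, j) * W j i) (s * b) (g / 4)}
    \<le> measure_pmf.prob ?P
     {h. \<exists>x. nrm n x = 1 \<and> card {i. i < n \<and> x i \<noteq> 0} \<le> m \<and>
       real (card {p \<in> ?I. s * b \<le> \<bar>(\<Sum>i<n. C (snd p) i * x i) + s * h p * (\<Sum>i<n. W (snd p) i * x i)\<bar>}) < g / 4}"
    unfolding eq by (intro measure_pmf.finite_measure_mono) (auto simp: sparse_good_def not_le)
  also have "\<dots> \<le> real (\<Sum>i\<le>m. n choose i) * (real (\<Sum>i\<le>Suc m. (3 * card ?I) choose i) * exp (- g / 20))"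
  proof (rule prob_sparse_vector_small_image_le)
    fix x assume x: "nrm n x = 1" "card {i. i < n \<and> x i \<noteq> 0} \<le> m"
    show "g \<le> real (card {p \<in> ?I. b < \<bar>\<Sum>i<n. W (snd p) i * x i\<bar>})"
      using good[OF x] card_Collect_lessThan_pair[of r n "\<lambda>j. b < \<bar>\<Sum>i<n. W j i * x i\<bar>"] by simp
  qed (use assms in auto)
  also have "card ?I = n" by (simp add: card_cartesian_product)
  finally show ?thesis by (simp add: sparse_failure_bound_def)
qed

text \<open>Here \<open>s\<close> is the coefficient of the pattern part, \<open>m\<close> the
  sparsity level and \<open>g\<close> the number of large rows granted by the pattern. The rows
  exceed \<open>b\<close> strictly because sign patterns record strict inequalities. The last bound
  on \<omega> is what a spread vector requires with entries \<open>s * b\<close> in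
  \<open>g / 4\<close> rows. The link between \<alpha> and \<open>m\<close> works both ways: a count
  above \<open>m\<close> is at least \<alpha>n, and a count below \<alpha>n is at most
  \<open>m\<close>.\<close>

locale oblivious_model =
  fixes n K L m :: nat and A V :: "nat \<Rightarrow> nat \<Rightarrow> real" and c s \<epsilon> b g \<omega> \<alpha> :: real
  assumes K: "1 \<le> K" "K \<le> n" and L: "K \<le> L"
    and A: "op_bounded n A 1" and V: "op_bounded n V c"
    and s: "0 < s" "s * c \<le> 1" and \<epsilon>: "0 < \<epsilon>" "\<epsilon> \<le> 1" and b: "0 < b"
    and rows: "\<And>\<eta> x. (\<And>i. i < n \<Longrightarrow> \<eta> i \<in> {-1, 1}) \<Longrightarrow> nrm n x = 1 \<Longrightarrow>
      card {i. i < n \<and> x i \<noteq> 0} \<le> m \<Longrightarrow> g \<le> real (card {j. j < n \<and> b < \<bar>\<Sum>i<n. V j i * \<eta> i * x i\<bar>})"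
    and cols: "\<And>\<eta> x. (\<And>i. i < n \<Longrightarrow> \<eta> i \<in> {-1, 1}) \<Longrightarrow> nrm n x = 1 \<Longrightarrow>
      card {i. i < n \<and> x i \<noteq> 0} \<le> m \<Longrightarrow> g \<le> real (card {j. j < n \<and> b < \<bar>\<Sum>i<n. V i j * \<eta> i * x i\<bar>})"
    and \<omega>: "0 < \<omega>" "\<omega> \<le> 1 / 2" "(6 * \<omega>)\<^sup>2 \<le> (g / 4 - 1) * (s * b / 2)\<^sup>2"
    and m: "\<alpha> * real n \<le> real m + 1" and \<alpha>: "0 < \<alpha>"
begin

abbreviation M where "M \<equiv> perturbed n K L A V s \<epsilon>"

definition sign_pmf :: "(nat \<times> nat \<Rightarrow> real) pmf" where
  "sign_pmf = Pi_pmf ({1, 2} \<times> {..<n}) 0 (\<lambda>_. rademacher_pmf)"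

definition support_pmf :: "(nat \<Rightarrow> nat set) pmf" where
  "support_pmf = Pi_pmf {..<n} {} (\<lambda>_. uniform_subset_pmf n K)"

definition value_pmf :: "(nat \<times> nat \<Rightarrow> real) pmf" where
  "value_pmf = Pi_pmf ({..<K} \<times> {..<n}) 0 (\<lambda>_. rademacher_pmf)"

abbreviation model_pmf where "model_pmf \<equiv> pair_pmf sign_pmf (pair_pmf support_pmf value_pmf)"

lemma set_sign_pmf: "\<eta> \<in> set_pmf sign_pmf \<Longrightarrow> valid_signs ({1, 2} \<times> {..<n}) \<eta>"
  unfolding sign_pmf_def valid_signs_def
  by (subst (asm) set_Pi_pmf) (auto simp: PiE_dflt_def set_rademacher_pmf)

lemma set_value_pmf: "X \<in> set_pmf value_pmf \<Longrightarrow> valid_signs ({..<K} \<times> {..<n}) X"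
  unfolding value_pmf_def valid_signs_def
  by (subst (asm) set_Pi_pmf) (auto simp: PiE_dflt_def set_rademacher_pmf)

lemma set_support_pmf:
  assumes "J \<in> set_pmf support_pmf" "i < n"
  shows "J i \<subseteq> {..<n}" "card (J i) = K"
proof -
  have "J i \<in> set_pmf (uniform_subset_pmf n K)"
    using assms unfolding support_pmf_def by (subst (asm) set_Pi_pmf) (auto simp: PiE_dflt_def)
  then show "J i \<subseteq> {..<n}" "card (J i) = K" using subsets_of_card_nonempty[OF K(2)] by auto
qed

lemma valid_supports_support_pmf:
  assumes "J \<in> set_pmf support_pmf"
  shows "valid_supports n K J" "valid_supports n K (J(k := {}))"
  using set_support_pmf[OF assms] by (auto simp: valid_supports_def)

text \<open>Only the row signs are random. The column signs are frozen and absorbed into the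
  pattern, whose row property holds for every choice of them; \<open>A\<close> and the sparse part
  form the fixed matrix \<open>?C\<close>, which may be arbitrary.\<close>

lemma prob_not_sparse_good:
  "measure_pmf.prob sign_pmf {\<eta>. \<not> sparse_good n m (M \<eta> J X) (s * b) (g / 4)} \<le> sparse_failure_bound n m g"
  unfolding sign_pmf_def
proof (rule prob_Pi_pmf_resample_le[where B = "{1} \<times> {..<n}"])
  show "0 \<le> sparse_failure_bound n m g" by (rule sparse_failure_bound_nonneg)
  fix f :: "nat \<times> nat \<Rightarrow> real"
  assume "\<And>p. p \<in> {1, 2} \<times> {..<n} - {1} \<times> {..<n} \<Longrightarrow> f p \<in> set_pmf rademacher_pmf"
  then have f: "f (2, i) \<in> {-1, 1}" if "i < n" for i using that by (auto simp: set_rademacher_pmf)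
  let ?C = "\<lambda>j i. A j i + \<epsilon> * R2_entry n K L J X j i"
  let ?W = "\<lambda>j i. V j i * f (2, i)"
  have "sparse_good n m (M (\<lambda>p. if p \<in> {1} \<times> {..<n} then h p else f p) J X) (s * b) (g / 4)
    \<longleftrightarrow> sparse_good n m (\<lambda>j i. ?C j i + s * h (1, j) * ?W j i) (s * b) (g / 4)" for h
  proof -
    have "mat_app n (M (\<lambda>p. if p \<in> {1} \<times> {..<n} then h p else f p) J X) x j
       = mat_app n (\<lambda>j i. ?C j i + s * h (1, j) * ?W j i) x j" if "j < n" for x j
      using that by (intro mat_app_cong) (auto simp: perturbed_def algebra_simps)
    then show ?thesis by (simp add: sparse_good_def cong: conj_cong)
  qed
  then show "measure_pmf.prob (Pi_pmf ({1} \<times> {..<n}) 0 (\<lambda>_. rademacher_pmf))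
      {h. \<not> sparse_good n m (M (\<lambda>p. if p \<in> {1} \<times> {..<n} then h p else f p) J X) (s * b) (g / 4)}
     \<le> sparse_failure_bound n m g"
    using prob_not_sparse_good_le[of s b n m g ?W 1 ?C] rows[of "\<lambda>i. f (2, i)"] s(1) b f by simp
qed auto

text \<open>The two families of signs exchange roles: the column signs now multiply the rows of the
  transposed matrix, and the property of the transposed pattern is used.\<close>

lemma prob_not_sparse_good_transpose:
  "measure_pmf.prob sign_pmf {\<eta>. \<not> sparse_good n m (\<lambda>i j. M \<eta> J X j i) (s * b) (g / 4)} \<le> sparse_failure_bound n m g"
  unfolding sign_pmf_def
proof (rule prob_Pi_pmf_resample_le[where B = "{2} \<times> {..<n}"])
  show "0 \<le> sparse_failure_bound n m g" by (rule sparse_failure_bound_nonneg)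
  fix f :: "nat \<times> nat \<Rightarrow> real"
  assume "\<And>p. p \<in> {1, 2} \<times> {..<n} - {2} \<times> {..<n} \<Longrightarrow> f p \<in> set_pmf rademacher_pmf"
  then have f: "f (1, i) \<in> {-1, 1}" if "i < n" for i using that by (auto simp: set_rademacher_pmf)
  let ?C = "\<lambda>i j. A j i + \<epsilon> * R2_entry n K L J X j i"
  let ?W = "\<lambda>i j. V j i * f (1, j)"
  have "sparse_good n m (\<lambda>i j. M (\<lambda>p. if p \<in> {2} \<times> {..<n} then h p else f p) J X j i) (s * b) (g / 4)
    \<longleftrightarrow> sparse_good n m (\<lambda>i j. ?C i j + s * h (2, i) * ?W i j) (s * b) (g / 4)" for h
  proof -
    have "mat_app n (\<lambda>i j. M (\<lambda>p. if p \<in> {2} \<times> {..<n} then h p else f p) J X j i) x i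
       = mat_app n (\<lambda>i j. ?C i j + s * h (2, i) * ?W i j) x i" if "i < n" for x i
      using that by (intro mat_app_cong) (auto simp: perturbed_def algebra_simps)
    then show ?thesis by (simp add: sparse_good_def cong: conj_cong)
  qed
  then show "measure_pmf.prob (Pi_pmf ({2} \<times> {..<n}) 0 (\<lambda>_. rademacher_pmf))
      {h. \<not> sparse_good n m (\<lambda>i j. M (\<lambda>p. if p \<in> {2} \<times> {..<n} then h p else f p) J X j i) (s * b) (g / 4)}
     \<le> sparse_failure_bound n m g"
    using prob_not_sparse_good_le[of s b n m g ?W 2 ?C] cols[of "\<lambda>i. f (1, i)"] s(1) b f by simp
qed auto

text \<open>
  The normal to the columns other than \<open>k\<close>, computed without the \<open>k\<close>-th support set: removing it from
  the row counts makes the normal independent of \<open>J k\<close> and of the signs in column \<open>k\<close>.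
\<close>

definition normal :: "(nat \<times> nat \<Rightarrow> real) \<Rightarrow> (nat \<Rightarrow> nat set) \<Rightarrow> (nat \<times> nat \<Rightarrow> real) \<Rightarrow> nat \<Rightarrow> nat \<Rightarrow> real" where
  "normal \<eta> J X k = unit_normal n (M \<eta> (J(k := {})) X) k"

definition big :: "(nat \<Rightarrow> real) \<Rightarrow> nat set" where
  "big u = {j. j < n \<and> \<omega> / sqrt (real n) \<le> \<bar>u j\<bar>}"

lemma normal_cong:
  assumes "\<And>i. i \<noteq> k \<Longrightarrow> J i = J' i" "\<And>l i. i \<noteq> k \<Longrightarrow> X (l, i) = X' (l, i)"
  shows "normal \<eta> J X k = normal \<eta> J' X' k"
  using R2_entry_removed_cong[of k J J' X X' n K L] assms unfolding normal_def perturbed_def by simp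

text \<open>Once all other supports are frozen the normal is fixed, so \<open>J k\<close> is a fresh
  uniform subset tested against a fixed target of at least \<alpha>n points.\<close>

lemma prob_few_big_hits:
  assumes "k < n"
  shows "measure_pmf.prob support_pmf {J. \<alpha> * real n \<le> real (card (big (normal \<eta> J X k))) \<and>
     real (card (J k \<inter> big (normal \<eta> J X k))) < \<alpha> * real K / 2} \<le> 4 / (\<alpha> * real K)"
  unfolding support_pmf_def
proof (rule prob_Pi_pmf_resample_le[where B = "{k}"])
  show "0 \<le> 4 / (\<alpha> * real K)" using \<alpha> by simp
  fix f :: "nat \<Rightarrow> nat set"
  let ?B = "big (normal \<eta> f X k)"
  have nf: "normal \<eta> (\<lambda>i. if i \<in> {k} then h i else f i) X k = normal \<eta> f X k" for h
    by (rule normal_cong) auto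
  show "measure_pmf.prob (Pi_pmf {k} {} (\<lambda>_. uniform_subset_pmf n K))
     {h. \<alpha> * real n \<le> real (card (big (normal \<eta> (\<lambda>i. if i \<in> {k} then h i else f i) X k))) \<and>
       real (card ((if k \<in> {k} then h k else f k) \<inter> big (normal \<eta> (\<lambda>i. if i \<in> {k} then h i else f i) X k)))
         < \<alpha> * real K / 2} \<le> 4 / (\<alpha> * real K)"
  proof (cases "\<alpha> * real n \<le> real (card ?B)")
    case True
    have "measure_pmf.prob (uniform_subset_pmf n K) {S. real (card (S \<inter> ?B)) < \<alpha> * real K / 2} \<le> 4 / (\<alpha> * real K)"
      using True K \<alpha> by (intro prob_uniform_subset_few_hits_le) (auto simp: big_def)
    then show ?thesis using True unfolding nf by (simp add: Pi_pmf_singleton vimage_def)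
  next
    case False
    then show ?thesis unfolding nf using \<alpha> by simp
  qed
qed (use assms in auto)

lemma prob_small_inner_product:
  assumes "k < n" and Jk: "J k \<subseteq> {..<n}" "card (J k) = K"
  shows "measure_pmf.prob value_pmf {X. \<alpha> * real K / 2 \<le> real (card (J k \<inter> big (normal \<eta> J X k))) \<and>
     \<bar>a (normal \<eta> J X k) + (\<Sum>l<K. X (l, k) * normal \<eta> J X k (sorted_list_of_set (J k) ! l))\<bar> < \<omega> / sqrt (real n)}
    \<le> 1 / sqrt (\<alpha> * real K / 2)"
  unfolding value_pmf_def
proof (rule prob_Pi_pmf_resample_le[where B = "{..<K} \<times> {k}"])
  have aK: "0 < \<alpha> * real K / 2" using \<alpha> K by simp
  then show nn: "0 \<le> 1 / sqrt (\<alpha> * real K / 2)" by simp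
  fix f :: "nat \<times> nat \<Rightarrow> real"
  define u where "u = normal \<eta> J f k"
  define v where "v l = u (sorted_list_of_set (J k) ! l)" for l
  define Q where "Q = {l. l < K \<and> v l \<in> {y. \<omega> / sqrt (real n) \<le> \<bar>y\<bar>}}"
  have nf: "normal \<eta> J (\<lambda>p. if p \<in> {..<K} \<times> {k} then h p else f p) k = u" for h
    unfolding u_def by (rule normal_cong) auto
  have cQ: "card Q = card (J k \<inter> big u)"
  proof -
    have "card Q = card {j \<in> J k. u j \<in> {y. \<omega> / sqrt (real n) \<le> \<bar>y\<bar>}}"
      unfolding Q_def v_def using Jk finite_subset by (intro card_positions_eq) auto
    also have "{j \<in> J k. u j \<in> {y. \<omega> / sqrt (real n) \<le> \<bar>y\<bar>}} = J k \<inter> big u"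
      using Jk by (auto simp: big_def)
    finally show ?thesis .
  qed
  let ?E = "\<lambda>h. \<bar>a u + (\<Sum>l<K. h (l, k) * v l)\<bar> < \<omega> / sqrt (real n)"
  have sumeq: "(\<Sum>l<K. (if (l, k) \<in> {..<K} \<times> {k} then h (l, k) else f (l, k)) * u (sorted_list_of_set (J k) ! l))
     = (\<Sum>l<K. h (l, k) * v l)" for h :: "nat \<times> nat \<Rightarrow> real"
    by (intro sum.cong) (auto simp: v_def)
  have "measure_pmf.prob (Pi_pmf ({..<K} \<times> {k}) 0 (\<lambda>_. rademacher_pmf)) {h. ?E h} \<le> 1 / sqrt (\<alpha> * real K / 2)"
    if big: "\<alpha> * real K / 2 \<le> real (card (J k \<inter> big u))"
  \<comment> \<open>A second freezing keeps random only the positions with large coefficients, as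
    Littlewood-Offord demands; the remaining terms move into the offset \<open>d\<close>.\<close>
  proof (rule prob_Pi_pmf_resample_le[where B = "Q \<times> {k}"])
    fix f' :: "nat \<times> nat \<Rightarrow> real"
    define d where "d = a u + (\<Sum>l\<in>{..<K} - Q. f' (l, k) * v l)"
    have cQk: "card (Q \<times> {k}) = card (J k \<inter> big u)" using cQ by (simp add: card_cartesian_product)
    have Q1: "1 \<le> card (Q \<times> {k})" using big aK cQk by (cases "card (Q \<times> {k})") auto
    have sp: "a u + (\<Sum>l<K. (if (l, k) \<in> Q \<times> {k} then h (l, k) else f' (l, k)) * v l)
        = d + (\<Sum>p\<in>Q \<times> {k}. h p * v (fst p))" for h :: "nat \<times> nat \<Rightarrow> real"
    proof -
      have "(\<Sum>l<K. (if (l, k) \<in> Q \<times> {k} then h (l, k) else f' (l, k)) * v l)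
        = (\<Sum>l\<in>{..<K} - Q. (if (l, k) \<in> Q \<times> {k} then h (l, k) else f' (l, k)) * v l)
          + (\<Sum>l\<in>Q. (if (l, k) \<in> Q \<times> {k} then h (l, k) else f' (l, k)) * v l)"
        by (intro sum.subset_diff) (auto simp: Q_def)
      also have "(\<Sum>l\<in>{..<K} - Q. (if (l, k) \<in> Q \<times> {k} then h (l, k) else f' (l, k)) * v l)
         = (\<Sum>l\<in>{..<K} - Q. f' (l, k) * v l)" by (intro sum.cong) auto
      also have "(\<Sum>l\<in>Q. (if (l, k) \<in> Q \<times> {k} then h (l, k) else f' (l, k)) * v l)
         = (\<Sum>l\<in>Q. h (l, k) * v l)" by (intro sum.cong) auto
      also have "\<dots> = (\<Sum>p\<in>Q \<times> {k}. h p * v (fst p))"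
        by (rule sum.reindex_bij_witness[of _ fst "\<lambda>l. (l, k)"]) auto
      finally show ?thesis by (simp add: d_def)
    qed
    have "measure_pmf.prob (Pi_pmf (Q \<times> {k}) 0 (\<lambda>_. rademacher_pmf))
       {h. \<bar>d + (\<Sum>p\<in>Q \<times> {k}. h p * v (fst p))\<bar> < \<omega> / sqrt (real n)} \<le> 1 / sqrt (real (card (Q \<times> {k})))"
      using \<omega> K Q1 by (intro Littlewood_Offord) (auto simp: Q_def)
    also have "\<dots> \<le> 1 / sqrt (\<alpha> * real K / 2)"
      using big aK unfolding cQk by (intro divide_left_mono real_sqrt_le_mono mult_pos_pos) auto
    finally show "measure_pmf.prob (Pi_pmf (Q \<times> {k}) 0 (\<lambda>_. rademacher_pmf))
       {h. ?E (\<lambda>p. if p \<in> Q \<times> {k} then h p else f' p)} \<le> 1 / sqrt (\<alpha> * real K / 2)"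
      unfolding sp .
  qed (use nn in \<open>auto simp: Q_def\<close>)
  then show "measure_pmf.prob (Pi_pmf ({..<K} \<times> {k}) 0 (\<lambda>_. rademacher_pmf))
     {h. \<alpha> * real K / 2 \<le> real (card (J k \<inter> big (normal \<eta> J (\<lambda>p. if p \<in> {..<K} \<times> {k} then h p else f p) k))) \<and>
     \<bar>a (normal \<eta> J (\<lambda>p. if p \<in> {..<K} \<times> {k} then h p else f p) k)
       + (\<Sum>l<K. (if (l, k) \<in> {..<K} \<times> {k} then h (l, k) else f (l, k))
           * normal \<eta> J (\<lambda>p. if p \<in> {..<K} \<times> {k} then h p else f p) k (sorted_list_of_set (J k) ! l))\<bar> < \<omega> / sqrt (real n)}
    \<le> 1 / sqrt (\<alpha> * real K / 2)"
    unfolding nf sumeq using nn by (cases "\<alpha> * real K / 2 \<le> real (card (J k \<inter> big u))") simp_all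
qed (use assms in auto)

end

context oblivious_model
begin

text \<open>One summand for each obstruction: the transposed matrix contracts a sparse vector, the
  column meets a crowded row, its support misses the large coordinates of the normal, or the
  Rademacher sum is small.\<close>

definition column_failure_bound :: real where
  "column_failure_bound = sparse_failure_bound n m g + real K * exp ((exp 1 - 1) * real K - real L)
     + 4 / (\<alpha> * real K) + 1 / sqrt (\<alpha> * real K / 2)"

lemma op_bounded_M:
  assumes "\<eta> \<in> set_pmf sign_pmf" "valid_supports n K J" "X \<in> set_pmf value_pmf"
  shows "op_bounded n (M \<eta> J X) 3"
  using assms K L s \<epsilon> set_sign_pmf set_value_pmf
  by (intro op_bounded_perturbed[OF A V]) auto

text \<open>The normal computed with support \<open>k\<close> emptied serves as witness for the true
  matrix, because \<open>free\<close> makes the other columns agree. Its inner product with the true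
  column \<open>k\<close> is \<epsilon>/L times the offset plus Rademacher sum in
  \<open>inner\<close>.\<close>

lemma separated_column_M:
  assumes \<eta>: "\<eta> \<in> set_pmf sign_pmf" and J: "J \<in> set_pmf support_pmf" and X: "X \<in> set_pmf value_pmf" and k: "k < n"
    and sparse: "sparse_good n m (\<lambda>i j. M \<eta> (J(k := {})) X j i) (s * b) (g / 4)"
    and free: "\<And>j. j \<in> J k \<Longrightarrow> row_count n (J(k := {})) j < L"
    and hits: "\<alpha> * real n \<le> real (card (big (normal \<eta> J X k))) \<Longrightarrow>
       \<alpha> * real K / 2 \<le> real (card (J k \<inter> big (normal \<eta> J X k)))"
    and inner: "\<alpha> * real K / 2 \<le> real (card (J k \<inter> big (normal \<eta> J X k))) \<Longrightarrow> \<omega> / sqrt (real n) \<le>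
      \<bar>real L / \<epsilon> * (\<Sum>j<n. normal \<eta> J X k j * (A j k + s * (\<eta> (1, j) * V j k * \<eta> (2, k))))
        + (\<Sum>l<K. X (l, k) * normal \<eta> J X k (sorted_list_of_set (J k) ! l))\<bar>"
  shows "separated_column n (M \<eta> J X) (\<epsilon> / real L * (\<omega> / sqrt (real n))) k"
proof -
  define N where "N = M \<eta> (J(k := {})) X"
  define u where "u = normal \<eta> J X k"
  have u: "nrm n u = 1" "\<And>i. i < n \<Longrightarrow> i \<noteq> k \<Longrightarrow> (\<Sum>j<n. u j * N j i) = 0"
    using unit_normal[OF k] by (auto simp: u_def normal_def N_def)
  have NM: "N j i = M \<eta> J X j i" if "i \<noteq> k" for j i
    using R2_entry_remove_column[OF k free that] by (simp add: N_def perturbed_def)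
  have "op_bounded n N 3"
    unfolding N_def by (intro op_bounded_M \<eta> X valid_supports_support_pmf J)
  then have op: "op_bounded n (\<lambda>i j. N j i) 3" by (rule op_bounded_transpose)
  \<comment> \<open>The transposed image of the normal is supported on coordinate \<open>k\<close>,
    exactly the coordinate that \<open>spread_of_small_image\<close> ignores.\<close>
  have "L2_set (mat_app n (\<lambda>i j. N j i) u) ({..<n} - {k}) = 0"
    using u(2) by (intro L2_set_0') (auto simp: mat_app_def mult.commute)
  then have "L2_set (mat_app n (\<lambda>i j. N j i) u) ({..<n} - {k}) < 3 * \<omega>" using \<omega>(1) by simp
  from spread_of_small_image[OF sparse[folded N_def] op u(1) this \<omega>(1,2) _ \<omega>(3)]
  have "m < card (big u)" using s(1) b by (simp add: big_def)
  then have "\<alpha> * real n \<le> real (card (big u))" using m by linarith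
  then have in': "\<omega> / sqrt (real n) \<le> \<bar>real L / \<epsilon> * (\<Sum>j<n. u j * (A j k + s * (\<eta> (1, j) * V j k * \<eta> (2, k))))
        + (\<Sum>l<K. X (l, k) * u (sorted_list_of_set (J k) ! l))\<bar>" (is "_ \<le> \<bar>?y\<bar>")
    using hits inner by (simp add: u_def)
  have L0: "0 < real L" using K L by simp
  have "(\<Sum>j<n. u j * M \<eta> J X j k) = (\<Sum>j<n. u j * (A j k + s * (\<eta> (1, j) * V j k * \<eta> (2, k))))
      + \<epsilon> * (\<Sum>j<n. u j * R2_entry n K L J X j k)"
    by (simp add: perturbed_def distrib_left sum.distrib sum_distrib_left mult_ac)
  also have "\<dots> = \<epsilon> / real L * ?y"
    using inner_R2_column[where u = u and X = X, OF k set_support_pmf[OF J k] free] \<epsilon>(1) L0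
    by (simp add: field_simps)
  finally have "\<bar>\<Sum>j<n. u j * M \<eta> J X j k\<bar> = \<epsilon> / real L * \<bar>?y\<bar>"
    using \<epsilon>(1) L0 by (simp add: abs_mult)
  then have "\<epsilon> / real L * (\<omega> / sqrt (real n)) \<le> \<bar>\<Sum>j<n. u j * M \<eta> J X j k\<bar>"
    using in' \<epsilon>(1) L0 by (simp only:) (intro mult_left_mono, auto)
  then show ?thesis
    unfolding separated_column_def using u NM by (intro exI[of _ u]) auto
qed

lemma prob_column_not_separated:
  assumes k: "k < n"
  shows "measure_pmf.prob model_pmf
     {z. \<not> separated_column n (M (fst z) (fst (snd z)) (snd (snd z))) (\<epsilon> / real L * (\<omega> / sqrt (real n))) k}
    \<le> column_failure_bound"
proof -
  \<comment> \<open>Each bad event is estimated over a different source of randomness with the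
    others frozen: \<open>E1\<close> over the signs of the pattern, \<open>E2\<close> and
    \<open>E3\<close> over the supports, \<open>E4\<close> over the values.\<close>
  define E1 where "E1 = {z. \<not> sparse_good n m (\<lambda>i j. M (fst z) ((fst (snd z))(k := {})) (snd (snd z)) j i) (s * b) (g / 4)}"
  define E2 where "E2 = {z :: (nat \<times> nat \<Rightarrow> real) \<times> (nat \<Rightarrow> nat set) \<times> (nat \<times> nat \<Rightarrow> real).
    \<exists>j\<in>fst (snd z) k. L \<le> row_count n ((fst (snd z))(k := {})) j}"
  define u where "u z = normal (fst z) (fst (snd z)) (snd (snd z)) k" for z
  define E3 where "E3 = {z. \<alpha> * real n \<le> real (card (big (u z))) \<and>
     real (card (fst (snd z) k \<inter> big (u z))) < \<alpha> * real K / 2}"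
  define a where "a \<eta> v = real L / \<epsilon> * (\<Sum>j<n. v j * (A j k + s * (\<eta> (1, j) * V j k * \<eta> (2, k))))"
    for \<eta> :: "nat \<times> nat \<Rightarrow> real" and v
  define E4 where "E4 = {z. \<alpha> * real K / 2 \<le> real (card (fst (snd z) k \<inter> big (u z))) \<and>
     \<bar>a (fst z) (u z) + (\<Sum>l<K. snd (snd z) (l, k) * u z (sorted_list_of_set (fst (snd z) k) ! l))\<bar> < \<omega> / sqrt (real n)}"
  have aK: "0 < \<alpha> * real K" using \<alpha> K by simp
  have "measure_pmf.prob model_pmf E1 \<le> sparse_failure_bound n m g"
    unfolding E1_def by (intro prob_pair_pmf_le_fst sparse_failure_bound_nonneg) (simp add: prob_not_sparse_good_transpose)
  moreover have "measure_pmf.prob model_pmf E2 \<le> real K * exp ((exp 1 - 1) * real K - real L)"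
    unfolding E2_def
  proof (rule prob_pair_pmf_le_snd)
    show "measure_pmf.prob (pair_pmf support_pmf value_pmf)
        {y. \<exists>j\<in>fst (snd (x, y)) k. L \<le> row_count n ((fst (snd (x, y)))(k := {})) j}
        \<le> real K * exp ((exp 1 - 1) * real K - real L)" for x :: "nat \<times> nat \<Rightarrow> real"
      unfolding snd_conv
    proof (rule prob_pair_pmf_le_fst)
      show "measure_pmf.prob support_pmf {J. \<exists>j\<in>fst (J, X) k. L \<le> row_count n ((fst (J, X))(k := {})) j}
        \<le> real K * exp ((exp 1 - 1) * real K - real L)" for X :: "nat \<times> nat \<Rightarrow> real"
        unfolding fst_conv row_count_remove support_pmf_def by (rule prob_hit_crowded_row_le[OF K k])
    qed simp
  qed simp
  moreover have "measure_pmf.prob model_pmf E3 \<le> 4 / (\<alpha> * real K)"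
    unfolding E3_def
  proof (rule prob_pair_pmf_le_snd)
    show "measure_pmf.prob (pair_pmf support_pmf value_pmf)
        {y. \<alpha> * real n \<le> real (card (big (u (x, y)))) \<and>
          real (card (fst (snd (x, y)) k \<inter> big (u (x, y)))) < \<alpha> * real K / 2} \<le> 4 / (\<alpha> * real K)" for x
    proof (rule prob_pair_pmf_le_fst)
      show "measure_pmf.prob support_pmf
          {J. \<alpha> * real n \<le> real (card (big (u (x, J, X)))) \<and>
            real (card (fst (snd (x, J, X)) k \<inter> big (u (x, J, X)))) < \<alpha> * real K / 2} \<le> 4 / (\<alpha> * real K)" for X
        unfolding u_def fst_conv snd_conv by (rule prob_few_big_hits[OF k])
    qed (use aK in simp)
  qed (use aK in simp)
  moreover have "measure_pmf.prob model_pmf E4 \<le> 1 / sqrt (\<alpha> * real K / 2)"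
    unfolding E4_def
  proof (rule prob_pair_pmf_le_snd)
    show "measure_pmf.prob (pair_pmf support_pmf value_pmf)
        {y. \<alpha> * real K / 2 \<le> real (card (fst (snd (x, y)) k \<inter> big (u (x, y)))) \<and>
          \<bar>a (fst (x, y)) (u (x, y)) + (\<Sum>l<K. snd (snd (x, y)) (l, k) *
             u (x, y) (sorted_list_of_set (fst (snd (x, y)) k) ! l))\<bar> < \<omega> / sqrt (real n)}
        \<le> 1 / sqrt (\<alpha> * real K / 2)" for x
    proof (rule prob_pair_pmf_le_snd)
      fix J assume J: "J \<in> set_pmf support_pmf"
      show "measure_pmf.prob value_pmf
          {X. \<alpha> * real K / 2 \<le> real (card (fst (snd (x, J, X)) k \<inter> big (u (x, J, X)))) \<and>
          \<bar>a (fst (x, J, X)) (u (x, J, X)) + (\<Sum>l<K. snd (snd (x, J, X)) (l, k) *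
             u (x, J, X) (sorted_list_of_set (fst (snd (x, J, X)) k) ! l))\<bar> < \<omega> / sqrt (real n)}
        \<le> 1 / sqrt (\<alpha> * real K / 2)"
        unfolding u_def fst_conv snd_conv by (rule prob_small_inner_product[where J = J and k = k, OF k set_support_pmf[OF J k]])
    qed (use aK in simp)
  qed (use aK in simp)
  moreover have "measure_pmf.prob model_pmf
     {z. \<not> separated_column n (M (fst z) (fst (snd z)) (snd (snd z))) (\<epsilon> / real L * (\<omega> / sqrt (real n))) k}
     \<le> measure_pmf.prob model_pmf (E1 \<union> E2 \<union> E3 \<union> E4)"
  proof (intro measure_pmf.finite_measure_mono_AE AE_pmfI)
    fix z assume z: "z \<in> set_pmf model_pmf"
    obtain \<eta> J X where zz: "z = (\<eta>, J, X)" by (cases z) auto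
    show "z \<in> {z. \<not> separated_column n (M (fst z) (fst (snd z)) (snd (snd z))) (\<epsilon> / real L * (\<omega> / sqrt (real n))) k}
      \<longrightarrow> z \<in> E1 \<union> E2 \<union> E3 \<union> E4"
    proof (rule impI, rule ccontr)
      assume *: "z \<in> {z. \<not> separated_column n (M (fst z) (fst (snd z)) (snd (snd z))) (\<epsilon> / real L * (\<omega> / sqrt (real n))) k}"
        "z \<notin> E1 \<union> E2 \<union> E3 \<union> E4"
      have "separated_column n (M \<eta> J X) (\<epsilon> / real L * (\<omega> / sqrt (real n))) k"
        using *(2) z k unfolding zz
        by (intro separated_column_M) (auto simp: E1_def E2_def E3_def E4_def u_def a_def not_le not_less)
      then show False using *(1) by (simp add: zz)
    qed
  qed auto
  moreover have "measure_pmf.prob model_pmf (E1 \<union> E2 \<union> E3 \<union> E4)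
     \<le> measure_pmf.prob model_pmf E1 + measure_pmf.prob model_pmf E2 + measure_pmf.prob model_pmf E3 + measure_pmf.prob model_pmf E4"
  proof -
    have "measure_pmf.prob model_pmf (E1 \<union> E2 \<union> E3 \<union> E4) \<le> measure_pmf.prob model_pmf (E1 \<union> E2 \<union> E3) + measure_pmf.prob model_pmf E4"
      "measure_pmf.prob model_pmf (E1 \<union> E2 \<union> E3) \<le> measure_pmf.prob model_pmf (E1 \<union> E2) + measure_pmf.prob model_pmf E3"
      "measure_pmf.prob model_pmf (E1 \<union> E2) \<le> measure_pmf.prob model_pmf E1 + measure_pmf.prob model_pmf E2"
      by (intro measure_subadditive; simp)+
    then show ?thesis by linarith
  qed
  ultimately show ?thesis unfolding column_failure_bound_def by linarith
qed

lemma finite_set_model_pmf: "finite (set_pmf model_pmf)"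
proof -
  have "finite (set_pmf (uniform_subset_pmf n K))" using subsets_of_card_nonempty[OF K(2)] by simp
  then show ?thesis
    unfolding set_pair_pmf sign_pmf_def support_pmf_def value_pmf_def
    by (intro finite_cartesian_product finite_set_Pi_pmf) (simp_all add: set_rademacher_pmf)
qed

definition smallest_stretch :: real where
  "smallest_stretch = min (3 * \<omega>) (\<omega> / sqrt (real n) * (\<epsilon> / real L * (\<omega> / sqrt (real n))))"

text \<open>The expected number of columns that are not separated is at most n times the bound for
  one column; Markov's inequality at \<alpha>n costs the division by \<alpha>.\<close>

lemma prob_contracted_vector_le:
  "measure_pmf.prob model_pmf
     {z. \<exists>x. nrm n x = 1 \<and> nrm n (mat_app n (M (fst z) (fst (snd z)) (snd (snd z))) x) < smallest_stretch}
    \<le> sparse_failure_bound n m g + column_failure_bound / \<alpha>"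
proof -
  define d where "d = \<epsilon> / real L * (\<omega> / sqrt (real n))"
  define N where "N z = M (fst z) (fst (snd z)) (snd (snd z))" for z
  define cnt where "cnt z = card {k. k < n \<and> \<not> separated_column n (N z) d k}" for z
  define F1 where "F1 = {z. \<not> sparse_good n m (N z) (s * b) (g / 4)}"
  define F2 where "F2 = {z. \<alpha> * real n \<le> real (cnt z)}"
  have n: "0 < real n" using K by simp
  have "measure_pmf.prob model_pmf F1 \<le> sparse_failure_bound n m g"
    unfolding F1_def N_def by (intro prob_pair_pmf_le_fst sparse_failure_bound_nonneg) (simp add: prob_not_sparse_good)
  moreover have "measure_pmf.prob model_pmf F2 \<le> column_failure_bound / \<alpha>"
  proof -
    have cnt: "real (cnt z) = (\<Sum>k<n. indicator {z. \<not> separated_column n (N z) d k} z)" for z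
    proof -
      have "(\<Sum>k<n. indicator {z. \<not> separated_column n (N z) d k} z)
        = (\<Sum>k<n. if \<not> separated_column n (N z) d k then 1 else 0 :: real)" by (intro sum.cong) (auto simp: indicator_def)
      also have "\<dots> = (\<Sum>k\<in>{k\<in>{..<n}. \<not> separated_column n (N z) d k}. 1)"
        by (simp only: sum.inter_filter[OF finite_lessThan])
      finally show ?thesis by (simp add: cnt_def)
    qed
    have "measure_pmf.prob model_pmf F2 \<le> measure_pmf.expectation model_pmf (\<lambda>z. real (cnt z)) / (\<alpha> * real n)"
      unfolding F2_def using \<alpha> n by (intro prob_le_expectation finite_set_model_pmf) auto
    also have "measure_pmf.expectation model_pmf (\<lambda>z. real (cnt z))
       = (\<Sum>k<n. measure_pmf.prob model_pmf {z. \<not> separated_column n (N z) d k})"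
      unfolding cnt by (subst Bochner_Integration.integral_sum)
        (auto intro: integrable_measure_pmf_finite finite_set_model_pmf)
    also have "\<dots> \<le> (\<Sum>k<n. column_failure_bound)"
      unfolding N_def d_def by (intro sum_mono prob_column_not_separated) simp
    finally have "measure_pmf.prob model_pmf F2 \<le> real n * column_failure_bound / (\<alpha> * real n)"
      using \<alpha> n by (simp add: divide_right_mono)
    then show ?thesis using n by simp
  qed
  moreover have "measure_pmf.prob model_pmf {z. \<exists>x. nrm n x = 1 \<and> nrm n (mat_app n (N z) x) < smallest_stretch}
     \<le> measure_pmf.prob model_pmf (F1 \<union> F2)"
  proof (intro measure_pmf.finite_measure_mono_AE AE_pmfI)
    fix z assume z: "z \<in> set_pmf model_pmf"
    have op: "op_bounded n (N z) 3"
      unfolding N_def using z by (intro op_bounded_M valid_supports_support_pmf) auto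
    have d0: "0 \<le> d" using \<epsilon> \<omega> by (simp add: d_def)
    have "smallest_stretch \<le> nrm n (mat_app n (N z) x)" if "z \<notin> F1 \<union> F2" "nrm n x = 1" for x
    proof -
      have "sparse_good n m (N z) (s * b) (g / 4)" "real (cnt z) < \<alpha> * real n"
        using that(1) by (auto simp: F1_def F2_def)
      \<comment> \<open>An integer below \<alpha>n \<le> m + 1 is at most \<open>m\<close>.\<close>
      moreover from this have "cnt z \<le> m" using m by linarith
      ultimately show ?thesis
        unfolding smallest_stretch_def d_def[symmetric]
        using that(2) \<omega> s b d0 by (intro norm_lower_bound[OF _ op]) (auto simp: cnt_def)
    qed
    then show "z \<in> {z. \<exists>x. nrm n x = 1 \<and> nrm n (mat_app n (N z) x) < smallest_stretch} \<longrightarrow> z \<in> F1 \<union> F2"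
      by (force simp: not_less[symmetric])
  qed auto
  moreover have "measure_pmf.prob model_pmf (F1 \<union> F2) \<le> measure_pmf.prob model_pmf F1 + measure_pmf.prob model_pmf F2"
    by (intro measure_subadditive) auto
  ultimately show ?thesis unfolding N_def by linarith
qed

end

section \<open>Choice of constants\<close>

text \<open>Take t = sqrt(\<alpha>), so that (1/t)^m \<le> exp(m/t) \<le> exp(tn). The number of
  supports is then at most exp(2tn), the number of patterns at most exp(4tn)/t, and t \<le>
  \<gamma>/360 turns 6t - \<gamma>/20 into at most -\<gamma>/30. Since exp(-y) \<le> 1/y, it
  suffices that n beats a fixed power of 1/\<alpha>; 480 is 30 times 16.\<close>

lemma sparse_failure_bound_le:
  fixes \<alpha> \<gamma> \<delta> :: real
  assumes \<alpha>: "0 < \<alpha>" "\<alpha> < 1" "\<alpha> < (\<gamma> / 360)\<^sup>2" and \<gamma>: "0 < \<gamma>" and \<delta>: "0 < \<delta>"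
    and m: "real m \<le> \<alpha> * real n" and n: "480 / \<gamma> \<le> real n * (\<delta> * \<alpha>\<^sup>2)"
  shows "sparse_failure_bound n m (\<gamma> * real n) \<le> \<delta> * \<alpha> / 16"
proof -
  define t where "t = sqrt \<alpha>"
  have t: "0 < t" "t \<le> 1" "t * t = \<alpha>" using \<alpha> by (auto simp: t_def)
  have "sqrt \<alpha> \<le> sqrt ((\<gamma> / 360)\<^sup>2)" using \<alpha>(3) by (intro real_sqrt_le_mono) simp
  then have t\<gamma>: "t \<le> \<gamma> / 360" using \<gamma> by (simp add: t_def)
  have "0 < real n * (\<delta> * \<alpha>\<^sup>2)" using n \<gamma> by (intro less_le_trans[OF _ n]) simp
  then have n0: "0 < real n" using \<delta> \<alpha> by (simp add: zero_less_mult_iff)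
  have pw: "(1 / t) ^ m \<le> exp (t * real n)"
  proof -
    have "1 / t \<le> exp (1 / t)" using exp_ge_add_one_self[of "1 / t"] by linarith
    then have "(1 / t) ^ m \<le> exp (1 / t) ^ m" using t by (intro power_mono) auto
    also have "\<dots> = exp (real m * (1 / t))" by (rule exp_of_nat_mult[symmetric])
    also have "\<dots> \<le> exp (t * real n)"
    proof -
      have "real m * (1 / t) \<le> \<alpha> * real n * (1 / t)" using m t by (intro mult_right_mono) auto
      also have "\<dots> = t * real n" using t by (simp add: t(3)[symmetric])
      finally show ?thesis by simp
    qed
    finally show ?thesis .
  qed
  have "real (\<Sum>i\<le>m. n choose i) \<le> (1 / t) ^ m * exp (t * n)" by (rule sum_binomial_le_exp[OF t(1,2)])
  also have "\<dots> \<le> exp (t * real n) * exp (t * n)" using pw by (intro mult_right_mono) auto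
  finally have 1: "real (\<Sum>i\<le>m. n choose i) \<le> exp (2 * t * real n)" by (simp add: exp_add[symmetric] mult.assoc)
  have "real (\<Sum>i\<le>Suc m. (3 * n) choose i) \<le> (1 / t) ^ Suc m * exp (t * (3 * n))"
    using sum_binomial_le_exp[OF t(1,2), of "3 * n" "Suc m"] by simp
  also have "\<dots> = 1 / t * ((1 / t) ^ m * exp (t * (3 * n)))" by simp
  also have "\<dots> \<le> 1 / t * (exp (t * real n) * exp (t * (3 * n)))"
    using pw t by (intro mult_left_mono mult_right_mono) auto
  finally have 2: "real (\<Sum>i\<le>Suc m. (3 * n) choose i) \<le> 1 / t * exp (4 * t * real n)"
    by (simp add: exp_add[symmetric] mult.assoc)
  have "sparse_failure_bound n m (\<gamma> * real n)
     \<le> exp (2 * t * real n) * (1 / t * exp (4 * t * real n) * exp (- (\<gamma> * real n) / 20))"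
    unfolding sparse_failure_bound_def using t
    by (intro mult_mono 1 2 mult_nonneg_nonneg of_nat_0_le_iff exp_ge_zero order_refl) auto
  also have "\<dots> = 1 / t * exp ((6 * t - \<gamma> / 20) * real n)"
    by (simp add: exp_add[symmetric] algebra_simps)
  also have "\<dots> \<le> 1 / t * exp (- (\<gamma> * real n / 30))"
  proof (intro mult_left_mono)
    have "(6 * t - \<gamma> / 20) * real n \<le> (- \<gamma> / 30) * real n"
      using t\<gamma> by (intro mult_right_mono) auto
    then show "exp ((6 * t - \<gamma> / 20) * real n) \<le> exp (- (\<gamma> * real n / 30))" by simp
  qed (use t in auto)
  also have "\<dots> \<le> 1 / t * (30 / (\<gamma> * real n))"
  proof (intro mult_left_mono)
    have "\<gamma> * real n / 30 \<le> exp (\<gamma> * real n / 30)" using exp_ge_add_one_self[of "\<gamma> * real n / 30"] by linarith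
    then have "1 / exp (\<gamma> * real n / 30) \<le> 1 / (\<gamma> * real n / 30)"
      using \<gamma> n0 by (intro divide_left_mono) auto
    then show "exp (- (\<gamma> * real n / 30)) \<le> 30 / (\<gamma> * real n)" by (simp add: exp_minus inverse_eq_divide)
  qed (use t in auto)
  also have "\<dots> \<le> \<delta> * \<alpha> / 16"
  proof -
    have "480 \<le> \<gamma> * (real n * (\<delta> * \<alpha>\<^sup>2))" using n \<gamma> by (simp add: field_simps)
    also have "\<dots> = (\<gamma> * real n * \<delta> * \<alpha>) * (t * t)" using t(3) by (simp add: power2_eq_square)
    also have "\<dots> \<le> (\<gamma> * real n * \<delta> * \<alpha>) * (t * 1)"
      using t \<gamma> \<delta> \<alpha> n0 by (intro mult_left_mono) auto
    finally have "480 \<le> \<gamma> * real n * \<delta> * \<alpha> * t" by simp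
    then show ?thesis using t \<gamma> n0 by (simp add: field_simps)
  qed
  finally show ?thesis .
qed

context oblivious_model
begin

lemma column_failure_bound_le:
  fixes \<delta> :: real
  assumes \<delta>: "0 < \<delta>" "\<delta> < 1" and \<alpha>1: "\<alpha> < 1" and Kb: "512 / (\<delta> ^ 2 * \<alpha> ^ 3) \<le> real K"
    and Lb: "2 * exp 1 * real K \<le> real L"
    and sp: "sparse_failure_bound n m g \<le> \<delta> * \<alpha> / 16"
  shows "column_failure_bound \<le> \<delta> * \<alpha> / 4"
proof -
  have K0: "0 < real K" using K by simp
  have pos: "0 < \<delta> ^ 2 * \<alpha> ^ 3" using \<delta> \<alpha> by simp
  have Kb': "512 \<le> real K * (\<delta> ^ 2 * \<alpha> ^ 3)" using Kb pos by (simp add: field_simps)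
  have \<delta>2: "\<delta> ^ 2 \<le> \<delta>" using power_decreasing[of 1 2 \<delta>] \<delta> by simp
  have \<alpha>3: "\<alpha> ^ 3 \<le> \<alpha>" "\<alpha> ^ 3 \<le> \<alpha> ^ 2" using power_decreasing[of 1 3 \<alpha>] power_decreasing[of 2 3 \<alpha>] \<alpha> \<alpha>1 by simp_all
  have K1: "512 \<le> real K * (\<delta> * \<alpha>)"
  proof -
    have "\<delta> ^ 2 * \<alpha> ^ 3 \<le> \<delta> * \<alpha>" using \<delta>2 \<alpha>3 \<delta> \<alpha> by (intro mult_mono) auto
    then show ?thesis using Kb' K0 mult_left_mono[of "\<delta> ^ 2 * \<alpha> ^ 3" "\<delta> * \<alpha>" "real K"] by linarith
  qed
  have K2: "512 \<le> real K * (\<delta> * \<alpha> ^ 2)"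
  proof -
    have "\<delta> ^ 2 * \<alpha> ^ 3 \<le> \<delta> * \<alpha> ^ 2" using \<delta>2 \<alpha>3 \<delta> \<alpha> by (intro mult_mono) auto
    then show ?thesis using Kb' K0 mult_left_mono[of "\<delta> ^ 2 * \<alpha> ^ 3" "\<delta> * \<alpha> ^ 2" "real K"] by linarith
  qed
  \<comment> \<open>The choice L \<ge> 2eK makes the exponent at most -(e+1)K, hence at most -2K,
    and K exp(-2K) \<le> 1/K.\<close>
  have hit: "real K * exp ((exp 1 - 1) * real K - real L) \<le> \<delta> * \<alpha> / 16"
  proof -
    have "(exp 1 - 1) * real K - real L \<le> - (2 * real K)"
    proof -
      have "(1 :: real) \<le> exp 1" by simp
      then have "1 * real K \<le> exp 1 * real K" using K0 by (intro mult_right_mono) auto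
      then show ?thesis using Lb by (simp add: algebra_simps)
    qed
    then have "real K * exp ((exp 1 - 1) * real K - real L) \<le> real K * exp (- (2 * real K))"
      using K0 by (intro mult_left_mono) auto
    also have "exp (- (2 * real K)) \<le> 1 / (real K * real K)"
    proof -
      have "real K \<le> exp (real K)" using exp_ge_add_one_self[of "real K"] by linarith
      then have "real K * real K \<le> exp (real K) * exp (real K)" using K0 by (intro mult_mono) auto
      also have "\<dots> = exp (2 * real K)" by (simp add: exp_add[symmetric])
      finally have "1 / exp (2 * real K) \<le> 1 / (real K * real K)" using K0 by (intro divide_left_mono) auto
      then show ?thesis by (simp add: exp_minus inverse_eq_divide)
    qed
    then have "real K * exp (- (2 * real K)) \<le> real K * (1 / (real K * real K))"
      using K0 by (intro mult_left_mono) auto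
    also have "\<dots> = 1 / real K" using K0 by simp
    also have "\<dots> \<le> \<delta> * \<alpha> / 16" using K1 K0 by (simp add: field_simps)
    finally show ?thesis .
  qed
  have few: "4 / (\<alpha> * real K) \<le> \<delta> * \<alpha> / 16"
    using K2 K0 \<alpha> by (simp add: field_simps power2_eq_square)
  \<comment> \<open>This term determines the size of \<open>K\<close>: its square root must reach
    16/(\<delta>\<alpha>), which is K \<ge> 512/(\<delta>^2 \<alpha>^3).\<close>
  have "(16 / (\<delta> * \<alpha>))\<^sup>2 \<le> \<alpha> * real K / 2"
  proof -
    have "256 * 2 \<le> \<alpha> * real K * (\<delta> * \<alpha>)\<^sup>2"
      using Kb' by (simp add: power2_eq_square power3_eq_cube mult_ac)
    then show ?thesis using \<delta> \<alpha> by (simp add: power_divide pos_divide_le_eq)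
  qed
  then have "16 / (\<delta> * \<alpha>) \<le> sqrt (\<alpha> * real K / 2)" by (rule real_le_rsqrt)
  then have "1 / sqrt (\<alpha> * real K / 2) \<le> 1 / (16 / (\<delta> * \<alpha>))"
    using \<delta> \<alpha> K0 by (intro divide_left_mono) auto
  then have "1 / sqrt (\<alpha> * real K / 2) \<le> \<delta> * \<alpha> / 16" by simp
  then show ?thesis using hit few sp unfolding column_failure_bound_def by linarith
qed

lemma prob_contracted_vector_le_delta:
  fixes \<delta> :: real
  assumes \<delta>: "0 < \<delta>" "\<delta> < 1" and \<alpha>1: "\<alpha> < 1" and Kb: "512 / (\<delta> ^ 2 * \<alpha> ^ 3) \<le> real K"
    and Lb: "2 * exp 1 * real K \<le> real L"
    and sp: "sparse_failure_bound n m g \<le> \<delta> * \<alpha> / 16"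
  shows "measure_pmf.prob model_pmf
     {z. \<exists>x. nrm n x = 1 \<and> nrm n (mat_app n (M (fst z) (fst (snd z)) (snd (snd z))) x) < smallest_stretch} \<le> \<delta>"
proof -
  have "column_failure_bound / \<alpha> \<le> \<delta> * \<alpha> / 4 / \<alpha>"
    using column_failure_bound_le[OF assms] \<alpha> by (intro divide_right_mono) auto
  also have "\<dots> = \<delta> / 4" using \<alpha> by simp
  finally have "column_failure_bound / \<alpha> \<le> \<delta> / 4" .
  moreover have "\<delta> * \<alpha> / 16 \<le> \<delta> / 16" using \<delta> \<alpha>1 \<alpha> by (simp add: mult_left_le)
  ultimately show ?thesis using prob_contracted_vector_le sp \<delta> by linarith
qed

text \<open>The minimum is attained by its second term, since \<omega>, \<epsilon> \<le> 1 and nL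
  \<ge> 1.\<close>

lemma smallest_stretch_eq: "smallest_stretch = \<omega>\<^sup>2 * \<epsilon> / (real n * real L)"
proof -
  have n1: "1 \<le> real n" "1 \<le> real L" using K L by simp_all
  have "\<omega> / sqrt (real n) * (\<epsilon> / real L * (\<omega> / sqrt (real n))) = \<omega>\<^sup>2 * \<epsilon> / (real n * real L)"
  proof -
    have "\<omega> / r * (\<epsilon> / real L * (\<omega> / r)) = \<omega>\<^sup>2 * \<epsilon> / (r * r * real L)" for r
      by (simp add: power2_eq_square mult_ac)
    from this[of "sqrt (real n)"] show ?thesis by simp
  qed
  moreover have "\<omega>\<^sup>2 * \<epsilon> / (real n * real L) \<le> 3 * \<omega>"
  proof -
    have "1 \<le> real n * real L" using n1 mult_mono[of 1 "real n" 1 "real L"] by simp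
    then have "\<omega>\<^sup>2 * \<epsilon> / (real n * real L) \<le> \<omega>\<^sup>2 * \<epsilon> / 1"
      using \<omega> \<epsilon> by (intro divide_left_mono) auto
    also have "\<dots> \<le> \<omega>\<^sup>2 * 1" using \<epsilon> by (simp add: mult_left_le)
    also have "\<dots> \<le> \<omega> * 1" using \<omega> unfolding power2_eq_square by simp
    finally show ?thesis using \<omega> by simp
  qed
  ultimately show ?thesis unfolding smallest_stretch_def by simp
qed

end

text \<open>The coefficient \<epsilon>/(\<rho> sqrt(n)) and the norm bound \<rho> sqrt(n) of
  \<open>V\<close> multiply to \<epsilon>. Halving \<beta> turns the weak inequality of the pattern
  into the strict one required, and \<omega> is proportional to \<epsilon>.\<close>

lemma oblivious_model_of_pattern_matrix:
  fixes \<beta> \<gamma> \<rho> \<epsilon> \<alpha> :: real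
  assumes \<beta>: "0 < \<beta>" and \<gamma>: "0 < \<gamma>" and \<rho>: "0 < \<rho>" and \<epsilon>: "0 < \<epsilon>" "\<epsilon> < 1" and \<alpha>: "0 < \<alpha>"
    and K: "1 \<le> K" "K \<le> n" "K \<le> L" and n: "8 \<le> \<gamma> * real n"
    and A: "A \<in> carrier_mat n n" "spectral_norm A = 1" and pat: "pattern_matrix n \<alpha> \<beta> \<gamma> \<rho> V"
    and \<theta>: "0 < \<theta>" "\<theta> \<le> 1 / 2" "\<theta> \<le> \<beta> * sqrt \<gamma> / (72 * \<rho>)"
  shows "oblivious_model n K L (nat \<lfloor>\<alpha> * real n\<rfloor>) (mat_fun A) (mat_fun V) (\<rho> * sqrt (real n))
    (\<epsilon> * inverse (\<rho> * sqrt (real n))) \<epsilon> (\<beta> / 2) (\<gamma> * real n) (\<theta> * \<epsilon>) \<alpha>"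
proof
  have n0: "0 < real n" using K by simp
  have V: "V \<in> carrier_mat n n" "spectral_norm V \<le> \<rho> * sqrt (real n)" using pat by (auto simp: pattern_matrix_def)
  show "op_bounded n (mat_fun A) 1" using op_bounded_spectral_norm[OF A(1)] A(2) by simp
  show "op_bounded n (mat_fun V) (\<rho> * sqrt (real n))"
    using op_bounded_mono[OF op_bounded_spectral_norm[OF V(1)] V(2)] .
  show "0 < \<epsilon> * inverse (\<rho> * sqrt (real n))" using \<epsilon> \<rho> n0 by simp
  show "\<epsilon> * inverse (\<rho> * sqrt (real n)) * (\<rho> * sqrt (real n)) \<le> 1" using \<epsilon> \<rho> n0 by (simp add: field_simps)
  have m: "real (nat \<lfloor>\<alpha> * real n\<rfloor>) \<le> \<alpha> * real n" using \<alpha> by simp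
  have half: "\<gamma> * real n \<le> real (card {j. j < n \<and> \<beta> / 2 < f j})"
    if "\<gamma> * real n \<le> real (card {j. j < n \<and> \<beta> \<le> f j})" for f :: "nat \<Rightarrow> real"
  proof -
    have "card {j. j < n \<and> \<beta> \<le> f j} \<le> card {j. j < n \<and> \<beta> / 2 < f j}"
      using \<beta> by (intro card_mono) auto
    then show ?thesis using that by linarith
  qed
  fix \<eta> x :: "nat \<Rightarrow> real"
  assume \<eta>: "\<And>i. i < n \<Longrightarrow> \<eta> i \<in> {-1, 1}" and x: "nrm n x = 1"
    and sx: "card {i. i < n \<and> x i \<noteq> 0} \<le> nat \<lfloor>\<alpha> * real n\<rfloor>"
  have "real (card {i. i < n \<and> x i \<noteq> 0}) \<le> \<alpha> * real n" using sx m by linarith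
  note rows = pattern_matrix_rows[OF pat \<eta> x this]
  show "\<gamma> * real n \<le> real (card {j. j < n \<and> \<beta> / 2 < \<bar>\<Sum>i<n. mat_fun V j i * \<eta> i * x i\<bar>})"
    "\<gamma> * real n \<le> real (card {j. j < n \<and> \<beta> / 2 < \<bar>\<Sum>i<n. mat_fun V i j * \<eta> i * x i\<bar>})"
    using half[OF rows(1)] half[OF rows(2)] by simp_all
next
  have n0: "0 < real n" using K by simp
  have "\<theta>\<^sup>2 \<le> (\<beta> * sqrt \<gamma> / (72 * \<rho>))\<^sup>2" using \<theta> by (intro power_mono) auto
  also have "\<dots> = \<beta>\<^sup>2 * \<gamma> / (5184 * \<rho>\<^sup>2)" using \<gamma> by (simp add: power_divide power_mult_distrib)
  finally have th: "\<theta>\<^sup>2 \<le> \<beta>\<^sup>2 * \<gamma> / (5184 * \<rho>\<^sup>2)" .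
  have "(6 * (\<theta> * \<epsilon>))\<^sup>2 = 36 * \<epsilon>\<^sup>2 * \<theta>\<^sup>2" by (simp add: power_mult_distrib)
  also have "\<dots> \<le> 36 * \<epsilon>\<^sup>2 * (\<beta>\<^sup>2 * \<gamma> / (5184 * \<rho>\<^sup>2))" using th by (intro mult_left_mono) auto
  \<comment> \<open>The constant 72 gives 36/72^2 = 1/144, within the required 1/128. The latter is
    1/8 from \<gamma>n/4 - 1 \<ge> \<gamma>n/8 times 1/16 from (\<beta>/4)^2.\<close>
  also have "\<dots> \<le> \<epsilon>\<^sup>2 * \<beta>\<^sup>2 * \<gamma> / (128 * \<rho>\<^sup>2)" using \<rho> \<gamma> by (simp add: field_simps)
  also have "\<dots> = \<gamma> * real n / 8 * (\<epsilon> * inverse (\<rho> * sqrt (real n)) * (\<beta> / 2) / 2)\<^sup>2"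
    using \<rho> n0 by (simp add: power_divide power_mult_distrib power_inverse field_simps)
  also have "\<dots> \<le> (\<gamma> * real n / 4 - 1) * (\<epsilon> * inverse (\<rho> * sqrt (real n)) * (\<beta> / 2) / 2)\<^sup>2"
    using n by (intro mult_right_mono) auto
  finally show "(6 * (\<theta> * \<epsilon>))\<^sup>2 \<le> (\<gamma> * real n / 4 - 1) * (\<epsilon> * inverse (\<rho> * sqrt (real n)) * (\<beta> / 2) / 2)\<^sup>2" .
  show "\<theta> * \<epsilon> \<le> 1 / 2" using \<theta> \<epsilon> mult_mono[of \<theta> "1 / 2" \<epsilon> 1] by simp
  show "\<alpha> * real n \<le> real (nat \<lfloor>\<alpha> * real n\<rfloor>) + 1" using \<alpha> by linarith
qed (use assms in auto)

lemma prob_condition_number_ge: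
  fixes \<beta> \<gamma> \<rho> \<epsilon> \<alpha> \<delta> :: real
  assumes \<beta>: "0 < \<beta>" and \<gamma>: "0 < \<gamma>" "\<gamma> < 1" and \<rho>: "0 < \<rho>"
    and \<theta>: "0 < \<theta>" "\<theta> \<le> 1 / 2" "\<theta> \<le> \<beta> * sqrt \<gamma> / (72 * \<rho>)"
    and \<delta>: "0 < \<delta>" "\<delta> < 1" and \<epsilon>: "0 < \<epsilon>" "\<epsilon> < 1" and \<alpha>: "0 < \<alpha>" "\<alpha> < 1" "\<alpha> < (\<gamma> / 360)\<^sup>2"
    and K: "K = nat \<lceil>512 / (\<delta> ^ 2 * \<alpha> ^ 3)\<rceil>" and L: "L = nat \<lceil>2 * exp 1 * real K\<rceil>"
    and n: "1024 / \<gamma> / (\<delta> ^ 5 * \<alpha> ^ 9) \<le> real n"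
    and A: "A \<in> carrier_mat n n" "spectral_norm A = 1" and pat: "pattern_matrix n \<alpha> \<beta> \<gamma> \<rho> V"
  shows "1 - \<delta> \<le> measure_pmf.prob (oblivious_perturbation n V \<rho> K L)
         {(R1, R2). condition_number (A + \<epsilon> \<cdot>\<^sub>m (R1 + R2))
            \<le> ereal (10773 / \<theta>\<^sup>2 * real n / (\<epsilon> ^ 3 * \<delta> ^ 2 * \<alpha> ^ 3))}"
proof -
  define p where "p = \<delta> ^ 2 * \<alpha> ^ 3"
  have p: "0 < p" "p \<le> 1" using \<delta> \<alpha> by (auto simp: p_def power_le_one mult_le_one)
  have Kge: "512 / p \<le> real K" unfolding K p_def[symmetric] by linarith
  have p1: "1 \<le> 1 / p" using p by simp
  \<comment> \<open>The ceiling adds at most 1 \<le> 1/p, so rounding costs only the step from 512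
    to 513.\<close>
  have Kle: "real K \<le> 513 / p"
  proof -
    have "real K \<le> 512 / p + 1" unfolding K p_def[symmetric] using p by (simp add: of_nat_nat)
    also have "\<dots> \<le> 512 / p + 1 / p" using p1 by simp
    finally show ?thesis by (simp add: add_divide_distrib[symmetric])
  qed
  have K1: "1 \<le> K"
  proof -
    have "512 \<le> 512 / p" using p by (simp add: field_simps)
    then show ?thesis using Kge by linarith
  qed
  have Lge: "2 * exp 1 * real K \<le> real L" unfolding L by linarith
  have KL: "K \<le> L"
  proof -
    have "1 * real K \<le> 2 * exp 1 * real K"
      by (intro mult_right_mono) (use exp_ge_add_one_self[of "1 :: real"] in auto)
    then show ?thesis using Lge by linarith
  qed
  have Lle: "real L \<le> 7 * real K"
  proof -
    have "real L \<le> 2 * exp 1 * real K + 1" unfolding L by (simp add: of_nat_nat)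
    moreover have "2 * exp 1 * real K \<le> 2 * 3 * real K"
      using exp_le by (intro mult_right_mono mult_left_mono) auto
    ultimately show ?thesis using K1 by linarith
  qed
  have d: "0 < \<delta> ^ 5 * \<alpha> ^ 9" using \<delta> \<alpha> by simp
  have n': "1024 / \<gamma> \<le> real n * (\<delta> ^ 5 * \<alpha> ^ 9)" using n unfolding pos_divide_le_eq[OF d] .
  \<comment> \<open>As \<delta>, \<alpha> < 1, the lower bound on n covers every y with smaller
    exponents: y = p gives K \<le> n, y = 1 gives \<gamma>n \<ge> 8, and y = \<delta>\<alpha>^2
    bounds the failure on sparse vectors.\<close>
  have nx: "1024 / \<gamma> \<le> real n * y" if "\<delta> ^ 5 * \<alpha> ^ 9 \<le> y" for y
    using n' that mult_left_mono[of "\<delta> ^ 5 * \<alpha> ^ 9" y "real n"] by linarith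
  have \<gamma>1: "1024 \<le> 1024 / \<gamma>" using \<gamma> by (simp add: field_simps)
  have np: "1024 / \<gamma> \<le> real n * p"
    unfolding p_def using \<delta> \<alpha> by (intro nx mult_mono power_decreasing) auto
  have n8: "8 \<le> \<gamma> * real n"
  proof -
    have "1024 / \<gamma> \<le> real n * 1" using \<delta> \<alpha> by (intro nx mult_le_one power_le_one) auto
    then show ?thesis using \<gamma> by (simp add: field_simps)
  qed
  have Kn: "K \<le> n"
  proof -
    have "513 \<le> real n * p" using np \<gamma>1 by linarith
    then have "513 / p \<le> real n" using p by (simp add: field_simps)
    then show ?thesis using Kle by linarith
  qed
  have n480: "480 / \<gamma> \<le> real n * (\<delta> * \<alpha>\<^sup>2)"
  proof -
    have "1024 / \<gamma> \<le> real n * (\<delta> ^ 1 * \<alpha>\<^sup>2)" using \<delta> \<alpha> by (intro nx mult_mono power_decreasing) auto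
    moreover have "480 / \<gamma> \<le> 1024 / \<gamma>" using \<gamma> by (intro divide_right_mono) auto
    ultimately show ?thesis by simp
  qed
  have V: "V \<in> carrier_mat n n" using pat by (simp add: pattern_matrix_def)
  have sparse_le: "sparse_failure_bound n (nat \<lfloor>\<alpha> * real n\<rfloor>) (\<gamma> * real n) \<le> \<delta> * \<alpha> / 16"
    using \<alpha> \<gamma> \<delta> n480 by (intro sparse_failure_bound_le) auto
  note \<alpha>_less_1 = \<alpha>(2) and carriers = A(1) V
  interpret oblivious_model n K L "nat \<lfloor>\<alpha> * real n\<rfloor>" "mat_fun A" "mat_fun V" "\<rho> * sqrt (real n)"
    "\<epsilon> * inverse (\<rho> * sqrt (real n))" \<epsilon> "\<beta> / 2" "\<gamma> * real n" "\<theta> * \<epsilon>" \<alpha>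
    by (rule oblivious_model_of_pattern_matrix[OF \<beta> \<gamma>(1) \<rho> \<epsilon> \<alpha>(1) K1 Kn KL n8 A pat \<theta>])
  note bad_le = prob_contracted_vector_le_delta[OF \<delta> \<alpha>_less_1 Kge[unfolded p_def] Lge sparse_le]
  define bad where "bad = {z. \<exists>x. nrm n x = 1 \<and> nrm n (mat_app n (M (fst z) (fst (snd z)) (snd (snd z))) x) < smallest_stretch}"
  define R where "R = (\<lambda>(\<eta>, J, X). (R1_mat n V \<rho> \<eta>, R2_mat n K L J X))"
  define good where "good = {(R1, R2). condition_number (A + \<epsilon> \<cdot>\<^sub>m (R1 + R2))
            \<le> ereal (10773 / \<theta>\<^sup>2 * real n / (\<epsilon> ^ 3 * \<delta> ^ 2 * \<alpha> ^ 3))}"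
  have n0: "0 < real n" and L0: "0 < real L" using K1 Kn KL by auto
  have stretch: "smallest_stretch = \<theta>\<^sup>2 * \<epsilon> ^ 3 / (real n * real L)"
    unfolding smallest_stretch_eq by (simp add: power2_eq_square power3_eq_cube)
  have stretch_pos: "0 < smallest_stretch" unfolding stretch using \<theta> \<epsilon> n0 L0 by simp
  \<comment> \<open>The norm is at most 3 and L \<le> 7K \<le> 7 * 513 / p = 3591 / p; the constant
    10773 is 3 times 3591.\<close>
  have ratio: "3 / smallest_stretch \<le> 10773 / \<theta>\<^sup>2 * real n / (\<epsilon> ^ 3 * \<delta> ^ 2 * \<alpha> ^ 3)"
  proof -
    have "3 / smallest_stretch = 3 * real n / (\<theta>\<^sup>2 * \<epsilon> ^ 3) * real L" by (simp add: stretch)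
    also have "\<dots> \<le> 3 * real n / (\<theta>\<^sup>2 * \<epsilon> ^ 3) * (3591 / p)"
    proof (rule mult_left_mono)
      show "real L \<le> 3591 / p" using Lle Kle by simp
    qed (use \<theta> \<epsilon> in auto)
    also have "\<dots> = 10773 / \<theta>\<^sup>2 * real n / (\<epsilon> ^ 3 * p)" by simp
    finally show ?thesis by (simp add: p_def mult.assoc)
  qed
  have "1 - \<delta> \<le> 1 - measure_pmf.prob model_pmf bad" using bad_le by (simp add: bad_def)
  also have "\<dots> = measure_pmf.prob model_pmf (- bad)"
    using measure_pmf.prob_compl[of bad model_pmf] by (simp add: Compl_eq_Diff_UNIV)
  also have "\<dots> \<le> measure_pmf.prob model_pmf (R -` good)"
  proof (intro measure_pmf.finite_measure_mono_AE AE_pmfI)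
    fix z assume z: "z \<in> set_pmf model_pmf"
    obtain \<eta> J X where zz: "z = (\<eta>, J, X)" by (cases z) auto
    define N where "N = A + \<epsilon> \<cdot>\<^sub>m (R1_mat n V \<rho> \<eta> + R2_mat n K L J X)"
    have app: "nrm n (mat_app n (mat_fun N) x) = nrm n (mat_app n (M \<eta> J X) x)" for x
      unfolding N_def using mat_fun_perturbed[OF carriers] by (intro L2_set_cong mat_app_cong refl) auto
    have Nc: "N \<in> carrier_mat n n"
      by (simp add: N_def R2_mat_def hadamard_prod_def H_mat_def)
    have "op_bounded n (M \<eta> J X) 3"
      using z by (intro op_bounded_M valid_supports_support_pmf) (auto simp: zz)
    then have op: "op_bounded n (mat_fun N) 3" by (simp add: op_bounded_def app)
    show "z \<in> - bad \<longrightarrow> z \<in> R -` good"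
    proof
      assume "z \<in> - bad"
      then have "smallest_stretch \<le> nrm n (mat_app n (mat_fun N) x)" if "nrm n x = 1" for x
        using that unfolding app by (auto simp: bad_def zz not_less)
      then have "condition_number N \<le> ereal (3 / smallest_stretch)"
        using stretch_pos by (intro condition_number_le[OF Nc op]) auto
      also have "\<dots> \<le> ereal (10773 / \<theta>\<^sup>2 * real n / (\<epsilon> ^ 3 * \<delta> ^ 2 * \<alpha> ^ 3))" using ratio by simp
      finally show "z \<in> R -` good" by (simp add: R_def good_def zz N_def)
    qed
  qed auto
  also have "\<dots> = measure_pmf.prob (oblivious_perturbation n V \<rho> K L) good"
    by (simp add: oblivious_perturbation_def R_def sign_pmf_def support_pmf_def value_pmf_def)
  finally show ?thesis by (simp add: good_def)
qed

theorem theorem8p2: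
  fixes \<beta> \<gamma> \<rho> :: real
  assumes "0 < \<beta>" "\<beta> < 1" and "0 < \<gamma>" "\<gamma> < 1" and "0 < \<rho>"
  shows "\<exists>c1 c2 c3 c4 c5 :: real.
    c1 > 0 \<and> c2 > 0 \<and> c3 > 0 \<and> c4 > 0 \<and> c5 > 0 \<and>
    (\<forall>(\<delta> :: real) (\<epsilon> :: real) (\<alpha> :: real) (\<nu> :: real) (K :: nat) (L :: nat) (n :: nat)
       (A :: real mat) (V :: real mat).
       0 < \<delta> \<and> \<delta> < 1 \<and> 0 < \<epsilon> \<and> \<epsilon> < 1 \<and> 0 < \<alpha> \<and> \<alpha> < 1 \<and> \<alpha> < c1 \<and>
       \<nu> = c2 * \<epsilon> \<and>
       K = nat \<lceil>c3 / (\<delta> ^ 2 * \<alpha> ^ 3)\<rceil> \<and>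
       L = nat \<lceil>2 * exp 1 * real K\<rceil> \<and>
       real n \<ge> c4 / (\<delta> ^ 5 * \<alpha> ^ 9) \<and>
       A \<in> carrier_mat n n \<and> spectral_norm A = 1 \<and>
       pattern_matrix n \<alpha> \<beta> \<gamma> \<rho> V \<longrightarrow>
       measure_pmf.prob (oblivious_perturbation n V \<rho> K L)
         {(R1, R2). condition_number (A + \<epsilon> \<cdot>\<^sub>m (R1 + R2))
            \<le> ereal (c5 * real n / (\<epsilon> ^ 3 * \<delta> ^ 2 * \<alpha> ^ 3))}
       \<ge> 1 - \<delta>)"
proof -
  \<comment> \<open>The proportionality factor between \<omega> and \<epsilon>. It depends only on
    \<beta>, \<gamma> and \<rho>, so it may enter the constant of the final bound.\<close>
  define \<theta> where "\<theta> = min (1 / 2) (\<beta> * sqrt \<gamma> / (72 * \<rho>))"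
  have \<theta>: "0 < \<theta>" "\<theta> \<le> 1 / 2" "\<theta> \<le> \<beta> * sqrt \<gamma> / (72 * \<rho>)"
    using assms by (auto simp: \<theta>_def)
  show ?thesis
  proof (rule exI[of _ "(\<gamma> / 360)\<^sup>2"], rule exI[of _ 1], rule exI[of _ 512], rule exI[of _ "1024 / \<gamma>"],
      rule exI[of _ "10773 / \<theta>\<^sup>2"], intro conjI allI impI)
    fix \<delta> \<epsilon> \<alpha> \<nu> :: real and K L n :: nat and A V :: "real mat"
    assume *: "0 < \<delta> \<and> \<delta> < 1 \<and> 0 < \<epsilon> \<and> \<epsilon> < 1 \<and> 0 < \<alpha> \<and> \<alpha> < 1 \<and> \<alpha> < (\<gamma> / 360)\<^sup>2 \<and>
       \<nu> = 1 * \<epsilon> \<and>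
       K = nat \<lceil>512 / (\<delta> ^ 2 * \<alpha> ^ 3)\<rceil> \<and>
       L = nat \<lceil>2 * exp 1 * real K\<rceil> \<and>
       real n \<ge> 1024 / \<gamma> / (\<delta> ^ 5 * \<alpha> ^ 9) \<and>
       A \<in> carrier_mat n n \<and> spectral_norm A = 1 \<and>
       pattern_matrix n \<alpha> \<beta> \<gamma> \<rho> V"
    show "1 - \<delta> \<le> measure_pmf.prob (oblivious_perturbation n V \<rho> K L)
         {(R1, R2). condition_number (A + \<epsilon> \<cdot>\<^sub>m (R1 + R2))
            \<le> ereal (10773 / \<theta>\<^sup>2 * real n / (\<epsilon> ^ 3 * \<delta> ^ 2 * \<alpha> ^ 3))}"
      using * assms by (intro prob_condition_number_ge[OF _ _ _ _ \<theta>]) auto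
  qed (use assms \<theta> in auto)
qed

end
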